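(* Every outerplanar graph, regarded as a simplicial complex of dimension at most $1$, is $2$-Tverberg.
   Context: All graphs are finite and simple. A graph is outerplanar if it can be drawn in the plane without crossings with all vertices on the boundary of the outer face. Given a finite set $S\subset\mathbb{R}^d$ and a partition $P=(S_1,\dots,S_m)$ of $S$ into nonempty parts, the nerve $\mathcal{N}(P)$ is the simplicial complex on vertex set $\{1,\dots,m\}$ whose faces are the $I\subset\{1,\dots,m\}$ with $\bigcap_{i\in I}\operatorname{conv}(S_i)\neq\emptyset$. A simplicial complex $\mathcal{K}$ is $d$-Tverberg if there is a constant $N$ such that for every finite point set $S\subset\mathbb{R}^d$ with at least $N$ points there is a partition $P$ of $S$ with $\mathcal{N}(P)$ isomorphic to $\mathcal{K}$. A graph is regarded as the simplicial complex whose faces are its vertices and edges (triangles of the graph are not filled in).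
   Formalization: In the definition of 2-Tverberg the point sets S are required to be in general position (no three collinear), since collinear sets make the claim false for the unfilled triangle; the graph is assumed to have at least one vertex. *)

theory Defs
  imports "HOL-Analysis.Analysis"
begin

definition simple_graph :: "'v set \<Rightarrow> 'v set set \<Rightarrow> bool" where
  "simple_graph V E \<longleftrightarrow> finite V \<and> (\<forall>e\<in>E. e \<subseteq> V \<and> card e = 2)"

(* The plane is taken to be complex, the type of the library's Jordan curve theorem. *)
definition plane_drawing ::
    "'v set \<Rightarrow> 'v set set \<Rightarrow> ('v \<Rightarrow> complex) \<Rightarrow> ('v set \<Rightarrow> real \<Rightarrow> complex) \<Rightarrow> bool" where
  "plane_drawing V E p \<gamma> \<longleftrightarrow>
     inj_on p V \<and>
     (\<forall>e\<in>E. arc (\<gamma> e) \<and> {pathstart (\<gamma> e), pathfinish (\<gamma> e)} = p ` e) \<and>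
     (\<forall>e\<in>E. path_image (\<gamma> e) \<inter> p ` V = p ` e) \<and>
     (\<forall>e\<in>E. \<forall>f\<in>E. e \<noteq> f \<longrightarrow> path_image (\<gamma> e) \<inter> path_image (\<gamma> f) = p ` (e \<inter> f))"

definition drawing_image ::
    "'v set \<Rightarrow> 'v set set \<Rightarrow> ('v \<Rightarrow> complex) \<Rightarrow> ('v set \<Rightarrow> real \<Rightarrow> complex) \<Rightarrow> complex set" where
  "drawing_image V E p \<gamma> = p ` V \<union> (\<Union>e\<in>E. path_image (\<gamma> e))"

(* The image of a drawing of a finite graph is compact, so its complement has exactly one
   unbounded component, the outer face, which is the library's outside of the image. *)
definition outerplanar :: "'v set \<Rightarrow> 'v set set \<Rightarrow> bool" where
  "outerplanar V E \<longleftrightarrow>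
     (\<exists>p \<gamma>. plane_drawing V E p \<gamma> \<and> p ` V \<subseteq> frontier (outside (drawing_image V E p \<gamma>)))"

(* Abstract simplicial complexes are given by their sets of faces, the empty face included;
   the vertex set of K is \<Union>K. *)
definition graph_complex :: "'v set \<Rightarrow> 'v set set \<Rightarrow> 'v set set" where
  "graph_complex V E = {{}} \<union> {{v} |v. v \<in> V} \<union> E"

definition complex_isomorphic :: "'a set set \<Rightarrow> 'b set set \<Rightarrow> bool" where
  "complex_isomorphic K L \<longleftrightarrow>
     (\<exists>f. bij_betw f (\<Union>K) (\<Union>L) \<and> (\<forall>\<sigma>. \<sigma> \<subseteq> \<Union>K \<longrightarrow> (\<sigma> \<in> K \<longleftrightarrow> f ` \<sigma> \<in> L)))"

definition indexed_partition :: "nat \<Rightarrow> (nat \<Rightarrow> 'a set) \<Rightarrow> 'a set \<Rightarrow> bool" where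
  "indexed_partition m P S \<longleftrightarrow>
     (\<forall>i\<in>{1..m}. P i \<noteq> {}) \<and> disjoint_family_on P {1..m} \<and> (\<Union>i\<in>{1..m}. P i) = S"

(* The empty intersection is the whole space, so the empty face belongs to the nerve. *)
definition nerve :: "nat \<Rightarrow> (nat \<Rightarrow> (real^'d) set) \<Rightarrow> nat set set" where
  "nerve m P = {I. I \<subseteq> {1..m} \<and> (\<Inter>i\<in>I. convex hull (P i)) \<noteq> {}}"

definition general_position :: "(real^'d) set \<Rightarrow> bool" where
  "general_position S \<longleftrightarrow>
     (\<forall>T. T \<subseteq> S \<and> finite T \<and> card T \<le> CARD('d) + 1 \<longrightarrow> \<not> affine_dependent T)"

(* The point sets have to be in general position: convex hulls of collinear sets satisfy
   Helly's theorem for intervals, so on a collinear set no partition has the unfilled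
   triangle as its nerve. *)
definition d_Tverberg :: "'d::finite itself \<Rightarrow> 'v set set \<Rightarrow> bool" where
  "d_Tverberg d K \<longleftrightarrow>
     (\<exists>N. \<forall>S :: (real^'d) set. finite S \<and> general_position S \<and> N \<le> card S \<longrightarrow>
        (\<exists>m P. indexed_partition m P S \<and> complex_isomorphic (nerve m P) K))"

end

theory Submission
  imports Defs "HOL-Complex_Analysis.Winding_Numbers" "HOL-Library.Ramsey"
begin

text \<open>The vertices of an outerplanar graph can be listed so that no two edges cross when the vertices
  are placed on a circle in this order. Indeed, among three internally disjoint arcs with common end
  points one runs inside the closed curve formed by the other two, so an outerplanar drawing contains
  neither three internally disjoint paths of length at least 2 between two vertices, nor a cycle with two crossing
  chords, and such an order exists in every graph without these two configurations.

  Conversely, let the order \<open>v\<^sub>1, \<dots>, v\<^sub>m\<close> be noncrossing. By Ramsey's theorem, a large point set in general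
  position contains a long convex chain \<open>q\<^sub>0, q\<^sub>1, \<dots>\<close> which is homogeneous with respect to the positions of
  lines through its points. Starting from the two ends of the order, insert the vertices one by one: the new vertex
  gets a convex set cut off by a chord of the chain, and the set of one older vertex is trimmed. The sets cover the
  plane, no three of them have a common point, and two of them meet only if the vertices are adjacent. Each part
  of the partition lies in its own set, so the nerve contains no other faces than those of the graph. The points of
  the chain are distributed such that for each edge \<open>uv\<close> four of them are labelled \<open>u, v, u, v\<close> in this
  order along the chain, which makes the hulls of the two parts meet.\<close>

subsection \<open>Half-planes cut off a convex chain\<close>


text \<open>The sets have to cover the plane because nothing is known about the points of
  \<open>S\<close> off the chain: each of them joins the part of any set that contains it, and the
  nerve is then controlled by the sets alone. The delicate step is the insertion of a vertex
  \<open>y\<close> adjacent to both \<open>a\<close> and \<open>b\<close>. The cap of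
  \<open>y\<close> meets the set of \<open>b\<close>, so the set of \<open>a\<close> must lose a
  half-plane that contains this intersection, keep points in common with the cap, and leave nothing
  uncovered. A half-plane bounded by a line through the crossing point of the two chords achieves
  this. Such lines are the reason for the conditions on a chain beyond convex position: it must be
  known which points they cut off, and that later, smaller cuts do not reach beyond earlier ones.
  Ramsey's theorem leaves a sign undetermined in each condition. The sign for triples is absorbed by
  \<open>\<epsilon>\<close>, the one for pairs of chords is matched to it by reversing the chain if
  necessary, and the one for six points is forced as soon as there are seven points.\<close>

definition cross2 :: "real^2 \<Rightarrow> real^2 \<Rightarrow> real" where
  "cross2 u v = u $ 1 * v $ 2 - u $ 2 * v $ 1"

definition affine_fun :: "(real^2 \<Rightarrow> real) \<Rightarrow> bool" where
  "affine_fun h \<longleftrightarrow> (\<exists>u k. \<forall>x. h x = u \<bullet> x + k)"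

lemma affine_funE:
  assumes "affine_fun h"
  obtains u1 u2 k where "\<And>x. h x = u1 * x $ 1 + u2 * x $ 2 + k"
proof -
  obtain u k where "\<And>x. h x = u \<bullet> x + k" using assms unfolding affine_fun_def by blast
  then show ?thesis using that[of "u $ 1" "u $ 2" k] by (simp add: inner_vec_def sum_2)
qed

lemma affine_funI: "(\<And>x. h x = u1 * x $ 1 + u2 * x $ 2 + k) \<Longrightarrow> affine_fun h"
  unfolding affine_fun_def
  by (rule exI[of _ "vector [u1, u2]"], rule exI[of _ k]) (simp add: inner_vec_def sum_2)

lemma convex_pos_affine_fun: "affine_fun h \<Longrightarrow> convex {x. 0 < h x}"
proof -
  assume "affine_fun h"
  then obtain u k where *: "\<And>x. h x = u \<bullet> x + k" unfolding affine_fun_def by blast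
  have "{x. 0 < h x} = {x. u \<bullet> x > - k}" using * by auto
  then show ?thesis by (simp add: convex_halfspace_gt)
qed

lemma convex_nonpos_affine_fun: "affine_fun h \<Longrightarrow> convex (- {x. 0 < h x})"
proof -
  assume "affine_fun h"
  then obtain u k where *: "\<And>x. h x = u \<bullet> x + k" unfolding affine_fun_def by blast
  have "- {x. 0 < h x} = {x. u \<bullet> x \<le> - k}" using * by auto
  then show ?thesis by (simp add: convex_halfspace_le)
qed

lemma affine_fun_lin_comb:
  assumes "affine_fun f" "affine_fun g" shows "affine_fun (\<lambda>x. s * f x + t * g x)"
proof -
  obtain a1 a2 a3 where f: "\<And>x. f x = a1 * x $ 1 + a2 * x $ 2 + a3" using affine_funE[OF assms(1)] by blast
  obtain b1 b2 b3 where g: "\<And>x. g x = b1 * x $ 1 + b2 * x $ 2 + b3" using affine_funE[OF assms(2)] by blast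
  show ?thesis
    by (rule affine_funI[where ?u1.0="s*a1+t*b1" and ?u2.0="s*a2+t*b2" and k="s*a3+t*b3"]) (simp add: f g algebra_simps)
qed

text \<open>The conditions \<open>quad\<close> and \<open>six\<close> prescribe on which side the lines through \<open>q i\<close>, \<open>q l\<close> and through \<open>q j\<close>, \<open>q k\<close>
  meet, and on which side of the line through \<open>q i\<close> and the common point of two chords the point \<open>q j\<close> lies.
  They do not follow from convex position.\<close>

locale chain =
  fixes q :: "nat \<Rightarrow> real^2" and n :: nat and \<epsilon> :: real
  fixes side :: "nat \<Rightarrow> nat \<Rightarrow> real^2 \<Rightarrow> real"
  defines side_def: "side a b x \<equiv> \<epsilon> * cross2 (x - q a) (q b - q a)"
  assumes tri: "\<lbrakk>i < j; j < k; k < n\<rbrakk> \<Longrightarrow> 0 < side i k (q j)"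
    and quad: "\<lbrakk>i < j; j < k; k < l; l < n\<rbrakk> \<Longrightarrow> 0 \<le> \<epsilon> * cross2 (q l - q i) (q k - q j)"
    and six: "\<lbrakk>a < i; i < c; c < b; b < j; j < d; d < n\<rbrakk> \<Longrightarrow>
        side a b (q i) * side c d (q j) \<le> side c d (q i) * side a b (q j)"
begin

lemma affine_fun_side: "affine_fun (side a b)"
  by (rule affine_funI[where ?u1.0="\<epsilon> * (q b $ 2 - q a $ 2)" and ?u2.0="- \<epsilon> * (q b $ 1 - q a $ 1)"
        and k = "\<epsilon> * (- q a $ 1 * (q b $ 2 - q a $ 2) + q a $ 2 * (q b $ 1 - q a $ 1))"])
    (simp add: side_def cross2_def algebra_simps)

lemma side_left [simp]: "side a b (q a) = 0" and side_right [simp]: "side a b (q b) = 0"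
  by (simp_all add: side_def cross2_def)

lemma side_neg_left: "\<lbrakk>x < a; a < b; b < n\<rbrakk> \<Longrightarrow> side a b (q x) < 0"
  using tri[of x a b] by (simp add: side_def cross2_def algebra_simps)

lemma side_neg_right: "\<lbrakk>a < b; b < x; x < n\<rbrakk> \<Longrightarrow> side a b (q x) < 0"
  using tri[of a b x] by (simp add: side_def cross2_def algebra_simps)

lemma side_pos_iff: "\<lbrakk>a < b; b < n; x < n\<rbrakk> \<Longrightarrow> 0 < side a b (q x) \<longleftrightarrow> a < x \<and> x < b"
  using tri[of a x b] side_neg_left[of x a b] side_neg_right[of a b x]
  by (metis less_irrefl linorder_neqE_nat not_less_iff_gr_or_eq side_left side_right)

text \<open>The line \<open>h = 0\<close> cuts the points \<open>q (i + 1), \<dots>, q b\<close> off the chain. The last condition determines on which side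
  it meets the chords that pass over it.\<close>

definition cap :: "(real^2 \<Rightarrow> real) \<Rightarrow> nat \<Rightarrow> nat \<Rightarrow> bool" where
  "cap h i b \<longleftrightarrow> affine_fun h \<and> (\<forall>j<n. 0 < h (q j) \<longleftrightarrow> i < j \<and> j \<le> b) \<and>
     (\<forall>u v. u < i \<longrightarrow> b + 1 < v \<longrightarrow> v < n \<longrightarrow> h (q u) \<le> h (q v))"

lemma cap_affine: "cap h i b \<Longrightarrow> affine_fun h"
  and cap_pos_iff: "cap h i b \<Longrightarrow> j < n \<Longrightarrow> 0 < h (q j) \<longleftrightarrow> i < j \<and> j \<le> b"
  and cap_mono: "cap h i b \<Longrightarrow> u < i \<Longrightarrow> b + 1 < v \<Longrightarrow> v < n \<Longrightarrow> h (q u) \<le> h (q v)"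
  by (auto simp: cap_def)

text \<open>The difference \<open>side a b (q v) - side a b (q u)\<close> is the expression in
  \<open>quad\<close>. The last index cut off is \<open>b - 1\<close> because \<open>q b\<close>
  lies on the line.\<close>

lemma cap_side:
  assumes "a < b" "b < n" shows "cap (side a b) a (b - 1)"
  unfolding cap_def
proof (intro conjI allI impI)
  show "affine_fun (side a b)" by (rule affine_fun_side)
  show "0 < side a b (q j) \<longleftrightarrow> a < j \<and> j \<le> b - 1" if "j < n" for j
    using side_pos_iff[OF assms that] assms by auto
  show "side a b (q u) \<le> side a b (q v)" if "u < a" "b - 1 + 1 < v" "v < n" for u v
    using quad[of u a b v] that assms by (simp add: side_def cross2_def algebra_simps)
qed

text \<open>The zero set is the line through \<open>q i\<close> and the common point of the lines \<open>side a b = 0\<close> and \<open>side c d = 0\<close>.\<close>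

definition pencil :: "nat \<Rightarrow> nat \<Rightarrow> nat \<Rightarrow> nat \<Rightarrow> nat \<Rightarrow> real^2 \<Rightarrow> real" where
  "pencil a b c d i x = side a b (q i) * side c d x - side c d (q i) * side a b x"

lemma affine_fun_pencil: "affine_fun (pencil a b c d i)"
  using affine_fun_lin_comb[OF affine_fun_side affine_fun_side, of "side a b (q i)" c d "- side c d (q i)" a b]
  by (simp add: pencil_def[abs_def])

text \<open>For \<open>b < j < d\<close> the answer is the content of \<open>six\<close>; elsewhere
  the signs of the two side functions or a determinant identity decide.\<close>

lemma pencil_pos_iff:
  assumes "a < i" "i < c" "c < b" "b < d" "d < n" "j < n"
  shows "0 < pencil a b c d i (q j) \<longleftrightarrow> i < j \<and> j \<le> b"
proof -
  have fi: "0 < side a b (q i)" using assms by (intro tri) auto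
  have gi: "side c d (q i) < 0" using assms by (intro side_neg_left) auto
  \<comment> \<open>A Pluecker-type identity turns the determinant into a sum of two products of
    orientations, all positive by \<open>tri\<close>. It settles the points between
    \<open>q a\<close> and \<open>q c\<close>.\<close>
  have key: "0 < side a b (q x) * side c d (q y) - side c d (q x) * side a b (q y)"
    if "a < x" "x < y" "y < c" for x y
  proof -
    have "0 < side x c (q y)" "0 < side a d (q b)" "0 < side x d (q y)" "0 < side a b (q c)"
      using that assms by (auto intro!: tri)
    then have "0 < side x c (q y) * side a d (q b) + side x d (q y) * side a b (q c)"
      by (simp add: add_pos_pos)
    also have "\<dots> = side a b (q x) * side c d (q y) - side c d (q x) * side a b (q y)"
      unfolding side_def cross2_def by (simp add: algebra_simps)
    finally show ?thesis .
  qed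
  consider "j \<le> a" | "a < j" "j < i" | "j = i" | "i < j" "j < c" | "j = c" | "c < j" "j < b" | "j = b"
    | "b < j" "j < d" | "d \<le> j" by linarith
  then show ?thesis
  proof cases
    case 1
    have "side c d (q j) < 0" using 1 assms by (intro side_neg_left) auto
    moreover have "side a b (q j) \<le> 0" using 1 assms side_pos_iff[of a b j] by (auto simp: not_less[symmetric])
    ultimately have "side a b (q i) * side c d (q j) \<le> 0" "0 \<le> side c d (q i) * side a b (q j)"
      using fi gi by (auto intro: mult_nonneg_nonpos mult_nonpos_nonpos)
    then show ?thesis using 1 assms by (auto simp: pencil_def)
  next
    case 2
    then show ?thesis using key[of j i] assms by (auto simp: pencil_def algebra_simps)
  next
    case 3 then show ?thesis by (simp add: pencil_def)
  next
    case 4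
    then show ?thesis using key[of i j] assms by (auto simp: pencil_def)
  next
    case 5
    have "0 < side a b (q j)" using 5 assms by (intro tri) auto
    then show ?thesis using 5 gi assms by (auto simp: pencil_def mult_neg_pos)
  next
    case 6
    have "0 < side a b (q j)" "0 < side c d (q j)" using 6 assms by (auto intro!: tri)
    then have "0 < side a b (q i) * side c d (q j)" "side c d (q i) * side a b (q j) < 0"
      using fi gi by (auto intro: mult_neg_pos)
    then show ?thesis using 6 assms by (auto simp: pencil_def)
  next
    case 7
    have "0 < side c d (q j)" using 7 assms by (auto intro!: tri)
    then show ?thesis using 7 fi assms by (auto simp: pencil_def)
  next
    case 8
    then show ?thesis using six[of a i c b j d] assms by (auto simp: pencil_def)
  next
    case 9
    have "side a b (q j) < 0" using 9 assms by (intro side_neg_right) auto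
    moreover have "side c d (q j) \<le> 0" using 9 assms side_pos_iff[of c d j] by (auto simp: not_less[symmetric])
    ultimately have "side a b (q i) * side c d (q j) \<le> 0" "0 \<le> side c d (q i) * side a b (q j)"
      using fi gi by (auto intro: mult_nonneg_nonpos mult_nonpos_nonpos)
    then show ?thesis using 9 assms by (auto simp: pencil_def)
  qed
qed

text \<open>The line passes through \<open>q i\<close>. A second point of it, between
  \<open>q b\<close> and \<open>q (b + 1)\<close>, makes its direction accessible to
  \<open>quad\<close>, which speaks of chords.\<close>

lemma pencil_zero:
  assumes "a < i" "i < c" "c < b" "b + 1 < d" "d < n"
  obtains s where "0 \<le> s" "s \<le> 1" "pencil a b c d i ((1 - s) *\<^sub>R q b + s *\<^sub>R q (b + 1)) = 0"
proof -
  let ?h = "pencil a b c d i"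
  obtain u1 u2 k where h: "\<And>x. ?h x = u1 * x $ 1 + u2 * x $ 2 + k" using affine_funE[OF affine_fun_pencil] by blast
  have 1: "0 < ?h (q b)" using pencil_pos_iff[of a i c b d b] assms by auto
  have 2: "?h (q (b+1)) \<le> 0" using pencil_pos_iff[of a i c b d "b+1"] assms by (auto simp: not_less[symmetric])
  define s where "s = ?h (q b) / (?h (q b) - ?h (q (b+1)))"
  have "?h ((1 - s) *\<^sub>R q b + s *\<^sub>R q (b + 1)) = (1 - s) * ?h (q b) + s * ?h (q (b+1))"
    by (simp add: h algebra_simps)
  also have "\<dots> = 0" using 1 2 by (simp add: s_def field_simps)
  finally show ?thesis using that[of s] 1 2 by (simp add: s_def)
qed

text \<open>The direction of the line is a convex combination of the directions of the chords from
  \<open>q i\<close> to \<open>q b\<close> and to \<open>q (b + 1)\<close>, and \<open>quad\<close>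
  for these two chords gives the monotonicity.\<close>

lemma cap_pencil:
  assumes "a < i" "i < c" "c < b" "b + 1 < d" "d < n"
  shows "cap (pencil a b c d i) i b"
  unfolding cap_def
proof (intro conjI allI impI)
  let ?h = "pencil a b c d i"
  show "affine_fun ?h" by (rule affine_fun_pencil)
  show "0 < ?h (q j) \<longleftrightarrow> i < j \<and> j \<le> b" if "j < n" for j
    using pencil_pos_iff[of a i c b d j] that assms by auto
  fix u v assume uv: "u < i" "b + 1 < v" "v < n"
  obtain u1 u2 k where h: "\<And>x. ?h x = u1 * x $ 1 + u2 * x $ 2 + k" using affine_funE[OF affine_fun_pencil] by blast
  obtain s where s: "0 \<le> s" "s \<le> 1" and z: "?h ((1 - s) *\<^sub>R q b + s *\<^sub>R q (b + 1)) = 0"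
    using pencil_zero[OF assms] by blast
  let ?e = "(1 - s) *\<^sub>R q b + s *\<^sub>R q (b + 1)"
  have hi: "?h (q i) = 0" by (simp add: pencil_def)
  have pos: "0 < ?h (q c)" using pencil_pos_iff[of a i c b d c] assms by auto
  have w: "0 < \<epsilon> * cross2 (q c - q i) (?e - q i)"
  proof -
    have "0 < side i b (q c)" "0 < side i (b+1) (q c)" using assms by (auto intro!: tri)
    then have "0 < (1 - s) * side i b (q c) + s * side i (b+1) (q c)"
      using s by (cases "s = 0") (auto intro: add_nonneg_pos)
    also have "\<dots> = \<epsilon> * cross2 (q c - q i) (?e - q i)" by (simp add: side_def cross2_def algebra_simps)
    finally show ?thesis .
  qed
  have d: "\<epsilon> * cross2 (q u - q v) (?e - q i) \<le> 0"
  proof -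
    have "0 \<le> \<epsilon> * cross2 (q v - q u) (q b - q i)" "0 \<le> \<epsilon> * cross2 (q v - q u) (q (b+1) - q i)"
      using uv assms by (auto intro!: quad)
    then have "0 \<le> (1 - s) * (\<epsilon> * cross2 (q v - q u) (q b - q i)) + s * (\<epsilon> * cross2 (q v - q u) (q (b+1) - q i))"
      using s by (intro add_nonneg_nonneg mult_nonneg_nonneg[of "1 - s"] mult_nonneg_nonneg[of s]) auto
    also have "\<dots> = - (\<epsilon> * cross2 (q u - q v) (?e - q i))" by (simp add: cross2_def algebra_simps)
    finally show ?thesis by simp
  qed
  \<comment> \<open>Cramer's rule \<open>cross2 x y * z = cross2 z y * x + cross2 x z * y\<close>
    for plane vectors, under the linear part of \<open>?h\<close>. Since \<open>?h\<close> vanishes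
    at \<open>q i\<close> and \<open>?e\<close>, only the positive value at \<open>q c\<close>
    remains on the right.\<close>
  have id: "(\<epsilon> * cross2 (q c - q i) (?e - q i)) * (?h (q u) - ?h (q v))
      = (\<epsilon> * cross2 (q u - q v) (?e - q i)) * (?h (q c) - ?h (q i)) +
        (\<epsilon> * cross2 (q c - q i) (q u - q v)) * (?h ?e - ?h (q i))"
    unfolding h cross2_def by (simp add: algebra_simps)
  have "(\<epsilon> * cross2 (q c - q i) (?e - q i)) * (?h (q u) - ?h (q v)) \<le> 0"
    unfolding id using z hi pos d by (simp add: mult_nonpos_nonneg)
  then show "?h (q u) \<le> ?h (q v)" using mult_le_cancel_left_pos[OF w, of "?h (q u) - ?h (q v)" 0] by linarith
qed

text \<open>Let O be the point where the zero line of the pencil meets the line through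
  \<open>q a\<close> and \<open>q b\<close>. By the monotonicity of \<open>h2\<close> along the
  chain, \<open>h2\<close> does not decrease from \<open>q i\<close> to O, nor when \<open>x\<close>
  is moved in this direction onto the line through \<open>q a\<close> and \<open>q b\<close>. If the
  pencil were not positive at \<open>x\<close>, the point reached would not lie beyond
  \<open>q b\<close>, and there \<open>h2\<close> is not positive. The lemma confines the caps used
  in later insertions.\<close>

lemma cap_inside:
  assumes abcd: "a < i" "i < c" "c < b" "b + 1 < d" "d < n"
    and cap: "cap h2 j k" and "i < j" "k + 1 < b"
    and x: "0 < side a b x" "0 < h2 x"
  shows "0 < pencil a b c d i x"
proof (rule ccontr)
  let ?h = "pencil a b c d i"
  assume "\<not> 0 < ?h x"
  then have hx: "?h x \<le> 0" by simp
  obtain u1 u2 u3 where h: "\<And>x. ?h x = u1 * x $ 1 + u2 * x $ 2 + u3" using affine_funE[OF affine_fun_pencil] by blast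
  obtain v1 v2 v3 where h2: "\<And>x. h2 x = v1 * x $ 1 + v2 * x $ 2 + v3" using affine_funE[OF cap_affine[OF cap]] by blast
  obtain s where s: "0 \<le> s" "s \<le> 1" and z: "?h ((1 - s) *\<^sub>R q b + s *\<^sub>R q (b + 1)) = 0"
    using pencil_zero[OF abcd] by blast
  let ?e = "(1 - s) *\<^sub>R q b + s *\<^sub>R q (b + 1)"
  let ?A = "q a" and ?B = "q b" and ?P = "q i"
  define D where "D = side a b ?P"
  have D: "0 < D" unfolding D_def using abcd by (auto intro!: tri)
  \<comment> \<open>Barycentric coordinates with respect to \<open>?A\<close>, \<open>?B\<close>,
    \<open>?P\<close>.\<close>
  define al where "al x = \<epsilon> * cross2 (?P - x) (?B - x) / D" for x
  define be where "be x = \<epsilon> * cross2 (?P - ?A) (x - ?A) / D" for x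
  define ga where "ga x = side a b x / D" for x
  have Dal: "D * al x = \<epsilon> * cross2 (?P - x) (?B - x)" and Dbe: "D * be x = \<epsilon> * cross2 (?P - ?A) (x - ?A)"
    and Dga: "D * ga x = side a b x" for x
    using D by (simp_all add: al_def be_def ga_def)
  have bary: "F x = al x * F ?A + be x * F ?B + ga x * F ?P"
    if F: "\<And>x. F x = w1 * x $ 1 + w2 * x $ 2 + w3" for F :: "real^2 \<Rightarrow> real" and w1 w2 w3 x
  proof -
    have "D * (al x * F ?A + be x * F ?B + ga x * F ?P)
        = (D * al x) * F ?A + (D * be x) * F ?B + (D * ga x) * F ?P" by (simp add: algebra_simps)
    also have "\<dots> = D * F x"
      unfolding Dal Dbe Dga unfolding F D_def side_def cross2_def by (simp add: algebra_simps)
    finally show ?thesis using D by simp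
  qed
  have sum1: "al x + be x + ga x = 1" for x
  proof -
    have "1 = al x * 1 + be x * 1 + ga x * 1" by (rule bary[of "\<lambda>_. 1" 0 0 1]) simp
    then show ?thesis by linarith
  qed
  define hA hB where "hA = ?h ?A" and "hB = ?h ?B"
  have hB: "0 < hB" using pencil_pos_iff[of a i c b d b] abcd by (auto simp: hB_def)
  have hA: "hA < 0"
  proof -
    have "0 < side a b (q i)" using abcd by (intro tri) auto
    moreover have "side c d (q a) < 0" using abcd by (intro side_neg_left) auto
    ultimately show ?thesis by (simp add: hA_def pencil_def mult_pos_neg)
  qed
  have hP: "?h ?P = 0" by (simp add: pencil_def)
  have AB: "h2 ?A \<le> h2 ?B" using abcd assms by (intro cap_mono[OF cap]) auto
  have B0: "h2 ?B \<le> 0" using cap_pos_iff[OF cap, of b] abcd assms by (auto simp: not_less[symmetric])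
  have Pe: "h2 ?P \<le> h2 ?e"
  proof -
    have "h2 ?P \<le> h2 (q b)" "h2 ?P \<le> h2 (q (b+1))" using abcd assms by (auto intro!: cap_mono[OF cap])
    then have "(1 - s) * h2 ?P + s * h2 ?P \<le> (1 - s) * h2 (q b) + s * h2 (q (b+1))"
      using s by (intro add_mono mult_left_mono) auto
    also have "\<dots> = h2 ?e" by (simp add: h2 algebra_simps)
    finally show ?thesis by (simp add: algebra_simps)
  qed
  have ge: "ga ?e \<le> 0"
  proof -
    have "side a b ?e = s * side a b (q (b+1))" by (simp add: side_def cross2_def algebra_simps)
    moreover have "side a b (q (b+1)) < 0" using abcd by (intro side_neg_right) auto
    ultimately have "side a b ?e \<le> 0" using s by (simp add: mult_nonneg_nonpos)
    then show ?thesis using D by (simp add: ga_def divide_nonpos_pos)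
  qed
  \<comment> \<open>\<open>t\<close> and \<open>1 - t\<close> are the coordinates of O. As
    \<open>ga ?e \<le> 0\<close>, O lies between \<open>?P\<close> and \<open>?e\<close>, so the
    comparison \<open>Pe\<close> passes on to O.\<close>
  define t where "t = hB / (hB - hA)"
  have t: "0 < t" "t < 1" "t * hA + (1 - t) * hB = 0" using hA hB by (auto simp: t_def field_simps)
  have he0: "al ?e * hA + be ?e * hB = 0" using bary[of ?h, OF h, of ?e] unfolding z hP hA_def hB_def by linarith
  have ae: "al ?e = (1 - ga ?e) * t"
  proof -
    have b: "be ?e = 1 - ga ?e - al ?e" using sum1[of ?e] by simp
    have "al ?e * (hB - hA) = (1 - ga ?e) * hB" using he0 unfolding b by (simp add: algebra_simps)
    then show ?thesis using hA hB by (simp add: t_def field_simps)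
  qed
  have be: "be ?e = (1 - ga ?e) * (1 - t)" using sum1[of ?e] ae by (simp add: algebra_simps)
  have O: "h2 ?P \<le> t * h2 ?A + (1 - t) * h2 ?B"
  proof -
    have "(1 - ga ?e) * h2 ?P \<le> al ?e * h2 ?A + be ?e * h2 ?B"
      using Pe unfolding bary[of h2, OF h2, of ?e] by (simp add: algebra_simps)
    also have "\<dots> = (1 - ga ?e) * (t * h2 ?A + (1 - t) * h2 ?B)" unfolding ae be by (simp add: algebra_simps)
    finally show ?thesis
      using ge mult_le_cancel_left_pos[of "1 - ga ?e" "h2 ?P" "t * h2 ?A + (1 - t) * h2 ?B"] by linarith
  qed
  have gx: "0 < ga x" using x D by (simp add: ga_def)
  \<comment> \<open>The position on the line through \<open>?A\<close> and \<open>?B\<close> that is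
    reached from \<open>x\<close> by moving in the direction from \<open>?P\<close> to O.\<close>
  define w where "w = be x + ga x * (1 - t)"
  have w: "(1 - w) * hA + w * hB \<le> 0"
  proof -
    have "?h x = al x * hA + be x * hB" using bary[of ?h, OF h, of x] unfolding hP hA_def hB_def by linarith
    moreover have "(1 - w) * hA + w * hB = al x * hA + be x * hB + ga x * (t * hA + (1 - t) * hB)"
    proof -
      have al: "al x = 1 - be x - ga x" using sum1[of x] by simp
      show ?thesis unfolding al w_def by (simp add: algebra_simps)
    qed
    ultimately show ?thesis using hx t by simp
  qed
  have w1: "w \<le> 1"
  proof (rule ccontr)
    assume "\<not> w \<le> 1"
    then have "0 < (1 - w) * hA" "0 < w * hB" using hA hB by (auto intro: mult_neg_neg)
    then show False using w by simp
  qed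
  have "h2 x = al x * h2 ?A + be x * h2 ?B + ga x * h2 ?P" by (rule bary[of h2, OF h2])
  also have "\<dots> \<le> al x * h2 ?A + be x * h2 ?B + ga x * (t * h2 ?A + (1 - t) * h2 ?B)"
    using O gx by simp
  also have "\<dots> = h2 ?A + w * (h2 ?B - h2 ?A)"
  proof -
    have al: "al x = 1 - be x - ga x" using sum1[of x] by simp
    show ?thesis unfolding al w_def by (simp add: algebra_simps)
  qed
  also have "\<dots> \<le> h2 ?A + 1 * (h2 ?B - h2 ?A)" using w1 AB by (intro add_left_mono mult_right_mono) auto
  also have "\<dots> \<le> 0" using B0 by simp
  finally show False using x by simp
qed

lemma inj_on_q:
  assumes "3 \<le> n" shows "inj_on q {..<n}"
proof (rule linorder_inj_onI)
  fix i j assume ij: "i < j" "i \<in> {..<n}" "j \<in> {..<n}"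
  show "q i \<noteq> q j"
  proof
    assume eq: "q i = q j"
    have "\<exists>k<3. k \<noteq> i \<and> k \<noteq> j" by presburger
    then obtain k where "k < n" "k \<noteq> i" "k \<noteq> j" using assms less_le_trans by blast
    then consider "k < i" | "i < k" "k < j" | "j < k" by linarith
    then show False
    proof cases
      case 1 then show False using tri[of k i j] eq ij by (simp add: side_def cross2_def)
    next
      case 2 then show False using tri[of i k j] eq ij by (simp add: side_def cross2_def)
    next
      case 3 then show False using tri[of i j k] eq ij \<open>k < n\<close> by (simp add: side_def cross2_def)
    qed
  qed
qed auto

text \<open>Diagonals of a convex quadrilateral; the values of \<open>side\<close> at the end points
  are, up to sign, the weights of the common point.\<close>

lemma segments_cross:
  assumes "i < j" "j < k" "k < l" "l < n"
  shows "convex hull {q i, q k} \<inter> convex hull {q j, q l} \<noteq> {}"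
proof -
  define a where "a = side j l (q i)"
  define b where "b = side j l (q k)"
  define c where "c = side i k (q j)"
  define d where "d = side i k (q l)"
  have a: "a < 0" using assms side_neg_left[of i j l] by (simp add: a_def)
  have b: "0 < b" using assms tri[of j k l] by (simp add: b_def)
  have c: "0 < c" using assms tri[of i j k] by (simp add: c_def)
  have d: "d < 0" using assms side_neg_right[of i k l] by (simp add: d_def)
  have id: "b - a = c - d"
    unfolding a_def b_def c_def d_def side_def cross2_def by (simp add: algebra_simps)
  have e1: "(b *\<^sub>R q i - a *\<^sub>R q k) = (c *\<^sub>R q l - d *\<^sub>R q j)"
    unfolding vec_eq_iff forall_2 a_def b_def c_def d_def side_def cross2_def
    by (simp add: algebra_simps)
  let ?s = "- a / (b - a)" and ?t = "c / (c - d)"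
  have "(1 - ?s) *\<^sub>R q i + ?s *\<^sub>R q k = (1 / (b - a)) *\<^sub>R (b *\<^sub>R q i - a *\<^sub>R q k)"
    using a b by (simp add: vec_eq_iff field_simps)
  moreover have "(1 - ?t) *\<^sub>R q j + ?t *\<^sub>R q l = (1 / (c - d)) *\<^sub>R (c *\<^sub>R q l - d *\<^sub>R q j)"
    using c d by (simp add: vec_eq_iff field_simps)
  ultimately have "(1 - ?s) *\<^sub>R q i + ?s *\<^sub>R q k = (1 - ?t) *\<^sub>R q j + ?t *\<^sub>R q l"
    using e1 id by simp
  moreover have "(1 - ?s) *\<^sub>R q i + ?s *\<^sub>R q k \<in> closed_segment (q i) (q k)"
    unfolding in_segment using a b by (intro exI[of _ ?s]) (auto simp: field_simps)
  moreover have "(1 - ?t) *\<^sub>R q j + ?t *\<^sub>R q l \<in> closed_segment (q j) (q l)"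
    unfolding in_segment using c d by (intro exI[of _ ?t]) (auto simp: field_simps)
  ultimately show ?thesis by (auto simp: segment_convex_hull)
qed

end

subsection \<open>Filling a gap of the chain\<close>

definition noncrossing :: "'v set set \<Rightarrow> 'v list \<Rightarrow> bool" where
  "noncrossing E xs \<longleftrightarrow>
     (\<forall>i j k l. i < j \<longrightarrow> j < k \<longrightarrow> k < l \<longrightarrow> l < length xs \<longrightarrow> \<not> ({xs ! i, xs ! k} \<in> E \<and> {xs ! j, xs ! l} \<in> E))"

lemma noncrossingD:
  "noncrossing E xs \<Longrightarrow> i < j \<Longrightarrow> j < k \<Longrightarrow> k < l \<Longrightarrow> l < length xs \<Longrightarrow> {xs ! i, xs ! k} \<in> E \<Longrightarrow> {xs ! j, xs ! l} \<notin> E"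
  unfolding noncrossing_def by blast

lemma noncrossing_infix:
  assumes "noncrossing E (xs @ ys @ zs)" shows "noncrossing E ys"
  unfolding noncrossing_def
proof (intro allI impI)
  fix i j k l assume ijkl: "i < j" "j < k" "k < l" "l < length ys"
  have "(xs @ ys @ zs) ! (length xs + m) = ys ! m" if "m < length ys" for m
    using that by (simp add: nth_append)
  then show "\<not> ({ys ! i, ys ! k} \<in> E \<and> {ys ! j, ys ! l} \<in> E)"
    using noncrossingD[OF assms, of "length xs + i" "length xs + j" "length xs + k" "length xs + l"] ijkl by auto
qed

text \<open>Take for \<open>y\<close> the last neighbour of \<open>a\<close>: an edge from before
  \<open>y\<close> to beyond \<open>y\<close> would cross the edge \<open>ay\<close>. If
  \<open>a\<close> has no neighbour in \<open>ys\<close>, the first vertex serves as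
  \<open>y\<close> and nothing lies before it.\<close>

lemma noncrossing_split:
  assumes nc: "noncrossing E (a # ys @ [b])" and "ys \<noteq> []"
  obtains ys1 y ys2 where "ys = ys1 @ y # ys2" "\<And>v. v \<in> set ys2 \<Longrightarrow> {a, v} \<notin> E"
    "\<And>u v. u \<in> set ys1 \<Longrightarrow> v \<in> set ys2 \<union> {b} \<Longrightarrow> {u, v} \<notin> E"
proof (cases "\<exists>y\<in>set ys. {a, y} \<in> E")
  case True
  then obtain ys1 y ys2 where ys: "ys = ys1 @ y # ys2" and ay: "{a, y} \<in> E" and last: "\<forall>v\<in>set ys2. {a, v} \<notin> E"
    using split_list_last_prop[where P = "\<lambda>y. {a, y} \<in> E", OF True] by (elim exE conjE) (rule that)
  have "{u, v} \<notin> E" if uv: "u \<in> set ys1" "v \<in> set ys2 \<union> {b}" for u v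
  proof -
    obtain i where i: "i < length ys1" "u = ys1 ! i" using uv(1) unfolding in_set_conv_nth by blast
    have "v \<in> set (ys2 @ [b])" using uv(2) by auto
    then obtain j where j: "j < length (ys2 @ [b])" "v = (ys2 @ [b]) ! j" unfolding in_set_conv_nth by blast
    let ?L = "a # ys @ [b]"
    have L: "?L = (a # ys1) @ y # (ys2 @ [b])" using ys by simp
    have 0: "?L ! 0 = a" by simp
    have 1: "?L ! (Suc i) = u" using i ys by (simp add: nth_append)
    have 2: "?L ! (Suc (length ys1)) = y" using ys by (simp add: nth_append)
    have 3: "?L ! (Suc (Suc (length ys1 + j))) = v" using j unfolding L by (subst nth_append) simp
    show ?thesis
      using noncrossingD[OF nc, of 0 "Suc i" "Suc (length ys1)" "Suc (Suc (length ys1 + j))"] ay i j ys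
      unfolding 0 1 2 3 by auto
  qed
  then show thesis using that[OF ys] last by blast
next
  case False
  then obtain y ys2 where "ys = y # ys2" using assms(2) by (cases ys) auto
  then show thesis using that[of "[]" y ys2] False by auto
qed

definition admissible :: "'v set set \<Rightarrow> 'v set \<Rightarrow> ('v \<Rightarrow> 'a set) \<Rightarrow> bool" where
  "admissible E F D \<longleftrightarrow> (\<forall>u\<in>F. \<forall>v\<in>F. u \<noteq> v \<longrightarrow> D u \<inter> D v \<noteq> {} \<longrightarrow> {u, v} \<in> E) \<and>
     (\<forall>u\<in>F. \<forall>v\<in>F. \<forall>w\<in>F. u \<noteq> v \<longrightarrow> v \<noteq> w \<longrightarrow> u \<noteq> w \<longrightarrow> D u \<inter> D v \<inter> D w = {})"

lemma admissible_edge: "admissible E F D \<Longrightarrow> u \<in> F \<Longrightarrow> v \<in> F \<Longrightarrow> u \<noteq> v \<Longrightarrow> x \<in> D u \<Longrightarrow> x \<in> D v \<Longrightarrow> {u, v} \<in> E"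
  and admissible_triple: "admissible E F D \<Longrightarrow> u \<in> F \<Longrightarrow> v \<in> F \<Longrightarrow> w \<in> F \<Longrightarrow> u \<noteq> v \<Longrightarrow> v \<noteq> w \<Longrightarrow> u \<noteq> w \<Longrightarrow>
     x \<in> D u \<Longrightarrow> x \<in> D v \<Longrightarrow> x \<in> D w \<Longrightarrow> False"
  unfolding admissible_def by blast+

text \<open>The two labels are compared as a set, so the pattern may start with either vertex and
  the notion is symmetric.\<close>

definition alternates :: "(nat \<Rightarrow> 'v) \<Rightarrow> nat set \<Rightarrow> 'v \<Rightarrow> 'v \<Rightarrow> bool" where
  "alternates \<phi> W u v \<longleftrightarrow> (\<exists>i\<in>W. \<exists>j\<in>W. \<exists>k\<in>W. \<exists>l\<in>W. i < j \<and> j < k \<and> k < l \<and>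
     {\<phi> i, \<phi> j} = {u, v} \<and> \<phi> k = \<phi> i \<and> \<phi> l = \<phi> j)"

lemma alternates_mono:
  assumes "alternates \<phi> W u v" "W \<subseteq> W'" "\<And>i. i \<in> W \<Longrightarrow> \<phi>' i = \<phi> i" shows "alternates \<phi>' W' u v"
proof -
  obtain i j k l where "i\<in>W" "j\<in>W" "k\<in>W" "l\<in>W" "i < j" "j < k" "k < l" "{\<phi> i, \<phi> j} = {u, v}" "\<phi> k = \<phi> i" "\<phi> l = \<phi> j"
    using assms(1) unfolding alternates_def by blast
  then show ?thesis unfolding alternates_def
    using assms(2,3) by (intro bexI[of _ i] bexI[of _ j] bexI[of _ k] bexI[of _ l]) auto
qed

lemma alternates_sym: "alternates \<phi> W u v \<Longrightarrow> alternates \<phi> W v u"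
  unfolding alternates_def by (simp add: insert_commute)

section \<open>Ports and the inductive insertion of vertices\<close>

context chain
begin

text \<open>The vertices between \<open>a\<close> and \<open>b\<close> are to be placed in the region \<open>R\<close>, using the points \<open>q i\<close> with \<open>l < i < r\<close>, by
  trimming \<open>D a\<close>. In \<open>R\<close>, the set of \<open>b\<close> is the part beyond the chord from \<open>q c\<close> to \<open>q d\<close>. Trimming by caps of the
  available points affects only \<open>\<Gamma>\<close>, and the part of \<open>D a \<inter> \<Gamma>\<close> outside of \<open>R\<close> remains covered by other sets.\<close>

definition port ::
  "'v set set \<Rightarrow> 'v set \<Rightarrow> ('v \<Rightarrow> (real^2) set) \<Rightarrow> 'v \<Rightarrow> 'v \<Rightarrow> (real^2) set \<Rightarrow>
     nat \<Rightarrow> nat \<Rightarrow> nat \<Rightarrow> nat \<Rightarrow> (real^2) set \<Rightarrow> bool" where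
  "port E F D a b R c d l r \<Gamma> \<longleftrightarrow>
     a \<in> F \<and> b \<in> F \<and> a \<noteq> b \<and> l < c \<and> c < r \<and> r \<le> d \<and> d < n \<and> convex R \<and>
     (\<forall>v\<in>F - {a, b}. R \<inter> D v = {}) \<and>
     R \<inter> D b = R \<inter> {x. 0 < side c d x} \<and>
     R - {x. 0 < side c d x} \<subseteq> D a \<and>
     ({a, b} \<in> E \<longrightarrow> R \<subseteq> D a) \<and>
     D a \<inter> \<Gamma> - R \<subseteq> (\<Union>v\<in>F - {a}. D v) \<and>
     (\<forall>i. l < i \<longrightarrow> i < r \<longrightarrow> q i \<in> R) \<and>
     (\<forall>h i j. cap h i j \<longrightarrow> l < i \<longrightarrow> j + 1 < r \<longrightarrow> {x. 0 < h x} \<inter> D a \<subseteq> \<Gamma>)"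

lemma portD:
  assumes "port E F D a b R c d l r \<Gamma>"
  shows "a \<in> F" "b \<in> F" "a \<noteq> b" "l < c" "c < r" "r \<le> d" "d < n" "convex R"
    "\<And>v. v \<in> F \<Longrightarrow> v \<noteq> a \<Longrightarrow> v \<noteq> b \<Longrightarrow> R \<inter> D v = {}"
    "R \<inter> D b = R \<inter> {x. 0 < side c d x}"
    "R - {x. 0 < side c d x} \<subseteq> D a"
    "{a, b} \<in> E \<Longrightarrow> R \<subseteq> D a"
    "D a \<inter> \<Gamma> - R \<subseteq> (\<Union>v\<in>F - {a}. D v)"
    "\<And>i. l < i \<Longrightarrow> i < r \<Longrightarrow> q i \<in> R"
    "\<And>h i j. cap h i j \<Longrightarrow> l < i \<Longrightarrow> j + 1 < r \<Longrightarrow> {x. 0 < h x} \<inter> D a \<subseteq> \<Gamma>"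
  using assms unfolding port_def by blast+

text \<open>The number of points demanded on each side of \<open>q c\<close>. An edge
  \<open>ab\<close> with nothing to insert takes four points after \<open>q c\<close>. An insertion
  takes three blocks of the smaller size before \<open>q c\<close>, two for the call on the vertices
  before the new one and one for the call on those after it; after \<open>q c\<close> it takes one
  block and four more points. The summand 6 pays for the separating points, with some slack.\<close>

fun room :: "nat \<Rightarrow> nat" where
  "room 0 = 4"
| "room (Suc m) = 3 * room m + 6"

lemma room_mono: "m \<le> m' \<Longrightarrow> room m \<le> room m'"
  by (rule lift_Suc_mono_le) auto

text \<open>\<open>W\<close> is the window of indices labelled by \<open>\<phi>\<close>. Chain
  points outside of \<open>W\<close> must not leave the set of \<open>a\<close>, since they may be
  labelled \<open>a\<close> elsewhere.\<close>

definition filled where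
  "filled E F D a b ys R W D' \<phi> \<longleftrightarrow>
     (\<forall>v\<in>F - {a}. D' v = D v) \<and> D' a \<subseteq> D a \<and> (\<forall>v\<in>set ys. D' v \<subseteq> R) \<and>
     (\<forall>v\<in>F \<union> set ys. convex (D' v)) \<and>
     (\<Union>v\<in>F. D v) \<subseteq> (\<Union>v\<in>F \<union> set ys. D' v) \<and>
     admissible E (F \<union> set ys) D' \<and>
     (\<forall>i<n. i \<notin> W \<longrightarrow> q i \<in> D a \<longrightarrow> q i \<in> D' a) \<and>
     (\<forall>i\<in>W. \<phi> i \<in> {a, b} \<union> set ys \<and> q i \<in> D' (\<phi> i)) \<and>
     (\<forall>v\<in>set ys \<union> {b}. \<exists>i\<in>W. \<phi> i = v) \<and>
     (\<forall>u\<in>{a, b} \<union> set ys. \<forall>v\<in>{a, b} \<union> set ys. u \<noteq> v \<longrightarrow> {u, v} \<in> E \<longrightarrow> alternates \<phi> W u v)"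

lemma filledD:
  assumes "filled E F D a b ys R W D' \<phi>"
  shows "\<And>v. v \<in> F \<Longrightarrow> v \<noteq> a \<Longrightarrow> D' v = D v" "D' a \<subseteq> D a" "\<And>v. v \<in> set ys \<Longrightarrow> D' v \<subseteq> R"
    "\<And>v. v \<in> F \<union> set ys \<Longrightarrow> convex (D' v)"
    "(\<Union>v\<in>F. D v) \<subseteq> (\<Union>v\<in>F \<union> set ys. D' v)"
    "admissible E (F \<union> set ys) D'"
    "\<And>i. i < n \<Longrightarrow> i \<notin> W \<Longrightarrow> q i \<in> D a \<Longrightarrow> q i \<in> D' a"
    "\<And>i. i \<in> W \<Longrightarrow> \<phi> i \<in> {a, b} \<union> set ys" "\<And>i. i \<in> W \<Longrightarrow> q i \<in> D' (\<phi> i)"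
    "\<And>v. v \<in> set ys \<union> {b} \<Longrightarrow> \<exists>i\<in>W. \<phi> i = v"
    "\<And>u v. u \<in> {a, b} \<union> set ys \<Longrightarrow> v \<in> {a, b} \<union> set ys \<Longrightarrow> u \<noteq> v \<Longrightarrow> {u, v} \<in> E \<Longrightarrow> alternates \<phi> W u v"
proof -
  note conjs = assms[unfolded filled_def]
  note c1 = conjunct1[OF conjs] and r1 = conjunct2[OF conjs]
  note c2 = conjunct1[OF r1] and r2 = conjunct2[OF r1]
  note c3 = conjunct1[OF r2] and r3 = conjunct2[OF r2]
  note c4 = conjunct1[OF r3] and r4 = conjunct2[OF r3]
  note c5 = conjunct1[OF r4] and r5 = conjunct2[OF r4]
  note c6 = conjunct1[OF r5] and r6 = conjunct2[OF r5]
  note c7 = conjunct1[OF r6] and r7 = conjunct2[OF r6]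
  note c8 = conjunct1[OF r7] and r8 = conjunct2[OF r7]
  note c9 = conjunct1[OF r8] and c10 = conjunct2[OF r8]
  show "\<And>v. v \<in> F \<Longrightarrow> v \<noteq> a \<Longrightarrow> D' v = D v" using c1 by simp
  show "D' a \<subseteq> D a" by (rule c2)
  show "\<And>v. v \<in> set ys \<Longrightarrow> D' v \<subseteq> R" by (rule bspec[OF c3])
  show "\<And>v. v \<in> F \<union> set ys \<Longrightarrow> convex (D' v)" by (rule bspec[OF c4])
  show "(\<Union>v\<in>F. D v) \<subseteq> (\<Union>v\<in>F \<union> set ys. D' v)" by (rule c5)
  show "admissible E (F \<union> set ys) D'" by (rule c6)
  show "\<And>i. i < n \<Longrightarrow> i \<notin> W \<Longrightarrow> q i \<in> D a \<Longrightarrow> q i \<in> D' a" using c7 by simp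
  show "\<And>i. i \<in> W \<Longrightarrow> \<phi> i \<in> {a, b} \<union> set ys" "\<And>i. i \<in> W \<Longrightarrow> q i \<in> D' (\<phi> i)"
    by (rule conjunct1[OF bspec[OF c8]], assumption) (rule conjunct2[OF bspec[OF c8]])
  show "\<And>v. v \<in> set ys \<union> {b} \<Longrightarrow> \<exists>i\<in>W. \<phi> i = v" by (rule bspec[OF c9])
  show "\<And>u v. u \<in> {a, b} \<union> set ys \<Longrightarrow> v \<in> {a, b} \<union> set ys \<Longrightarrow> u \<noteq> v \<Longrightarrow> {u, v} \<in> E \<Longrightarrow> alternates \<phi> W u v"
    by (rule c10[rule_format])
qed

text \<open>If \<open>a\<close> and \<open>b\<close> are not adjacent, points beyond the chord may
  lie outside the set of \<open>a\<close>, so all of them go to \<open>b\<close>.\<close>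

definition edge_labels :: "bool \<Rightarrow> 'v \<Rightarrow> 'v \<Rightarrow> nat \<Rightarrow> nat \<Rightarrow> 'v" where
  "edge_labels e a b m i = (if e \<and> (i = m + 1 \<or> i = m + 3) then a else b)"

lemma alternates_edge_labels:
  assumes "e" "{m<..m+4} \<subseteq> W" shows "alternates (edge_labels e a b m) W a b"
  unfolding alternates_def using assms
  by (intro bexI[of _ "m+1"] bexI[of _ "m+2"] bexI[of _ "m+3"] bexI[of _ "m+4"]) (auto simp: edge_labels_def)

text \<open>Nothing is trimmed. Window points up to \<open>q c\<close> are not in the half-plane of
  \<open>b\<close>, hence in the set of \<open>a\<close>; later ones are in the set of
  \<open>b\<close> and, for an edge, in that of \<open>a\<close> too, so labels can alternate
  there.\<close>

lemma filled_Nil: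
  assumes port: "port E F D a b R c d l r \<Gamma>" and adm: "admissible E F D"
    and cv: "\<And>v. v \<in> F \<Longrightarrow> convex (D v)" and rm: "c + 4 < r"
  shows "\<exists>\<phi>. filled E F D a b [] R {l<..<r} D \<phi>"
proof -
  note P = portD[OF port]
  define \<phi> where "\<phi> i = (if i \<le> c then a else edge_labels ({a,b} \<in> E) a b c i)" for i
  have alt: "alternates \<phi> {l<..<r} a b" if "{a, b} \<in> E"
    by (rule alternates_mono[where W = "{c<..c+4}", OF alternates_edge_labels[of "{a,b} \<in> E"]])
      (use that rm P in \<open>auto simp: \<phi>_def\<close>)
  have mem: "q i \<in> D (\<phi> i)" if "i \<in> {l<..<r}" for i
  proof (cases "i \<le> c")
    case True
    then have "\<not> 0 < side c d (q i)" using side_pos_iff[of c d i] P that by auto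
    then show ?thesis using P(11) P(14)[of i] that True by (auto simp: \<phi>_def)
  next
    case False
    then have "0 < side c d (q i)" using side_pos_iff[of c d i] P(5-7) that by auto
    then have "q i \<in> D b" using P(10) P(14)[of i] that by auto
    moreover have "q i \<in> D a" if "{a,b} \<in> E" using P(12) P(14)[of i] that \<open>i \<in> {l<..<r}\<close> by auto
    ultimately show ?thesis using False by (auto simp: \<phi>_def edge_labels_def)
  qed
  have "\<phi> (c + 2) = b" by (simp add: \<phi>_def edge_labels_def)
  then have "\<exists>i\<in>{l<..<r}. \<phi> i = b" using rm P by (intro bexI[of _ "c+2"]) auto
  moreover have "\<phi> i \<in> {a, b}" for i by (simp add: \<phi>_def edge_labels_def)
  ultimately have "filled E F D a b [] R {l<..<r} D \<phi>"
    unfolding filled_def using cv adm mem alt alternates_sym[OF alt] by (auto simp: insert_commute)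
  then show ?thesis by (intro exI[of _ \<phi>])
qed

text \<open>Let \<open>y\<close> be the last neighbour of \<open>a\<close> in the list. It gets the cap \<open>Y\<close> beyond the chord from \<open>q a'\<close> to \<open>q b'\<close>, where
  \<open>a' < c < b'\<close>, and \<open>D a\<close> is trimmed by \<open>C\<close>, which contains the part of \<open>Y\<close> belonging to \<open>b\<close>. The vertices between
  \<open>a\<close> and \<open>y\<close> are then placed at points up to \<open>i0\<close>, those between \<open>y\<close> and \<open>b\<close> at points from \<open>i0 + 2\<close> on.\<close>

lemma fill_block:
  assumes "port E F D a b R c d l r \<Gamma>" "admissible E F D" "\<And>v. v \<in> F \<Longrightarrow> convex (D v)"
    and "distinct (a # ys @ [b])" "set ys \<inter> F = {}" "noncrossing E (a # ys @ [b])"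
    and "l + room (length ys) < c" "c + room (length ys) < r"
  shows "\<exists>D' \<phi>. filled E F D a b ys R {l<..<r} D' \<phi>"
  using assms
proof (induction "length ys" arbitrary: ys F D a b R c d l r \<Gamma> rule: less_induct)
  case less
  note port = less.prems(1) and adm = less.prems(2) and cv = less.prems(3) and dist = less.prems(4)
    and new = less.prems(5) and nc = less.prems(6) and rooml = less.prems(7) and roomr = less.prems(8)
  note P = portD[OF port]
  show ?case
  proof (cases "ys = []")
    case True
    then show ?thesis using filled_Nil[OF port adm cv] roomr by (auto intro!: exI[of _ D])
  next
    case False
    obtain ys1 y ys2 where ys: "ys = ys1 @ y # ys2" and no_a: "\<And>v. v \<in> set ys2 \<Longrightarrow> {a, v} \<notin> E"
      and no12: "\<And>u v. u \<in> set ys1 \<Longrightarrow> v \<in> set ys2 \<union> {b} \<Longrightarrow> {u, v} \<notin> E"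
      using noncrossing_split[OF nc False] by blast
    obtain m where m: "length ys = Suc m" using False by (cases ys) auto
    define g where "g = room m"
    have g4: "4 \<le> g" unfolding g_def using room_mono[of 0 m] by simp
    have g1: "room (length ys1) \<le> g" "room (length ys2) \<le> g" unfolding g_def using ys m by (auto intro!: room_mono)
    have rm: "l + 3 * g + 6 < c" "c + 3 * g + 6 < r" using rooml roomr m by (auto simp: g_def)
    \<comment> \<open>The first call, up to \<open>i0\<close>, has \<open>g\<close> points on each
      side of \<open>a'\<close>; the second, from \<open>i0 + 2\<close> on, has at least
      \<open>g\<close> on each side of \<open>c\<close>. Beyond \<open>b'\<close> four points remain
      for the edge \<open>ab\<close>.\<close>
    define a' where "a' = l + g + 1"
    define i0 where "i0 = a' + g"
    define b' where "b' = c + g + 1"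
    have ord: "l < a'" "a' < i0" "i0 + 1 + g < c" "c < b'" "b' + 4 < r" "b' + 1 < d" "d < n" "b' < n"
      using rm g4 P(4-7) by (auto simp: a'_def i0_def b'_def)
    let ?L = "{x. 0 < side c d x}"
    let ?Y = "{x. 0 < side a' b' x}"
    \<comment> \<open>Without the edge \<open>ay\<close>, the whole cap is taken away from
      \<open>a\<close>. With it, the pencil leaves a piece of the cap to both vertices but still
      removes everything of the cap that lies in \<open>?L\<close>.\<close>
    define h where "h = (if {a,y} \<in> E then pencil a' b' c d i0 else side a' b')"
    define C where "C = {x. 0 < h x}"
    let ?C0 = "{x. 0 < pencil a' b' c d i0 x}"
    have fi: "0 < side a' b' (q i0)" using ord by (intro tri) auto
    have gi: "side c d (q i0) < 0" using ord by (intro side_neg_left) auto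
    \<comment> \<open>As \<open>q i0\<close> lies in \<open>?Y\<close> and strictly outside of
      \<open>?L\<close>, the pencil is a combination of the two side functions with positive
      coefficients: positive where both are, not positive where neither is.\<close>
    have YLC: "?Y \<inter> ?L \<subseteq> C"
    proof
      fix x assume "x \<in> ?Y \<inter> ?L"
      then have "0 < side a' b' x" "0 < side c d x" by auto
      moreover from this have "0 < side a' b' (q i0) * side c d x" "side c d (q i0) * side a' b' x < 0"
        using fi gi by (auto intro: mult_neg_pos)
      ultimately show "x \<in> C" by (auto simp: C_def h_def pencil_def)
    qed
    have C0YL: "?C0 \<subseteq> ?Y \<union> ?L"
    proof
      fix x assume x: "x \<in> ?C0"
      show "x \<in> ?Y \<union> ?L"
      proof (rule ccontr)
        assume "x \<notin> ?Y \<union> ?L"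
        then have "side a' b' x \<le> 0" "side c d x \<le> 0" by auto
        then have "side a' b' (q i0) * side c d x \<le> 0" "0 \<le> side c d (q i0) * side a' b' x"
          using fi gi by (auto intro: mult_nonneg_nonpos mult_nonpos_nonpos)
        then show False using x by (auto simp: pencil_def)
      qed
    qed
    then have CYL: "C \<subseteq> ?Y \<union> ?L" by (auto simp: C_def h_def)
    have C0q: "q i \<in> ?C0 \<longleftrightarrow> i0 < i \<and> i \<le> b'" if "i < n" for i
      using pencil_pos_iff[of a' i0 c b' d i] ord that by auto
    have Cq: "q i \<in> C \<longleftrightarrow> (if {a,y} \<in> E then i0 < i \<and> i \<le> b' else a' < i \<and> i < b')" if "i < n" for i
      using pencil_pos_iff[of a' i0 c b' d i] side_pos_iff[of a' b' i] ord that by (auto simp: C_def h_def)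
    have Yq: "q i \<in> ?Y \<longleftrightarrow> a' < i \<and> i < b'" if "i < n" for i
      using side_pos_iff[of a' b' i] ord that by auto
    have Lq: "q i \<in> ?L \<longleftrightarrow> c < i \<and> i < d" if "i < n" for i
      using side_pos_iff[of c d i] ord that by auto
    have affh: "affine_fun h" by (simp add: h_def affine_fun_pencil affine_fun_side)
    \<comment> \<open>The cutting function is a cap within the window, so the trimming stays in the
      region where the port guarantees covering.\<close>
    have CG: "C \<inter> D a \<subseteq> \<Gamma>"
    proof (cases "{a,y} \<in> E")
      case True
      have "cap h i0 b'" using cap_pencil[of a' i0 c b' d] ord True by (simp add: h_def)
      then show ?thesis using P(15)[of h i0 b'] ord by (auto simp: C_def)
    next
      case False
      have "cap h a' (b' - 1)" using cap_side[of a' b'] ord False by (simp add: h_def)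
      then show ?thesis using P(15)[of h a' "b' - 1"] ord by (auto simp: C_def)
    qed
    have ynew: "y \<notin> F" "y \<noteq> a" "y \<noteq> b" using new ys P(1,2) by auto
    define Dy where "Dy = ?Y \<inter> R \<inter> (if {y,b} \<in> E then UNIV else - ?L)"
    define D1 where "D1 = D(a := D a \<inter> - C, y := Dy)"
    have D1a: "D1 a = D a \<inter> - C" and D1y: "D1 y = Dy" and D1b: "D1 b = D b"
      and D1o: "v \<noteq> a \<Longrightarrow> v \<noteq> y \<Longrightarrow> D1 v = D v" for v
      using ynew P(3) by (auto simp: D1_def)
    let ?F1 = "insert y F"
    have cvY: "convex ?Y" "convex ?L" "convex (- ?L)" "convex (- C)" "convex ?C0" "convex (- ?C0)"
      using convex_pos_affine_fun[OF affine_fun_side] convex_nonpos_affine_fun[OF affine_fun_side]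
        convex_pos_affine_fun[OF affh] convex_nonpos_affine_fun[OF affh]
        convex_pos_affine_fun[OF affine_fun_pencil] convex_nonpos_affine_fun[OF affine_fun_pencil] by (auto simp: C_def)
    have cvDy: "convex Dy" unfolding Dy_def using cvY P(8) by (auto intro!: convex_Int)
    have cv1: "convex (D1 v)" if "v \<in> ?F1" for v
      using that cvDy cv[of a] cv[of v] P(1) cvY(4) D1o[of v] D1a D1y by (cases "v = a"; cases "v = y") (auto intro!: convex_Int)
    have DyR: "Dy \<subseteq> R" "Dy \<subseteq> ?Y" by (auto simp: Dy_def)
    have Dy_disj: "Dy \<inter> D v = {}" if "v \<in> F" "v \<noteq> a" "v \<noteq> b" for v
      using P(9)[OF that] DyR by blast
    have Dya: "{a, y} \<in> E" if "x \<in> Dy" "x \<in> D1 a" for x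
      using that D1a DyR by (auto simp: C_def h_def split: if_splits)
    have Dyb: "{y, b} \<in> E" if "x \<in> Dy" "x \<in> D b" for x
      using that P(10) DyR by (auto simp: Dy_def split: if_splits)
    \<comment> \<open>This is the purpose of the trimming: a point common to the new set and the set
      of \<open>b\<close> lies in \<open>C\<close>.\<close>
    have Dyab: False if "x \<in> Dy" "x \<in> D1 a" "x \<in> D b" for x
      using that P(10) DyR D1a YLC by blast
    have D1sub: "D1 v \<subseteq> D v" if "v \<in> F" for v using that D1a D1o[of v] ynew by (cases "v = a") auto
    have e1: "{u, y} \<in> E" if "u \<in> F" "x \<in> D1 u" "x \<in> Dy" for u x
    proof -
      consider "u = a" | "u = b" | "u \<noteq> a" "u \<noteq> b" by blast
      then show ?thesis
      proof cases
        case 1 then show ?thesis using Dya that by auto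
      next
        case 2 then show ?thesis using Dyb[of x] that D1b by (auto simp: insert_commute)
      next
        case 3 then show ?thesis using Dy_disj[of u] D1sub[of u] that by blast
      qed
    qed
    have e2: False if "u \<in> F" "v \<in> F" "u \<noteq> v" "x \<in> D1 u" "x \<in> D1 v" "x \<in> Dy" for u v x
    proof -
      have "u \<in> {a,b}" "v \<in> {a,b}" using Dy_disj[of u] Dy_disj[of v] D1sub[of u] D1sub[of v] that by blast+
      then show False using that Dyab[of x] D1b by auto
    qed
    have adm1: "admissible E ?F1 D1"
      unfolding admissible_def
    proof (intro conjI ballI impI)
      fix u v assume uv: "u \<in> ?F1" "v \<in> ?F1" "u \<noteq> v" "D1 u \<inter> D1 v \<noteq> {}"
      then obtain x where x: "x \<in> D1 u" "x \<in> D1 v" by blast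
      show "{u, v} \<in> E"
      proof (cases "u = y \<or> v = y")
        case True
        then show ?thesis using e1[of u x] e1[of v x] x uv D1y ynew by (auto simp: insert_commute)
      next
        case False
        then show ?thesis using admissible_edge[OF adm, of u v x] uv x D1sub by auto
      qed
    next
      fix u v w assume uvw: "u \<in> ?F1" "v \<in> ?F1" "w \<in> ?F1" "u \<noteq> v" "v \<noteq> w" "u \<noteq> w"
      show "D1 u \<inter> D1 v \<inter> D1 w = {}"
      proof (rule ccontr)
        assume "D1 u \<inter> D1 v \<inter> D1 w \<noteq> {}"
        then obtain x where x: "x \<in> D1 u" "x \<in> D1 v" "x \<in> D1 w" by blast
        consider "u = y" | "v = y" | "w = y" | "y \<notin> {u,v,w}" by blast
        then show False
        proof cases
          case 1 then show ?thesis using e2[of v w x] x uvw D1y by auto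
        next
          case 2 then show ?thesis using e2[of u w x] x uvw D1y by auto
        next
          case 3 then show ?thesis using e2[of u v x] x uvw D1y by auto
        next
          case 4
          then show ?thesis using admissible_triple[OF adm, of u v w x] uvw x D1sub by auto
        qed
      qed
    qed
    \<comment> \<open>What \<open>a\<close> loses outside of \<open>R\<close> is covered by the port
      condition; inside of \<open>R\<close> it lies in \<open>?L\<close>, which belongs to
      \<open>b\<close> there, or in the cap of \<open>y\<close>.\<close>
    have cov1: "(\<Union>v\<in>F. D v) \<subseteq> (\<Union>v\<in>?F1. D1 v)"
    proof
      fix x assume "x \<in> (\<Union>v\<in>F. D v)"
      then obtain v where v: "v \<in> F" "x \<in> D v" by blast
      have other: "x \<in> (\<Union>v\<in>?F1. D1 v)" if "v \<in> F" "v \<noteq> a" "x \<in> D v" for v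
        using that D1o[of v] ynew by auto
      show "x \<in> (\<Union>v\<in>?F1. D1 v)"
      proof (cases "v = a \<and> x \<in> C")
        case False
        then show ?thesis using v other[of v] D1a P(1) by auto
      next
        case True
        then have xG: "x \<in> D a \<inter> \<Gamma>" using CG v by auto
        show ?thesis
        proof (cases "x \<in> R")
          case False
          then show ?thesis using P(13) xG other by blast
        next
          case xR: True
          show ?thesis
          proof (cases "x \<in> ?L")
            case True
            then show ?thesis using P(10) xR other[of b] P(2,3) by auto
          next
            case False
            then have "x \<in> Dy" using CYL True xR by (auto simp: Dy_def)
            then show ?thesis using D1y by auto
          qed
        qed
      qed
    qed
    \<comment> \<open>The line of \<open>?C0\<close> separates \<open>R1\<close> from
      \<open>R2\<close> below even if \<open>ay\<close> is not an edge, so the sets placed by the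
      two calls are disjoint. Avoiding \<open>?L\<close> keeps the first block away from
      \<open>b\<close>.\<close>
    define R1 where "R1 = R \<inter> - ?L \<inter> - ?C0"
    have port1: "port E ?F1 D1 a y R1 a' b' l (i0 + 1) \<Gamma>"
      unfolding port_def
    proof (intro conjI ballI allI impI)
      show "a \<in> ?F1" "y \<in> ?F1" "a \<noteq> y" "l < a'" "a' < i0 + 1" "i0 + 1 \<le> b'" "b' < n"
        using P(1) ynew ord by auto
      show "convex R1" unfolding R1_def using cvY P(8) by (auto intro!: convex_Int)
      show "R1 \<inter> D1 v = {}" if "v \<in> ?F1 - {a, y}" for v
      proof (cases "v = b")
        case True then show ?thesis using D1b P(10) by (auto simp: R1_def)
      next
        case False then show ?thesis using P(9)[of v] D1o[of v] that by (auto simp: R1_def)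
      qed
      show "R1 \<inter> D1 y = R1 \<inter> ?Y" unfolding D1y Dy_def R1_def by auto
      show "R1 - ?Y \<subseteq> D1 a" using P(11) unfolding D1a R1_def C_def h_def by auto
      show "{a, y} \<in> E \<Longrightarrow> R1 \<subseteq> D1 a" using P(11) unfolding D1a R1_def C_def h_def by auto
      show "D1 a \<inter> \<Gamma> - R1 \<subseteq> (\<Union>v\<in>?F1 - {a}. D1 v)"
      proof
        fix x assume x: "x \<in> D1 a \<inter> \<Gamma> - R1"
        have other: "x \<in> (\<Union>v\<in>?F1 - {a}. D1 v)" if "v \<in> F" "v \<noteq> a" "x \<in> D v" for v
          using that D1o[of v] ynew by auto
        show "x \<in> (\<Union>v\<in>?F1 - {a}. D1 v)"
        proof (cases "x \<in> R")
          case True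
          then have "x \<in> ?L" using x D1a C0YL by (auto simp: R1_def C_def h_def split: if_splits)
          then show ?thesis using other[of b] P(2,3,10) True by auto
        next
          case False
          then show ?thesis using P(13) x D1a other by blast
        qed
      qed
      show "q i \<in> R1" if "l < i" "i < i0 + 1" for i
      proof -
        have "i < n" "q i \<in> R" using that ord P(14)[of i] P(5) by auto
        then show ?thesis using Lq[of i] C0q[of i] that ord by (auto simp: R1_def)
      qed
      show "{x. 0 < h2 x} \<inter> D1 a \<subseteq> \<Gamma>" if "cap h2 i j" "l < i" "j + 1 < i0 + 1" for h2 i j
        using P(15)[OF that(1,2)] that ord D1a P(5) by auto
    qed
    have d1: "distinct (a # ys1 @ [y])" "distinct (y # ys2 @ [b])" using dist ys by auto
    have nc1: "noncrossing E (a # ys1 @ [y])" "noncrossing E (y # ys2 @ [b])"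
      using noncrossing_infix[of E "[]" "a # ys1 @ [y]" "ys2 @ [b]"] noncrossing_infix[of E "a # ys1" "y # ys2 @ [b]" "[]"]
        nc ys by auto
    have "\<exists>D' \<phi>. filled E ?F1 D1 a y ys1 R1 {l<..<i0+1} D' \<phi>"
      by (rule less.hyps[OF _ port1 adm1 cv1 d1(1) _ nc1(1)]) (use ys new dist ord g1 in \<open>auto simp: a'_def i0_def\<close>)
    then obtain D2 \<phi>1 where fill1: "filled E ?F1 D1 a y ys1 R1 {l<..<i0+1} D2 \<phi>1" by blast
    note Q = filledD[OF fill1]
    let ?F2 = "?F1 \<union> set ys1"
    define R2 where "R2 = R \<inter> ?C0 \<inter> ?Y"
    have D2y: "D2 y = Dy" and D2b: "D2 b = D b" using Q(1)[of y] Q(1)[of b] ynew P(2,3) D1y D1b by auto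
    have D2a: "D2 a \<subseteq> D a \<inter> - C" using Q(2) D1a by auto
    \<comment> \<open>Now \<open>y\<close> takes the role of \<open>a\<close>, while
      \<open>b\<close> keeps its chord. The part of \<open>Dy\<close> in \<open>?C0\<close> is
      contained in \<open>R2\<close>, so no covering has to be inherited.\<close>
    have port2: "port E ?F2 D2 y b R2 c d (i0 + 1) b' ?C0"
      unfolding port_def
    proof (intro conjI ballI allI impI)
      show "y \<in> ?F2" "b \<in> ?F2" "y \<noteq> b" "i0 + 1 < c" "c < b'" "b' \<le> d" "d < n"
        using P(2) ynew ord by auto
      show "convex R2" unfolding R2_def using cvY P(8) by (auto intro!: convex_Int)
      show "R2 \<inter> D2 v = {}" if v: "v \<in> ?F2 - {y, b}" for v
      proof -
        consider "v = a" | "v \<in> set ys1" | "v \<in> F" "v \<noteq> a" "v \<noteq> b" "v \<noteq> y" using v by blast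
        then show ?thesis
        proof cases
          case 1 then show ?thesis using D2a by (auto simp: R2_def C_def h_def split: if_splits)
        next
          case 2 then show ?thesis using Q(3)[OF 2] by (auto simp: R1_def R2_def)
        next
          case 3 then show ?thesis using P(9)[of v] Q(1)[of v] D1o[of v] by (auto simp: R2_def)
        qed
      qed
      show "R2 \<inter> D2 b = R2 \<inter> ?L" using D2b P(10) by (auto simp: R2_def)
      show "R2 - ?L \<subseteq> D2 y" unfolding D2y Dy_def R2_def by auto
      show "{y, b} \<in> E \<Longrightarrow> R2 \<subseteq> D2 y" unfolding D2y Dy_def R2_def by auto
      show "D2 y \<inter> ?C0 - R2 \<subseteq> (\<Union>v\<in>?F2 - {y}. D2 v)" unfolding D2y Dy_def R2_def by auto
      show "q i \<in> R2" if "i0 + 1 < i" "i < b'" for i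
      proof -
        have "i < n" "q i \<in> R" using that ord P(14)[of i] P(5) by auto
        then show ?thesis using Yq[of i] C0q[of i] that ord by (auto simp: R2_def)
      qed
      show "{x. 0 < h2 x} \<inter> D2 y \<subseteq> ?C0" if "cap h2 i j" "i0 + 1 < i" "j + 1 < b'" for h2 i j
        using cap_inside[of a' i0 c b' d h2 i j] that ord D2y DyR(2) by auto
    qed
    have "\<exists>D' \<phi>. filled E ?F2 D2 y b ys2 R2 {i0+1<..<b'} D' \<phi>"
      by (rule less.hyps[OF _ port2 Q(6) Q(4) d1(2) _ nc1(2)]) (use ys new dist ord g1 in \<open>auto simp: b'_def\<close>)
    then obtain D3 \<phi>2 where fill2: "filled E ?F2 D2 y b ys2 R2 {i0+1<..<b'} D3 \<phi>2" by blast
    note T = filledD[OF fill2]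
    \<comment> \<open>The index \<open>i0 + 1\<close> lies between the two windows and is given to
      \<open>y\<close>. The alternating labels for \<open>ab\<close> start after \<open>b'\<close>,
      because the pencil cuts off \<open>q b'\<close>, which may thus have left the set of
      \<open>a\<close>.\<close>
    define \<phi> where "\<phi> i = (if i < i0 + 1 then \<phi>1 i else if i = i0 + 1 then y else if i < b' then \<phi>2 i
      else edge_labels ({a,b} \<in> E) a b b' i)" for i
    have Fys: "?F2 \<union> set ys2 = F \<union> set ys" using ys by auto
    have D3o: "D3 v = D2 v" if "v \<in> ?F2" "v \<noteq> y" for v using T(1) that by auto
    have D3a: "D3 a = D2 a" and D3b: "D3 b = D b" using D3o[of a] D3o[of b] D2b P(1,2) ynew by auto
    have "filled E F D a b ys R {l<..<r} D3 \<phi>"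
      unfolding filled_def
    proof (intro conjI ballI allI impI)
      show "D3 v = D v" if "v \<in> F - {a}" for v
        using that D3o[of v] Q(1)[of v] D1o[of v] ynew by auto
      show "D3 a \<subseteq> D a" using D3a D2a by auto
      show "D3 v \<subseteq> R" if v: "v \<in> set ys" for v
      proof -
        consider "v \<in> set ys1" "v \<noteq> y" | "v = y" | "v \<in> set ys2" using v ys by auto
        then show ?thesis
        proof cases
          case 1 then show ?thesis using Q(3)[of v] D3o[of v] by (auto simp: R1_def)
        next
          case 2 then show ?thesis using T(2) D2y DyR by auto
        next
          case 3 then show ?thesis using T(3)[of v] by (auto simp: R2_def)
        qed
      qed
      show "convex (D3 v)" if "v \<in> F \<union> set ys" for v using T(4)[of v] that Fys by auto
      show "(\<Union>v\<in>F. D v) \<subseteq> (\<Union>v\<in>F \<union> set ys. D3 v)"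
        using order_trans[OF order_trans[OF cov1 Q(5)] T(5)] unfolding Fys .
      show "admissible E (F \<union> set ys) D3" using T(6) Fys by simp
      show "q i \<in> D3 a" if "i < n" "i \<notin> {l<..<r}" "q i \<in> D a" for i
      proof -
        have "q i \<notin> C" using Cq[of i] that ord by auto
        then have "q i \<in> D1 a" using D1a that by auto
        then show ?thesis using Q(7)[of i] that ord D3a by auto
      qed
      have y_keep: "q i \<in> D3 y" if "i < n" "i \<notin> {i0+1<..<b'}" "q i \<in> Dy" for i
        using T(7)[of i] that D2y by auto
      show "\<phi> i \<in> {a, b} \<union> set ys" if "i \<in> {l<..<r}" for i
        using that Q(8)[of i] T(8)[of i] ys by (auto simp: \<phi>_def edge_labels_def)
      show "q i \<in> D3 (\<phi> i)" if i: "i \<in> {l<..<r}" for i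
      proof -
        have inn: "i < n" using i ord P by auto
        have iR: "q i \<in> R" using P(14) i by auto
        consider "i < i0 + 1" | "i = i0 + 1" | "i0 + 1 < i" "i < b'" | "b' \<le> i" by linarith
        then show ?thesis
        proof cases
          case 1
          then have w: "i \<in> {l<..<i0+1}" using i by auto
          have p: "\<phi>1 i \<in> {a,y} \<union> set ys1" "q i \<in> D2 (\<phi>1 i)" using Q(8,9)[OF w] by auto
          show ?thesis
          proof (cases "\<phi>1 i = y")
            case True
            then show ?thesis using 1 p y_keep[of i] inn D2y by (auto simp: \<phi>_def)
          next
            case False
            then show ?thesis using 1 p D3o[of "\<phi>1 i"] P(1) by (auto simp: \<phi>_def)
          qed
        next
          case 2
          have "q i \<in> Dy" using Yq[of i] Lq[of i] iR inn 2 ord by (auto simp: Dy_def)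
          then show ?thesis using 2 y_keep[of i] inn by (auto simp: \<phi>_def)
        next
          case 3
          then show ?thesis using T(9)[of i] by (auto simp: \<phi>_def)
        next
          case 4
          have "q i \<in> D b" using Lq[of i] 4 ord i P(6,10) iR inn by auto
          moreover have "q i \<in> D3 a" if "{a,b} \<in> E" "i \<noteq> b'"
          proof -
            have "q i \<in> D1 a" using Cq[of i] 4 that D1a P(12) iR inn by auto
            then show ?thesis using Q(7)[of i] 4 ord inn D3a by auto
          qed
          ultimately show ?thesis using 4 ord D3b by (auto simp: \<phi>_def edge_labels_def)
        qed
      qed
      show "\<exists>i\<in>{l<..<r}. \<phi> i = v" if v: "v \<in> set ys \<union> {b}" for v
      proof -
        consider "v \<in> set ys1" | "v = y" | "v \<in> set ys2 \<union> {b}" using v ys by auto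
        then show ?thesis
        proof cases
          case 1
          then obtain i where "i \<in> {l<..<i0+1}" "\<phi>1 i = v" using Q(10)[of v] by auto
          then show ?thesis using ord by (intro bexI[of _ i]) (auto simp: \<phi>_def)
        next
          case 2
          then show ?thesis using ord by (intro bexI[of _ "i0 + 1"]) (auto simp: \<phi>_def)
        next
          case 3
          then obtain i where "i \<in> {i0+1<..<b'}" "\<phi>2 i = v" using T(10)[of v] by auto
          then show ?thesis using ord by (intro bexI[of _ i]) (auto simp: \<phi>_def)
        qed
      qed
      show "alternates \<phi> {l<..<r} u v" if uv: "u \<in> {a, b} \<union> set ys" "v \<in> {a, b} \<union> set ys" "u \<noteq> v" "{u, v} \<in> E" for u v
      proof -
        have vu: "{v, u} \<in> E" using uv by (simp add: insert_commute)
        have i1: "alternates \<phi> {l<..<r} u v" if "u \<in> {a,y} \<union> set ys1" "v \<in> {a,y} \<union> set ys1"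
          by (rule alternates_mono[OF Q(11)[OF that uv(3,4)]]) (use ord in \<open>auto simp: \<phi>_def\<close>)
        have i2: "alternates \<phi> {l<..<r} u v" if "u \<in> {y,b} \<union> set ys2" "v \<in> {y,b} \<union> set ys2"
          by (rule alternates_mono[OF T(11)[OF that uv(3,4)]]) (use ord in \<open>auto simp: \<phi>_def\<close>)
        have i3: "alternates \<phi> {l<..<r} a b" if "{a,b} \<in> E"
          by (rule alternates_mono[where W = "{b'<..b'+4}", OF alternates_edge_labels[of "{a,b} \<in> E"]])
            (use that ord in \<open>auto simp: \<phi>_def\<close>)
        \<comment> \<open>By the choice of \<open>y\<close>, every edge other than \<open>ab\<close>
          stays within one of the two blocks, \<open>y\<close> belonging to both.\<close>
        consider "u \<in> {a,y} \<union> set ys1" "v \<in> {a,y} \<union> set ys1" | "u \<in> {y,b} \<union> set ys2" "v \<in> {y,b} \<union> set ys2"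
          | "u = a" "v = b" | "u = b" "v = a"
          using uv vu no_a[of u] no_a[of v] no12[of u v] no12[of v u] ys by auto
        then show ?thesis
        proof cases
          case 1 then show ?thesis by (rule i1)
        next
          case 2 then show ?thesis by (rule i2)
        next
          case 3 then show ?thesis using i3 uv by simp
        next
          case 4 then show ?thesis using alternates_sym[OF i3] vu by simp
        qed
      qed
    qed
    then show ?thesis by blast
  qed
qed

end

subsection \<open>Existence of chains\<close>

definition homogeneous :: "(nat list \<Rightarrow> bool) \<Rightarrow> nat \<Rightarrow> nat \<Rightarrow> nat \<Rightarrow> (nat \<Rightarrow> nat) \<Rightarrow> bool \<Rightarrow> bool" where
  "homogeneous P r k N s t \<longleftrightarrow> (\<forall>i j. i < j \<longrightarrow> j < k \<longrightarrow> s i < s j) \<and> (\<forall>i<k. s i < N) \<and>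
     (\<forall>xs. sorted_wrt (<) xs \<longrightarrow> length xs = r \<longrightarrow> set xs \<subseteq> {..<k} \<longrightarrow> P (map s xs) = t)"

lemma homogeneousD:
  assumes "homogeneous P r k N s t"
  shows "i < j \<Longrightarrow> j < k \<Longrightarrow> s i < s j" "i < k \<Longrightarrow> s i < N"
    "sorted_wrt (<) xs \<Longrightarrow> length xs = r \<Longrightarrow> set xs \<subseteq> {..<k} \<Longrightarrow> P (map s xs) = t"
  using assms unfolding homogeneous_def by auto

text \<open>An \<open>r\<close>-element set is coloured by the value of \<open>P\<close> at its
  increasing enumeration. \<open>N\<close> is chosen before \<open>P\<close>, because the predicates
  will depend on the point set.\<close>

lemma ramsey_subsequence: "\<exists>N. \<forall>P. \<exists>s t. homogeneous P r k N s t"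
proof -
  obtain N :: nat where N: "partn_lst {..<N} [k, k] r" using ramsey_full by blast
  have "\<exists>s t. homogeneous P r k N s t" for P
  proof -
    define f where "f X = (if P (sorted_list_of_set X) then 0 else 1 :: nat)" for X
    have "f \<in> nsets {..<N} r \<rightarrow> {..<length [k, k]}" by (auto simp: f_def)
    then have "\<exists>t<length [k, k]. monochromatic {..<N} ([k, k] ! t) r f t"
      by (rule bspec[OF N[unfolded partn_lst_def]])
    then obtain t where t: "t < length [k, k]" "monochromatic {..<N} ([k, k] ! t) r f t" by blast
    have "[k, k] ! t = k" using t(1) by (cases t) auto
    then obtain H where H: "H \<in> nsets {..<N} k" "f ` nsets H r \<subseteq> {t}"
      using t(2) unfolding monochromatic_def by auto
    have fin: "finite H" "card H = k" "H \<subseteq> {..<N}" using H(1) by (auto simp: nsets_def)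
    define s where "s i = sorted_list_of_set H ! i" for i
    have mono: "s i < s j" if "i < j" "j < k" for i j
      unfolding s_def using that fin by (intro sorted_wrt_nth_less[of "(<)"]) auto
    have sH: "s i \<in> H" if "i < k" for i
      unfolding s_def using that fin nth_mem[of i "sorted_list_of_set H"] by simp
    have "P (map s xs) = (t = 0)" if xs: "sorted_wrt (<) xs" "length xs = r" "set xs \<subseteq> {..<k}" for xs
    proof -
      have 1: "sorted_wrt (<) (map s xs)"
        unfolding sorted_wrt_map by (rule sorted_wrt_mono_rel[OF _ xs(1)]) (use xs(3) mono in auto)
      have 2: "sorted_list_of_set (set (map s xs)) = map s xs"
        using 1 unfolding strict_sorted_iff by (intro sorted_list_of_set.idem_if_sorted_distinct) auto
      have "card (set (map s xs)) = r" using 1 xs(2) distinct_card[of "map s xs"] by (auto simp: strict_sorted_iff)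
      then have "set (map s xs) \<in> nsets H r" using xs(3) sH by (auto simp: nsets_def)
      then have "f (set (map s xs)) = t" using H(2) by blast
      then show ?thesis unfolding f_def 2 by (auto split: if_splits)
    qed
    moreover have "s i < N" if "i < k" for i using sH[OF that] fin(3) by auto
    ultimately have "homogeneous P r k N s (t = 0)" using mono unfolding homogeneous_def by auto
    then show ?thesis by blast
  qed
  then show ?thesis by blast
qed

section \<open>Convex chains in point sets in general position\<close>

definition orient :: "real^2 \<Rightarrow> real^2 \<Rightarrow> real^2 \<Rightarrow> real" where
  "orient a b x = cross2 (x - a) (b - a)"

lemma affine_dependent_if_orient_zero:
  assumes "orient a b c = 0" "a \<noteq> b" "a \<noteq> c" "b \<noteq> c" shows "affine_dependent {a, b, c}"
proof -
  have e: "(c $ 1 - a $ 1) * (b $ 2 - a $ 2) = (c $ 2 - a $ 2) * (b $ 1 - a $ 1)"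
    using assms(1) by (simp add: orient_def cross2_def)
  have "\<exists>t. c - a = t *\<^sub>R (b - a)"
  proof (cases "b $ 1 = a $ 1")
    case False
    then show ?thesis using e
      by (intro exI[of _ "(c $ 1 - a $ 1) / (b $ 1 - a $ 1)"]) (simp add: vec_eq_iff forall_2 eq_divide_eq)
  next
    case True
    then have "b $ 2 \<noteq> a $ 2" using assms(2) by (auto simp: vec_eq_iff forall_2)
    then show ?thesis using e True
      by (intro exI[of _ "(c $ 2 - a $ 2) / (b $ 2 - a $ 2)"]) (simp add: vec_eq_iff forall_2 eq_divide_eq)
  qed
  then have "collinear {0, b - a, c - a}" unfolding collinear_lemma by blast
  then have "collinear {b, a, c}" using collinear_3[of b a c] by simp
  then have "collinear {a, b, c}" by (simp add: insert_commute)
  then show ?thesis using assms collinear_3_eq_affine_dependent[of a b c] by blast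
qed

text \<open>If the six-point inequality failed for both the first and the last six of seven points, three
  lines (\<open>q 0 q 3\<close>, \<open>q 2 q 5\<close> and \<open>q 3 q 6\<close>) would meet the line \<open>q 1 q 4\<close> in a cyclically increasing order.\<close>

lemma six_point_inequality:
  fixes q :: "nat \<Rightarrow> real^2"
  assumes pos: "\<And>i j k. i < j \<Longrightarrow> j < k \<Longrightarrow> k < (7::nat) \<Longrightarrow> 0 < \<sigma> * orient (q i) (q k) (q j)"
    and six0: "orient (q 2) (q 5) (q 1) * orient (q 0) (q 3) (q 4) < orient (q 0) (q 3) (q 1) * orient (q 2) (q 5) (q 4)"
    and six1: "orient (q 3) (q 6) (q 2) * orient (q 1) (q 4) (q 5) < orient (q 1) (q 4) (q 2) * orient (q 3) (q 6) (q 5)"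
  shows False
proof -
  define B where "B i j k = \<sigma> * orient (q i) (q k) (q j)" for i j k
  have B: "0 < B i j k" if "i < j" "j < k" "k < 7" for i j k using pos that by (simp add: B_def)
  have s2: "0 < \<sigma>\<^sup>2" using B[of 0 1 2] by (auto simp: B_def)
  have 1: "B 0 3 4 * B 1 2 5 < B 0 1 3 * B 2 4 5"
  proof -
    have "B 0 1 3 * B 2 4 5 - B 0 3 4 * B 1 2 5 = \<sigma>\<^sup>2 * (orient (q 0) (q 3) (q 1) * orient (q 2) (q 5) (q 4) - orient (q 2) (q 5) (q 1) * orient (q 0) (q 3) (q 4))"
      by (simp add: B_def orient_def cross2_def power2_eq_square algebra_simps)
    also have "0 < \<dots>" using six0 by (intro mult_pos_pos s2) simp
    finally show ?thesis by linarith
  qed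
  have 2: "B 1 3 6 * B 2 4 5 < B 1 2 5 * B 3 4 6"
  proof -
    have "B 1 2 5 * B 3 4 6 - B 1 3 6 * B 2 4 5 = \<sigma>\<^sup>2 * (orient (q 1) (q 4) (q 2) * orient (q 3) (q 6) (q 5) - orient (q 3) (q 6) (q 2) * orient (q 1) (q 4) (q 5))"
      by (simp add: B_def orient_def cross2_def power2_eq_square algebra_simps)
    also have "0 < \<dots>" using six1 by (intro mult_pos_pos s2) simp
    finally show ?thesis by linarith
  qed
  \<comment> \<open>This inequality follows from convex position alone, by a three-term Pluecker
    relation for the lines through \<open>q 3\<close>.\<close>
  have 3: "B 0 1 3 * B 3 4 6 < B 0 3 4 * B 1 3 6"
  proof -
    have "B 0 3 4 * B 1 3 6 - B 0 1 3 * B 3 4 6 = B 0 3 6 * B 1 3 4"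
      by (simp add: B_def orient_def cross2_def power2_eq_square algebra_simps)
    moreover have "0 < B 0 3 6 * B 1 3 4" using B by simp
    ultimately show ?thesis by linarith
  qed
  \<comment> \<open>In the product of the three inequalities the same six positive factors appear on
    both sides.\<close>
  have "B 0 3 4 * B 1 2 5 * (B 1 3 6 * B 2 4 5) < B 0 1 3 * B 2 4 5 * (B 1 2 5 * B 3 4 6)"
    by (intro mult_strict_mono 1 2 mult_nonneg_nonneg mult_pos_pos less_imp_le[OF B] B) auto
  also have "\<dots> = (B 2 4 5 * B 1 2 5) * (B 0 1 3 * B 3 4 6)" by (simp only: ac_simps)
  also have "\<dots> < (B 2 4 5 * B 1 2 5) * (B 0 3 4 * B 1 3 6)"
    by (intro mult_strict_left_mono 3 mult_pos_pos B) auto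
  finally show False by (simp add: ac_simps)
qed

text \<open>Triples are made homogeneous first, then six-tuples, then quadruples; passing to
  subsequences preserves what has been reached, and the Ramsey numbers are fixed in the reverse
  order.\<close>

lemma chain_exists:
  "\<exists>N. \<forall>S :: (real^2) set. finite S \<and> general_position S \<and> N \<le> card S \<longrightarrow>
     (\<exists>q \<epsilon>. chain q n \<epsilon> \<and> (\<forall>i<n. q i \<in> S))"
proof -
  \<comment> \<open>Seven points determine the sign of the six-point condition.\<close>
  define n7 where "n7 = max n 7"
  obtain N4 where N4: "\<forall>P. \<exists>s t. homogeneous P 4 n7 N4 s t" by (rule exE[OF ramsey_subsequence])
  obtain N6 where N6: "\<forall>P. \<exists>s t. homogeneous P 6 N4 N6 s t" by (rule exE[OF ramsey_subsequence])
  obtain N3 where N3: "\<forall>P. \<exists>s t. homogeneous P 3 N6 N3 s t" by (rule exE[OF ramsey_subsequence])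
  show ?thesis
  proof (intro exI[of _ N3] allI impI, elim conjE)
    fix S :: "(real^2) set" assume S: "finite S" "general_position S" "N3 \<le> card S"
    obtain p where p: "bij_betw p {..<card S} S" using S(1) ex_bij_betw_nat_finite[of S] by (auto simp: atLeast0LessThan)
    have pS: "p i \<in> S" if "i < N3" for i using p that S(3) by (auto simp: bij_betw_def)
    have pinj: "p i \<noteq> p j" if "i < N3" "j < N3" "i \<noteq> j" for i j
      using p that S(3) by (auto simp: bij_betw_def inj_on_def)
    have gp: "orient a b c \<noteq> 0" if "a \<in> S" "b \<in> S" "c \<in> S" "a \<noteq> b" "a \<noteq> c" "b \<noteq> c" for a b c
    proof
      assume "orient a b c = 0"
      then have "affine_dependent {a, b, c}" using affine_dependent_if_orient_zero that by blast
      moreover have "card {a, b, c} \<le> CARD(2) + 1" using card_insert_le_m1[of 3] by (simp add: card_insert_if)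
      ultimately show False using S(2) that unfolding general_position_def
        by (metis empty_subsetI finite.emptyI finite.insertI insert_subset)
    qed
    obtain s3 t3 where "homogeneous (\<lambda>xs. 0 < orient (p (xs ! 0)) (p (xs ! 2)) (p (xs ! 1))) 3 N6 N3 s3 t3"
      using N3 by blast
    note s3 = homogeneousD(1,2)[OF this] and t3 = homogeneousD(3)[OF this]
    define p3 where "p3 i = p (s3 i)" for i
    define \<sigma> :: real where "\<sigma> = (if t3 then 1 else -1)"
    have p3: "p3 i \<in> S" if "i < N6" for i using that s3 pS by (simp add: p3_def)
    have or3: "0 < \<sigma> * orient (p3 i) (p3 k) (p3 j)" if ijk: "i < j" "j < k" "k < N6" for i j k
    proof -
      have lt: "s3 i < s3 j" "s3 j < s3 k" "s3 k < N3" using ijk s3 by auto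
      then have "orient (p3 i) (p3 k) (p3 j) \<noteq> 0"
        unfolding p3_def using pinj[of "s3 i" "s3 k"] pinj[of "s3 i" "s3 j"] pinj[of "s3 k" "s3 j"]
        by (intro gp pS) auto
      then show ?thesis using t3[of "[i,j,k]"] ijk by (auto simp: p3_def \<sigma>_def)
    qed
    obtain s6 t6 where "homogeneous (\<lambda>xs. let f = (\<lambda>i. p3 (xs ! i)) in
        orient (f 0) (f 3) (f 1) * orient (f 2) (f 5) (f 4) \<le> orient (f 2) (f 5) (f 1) * orient (f 0) (f 3) (f 4)) 6 N4 N6 s6 t6"
      using N6 by blast
    note s6 = homogeneousD(1,2)[OF this] and t6 = homogeneousD(3)[OF this]
    define p6 where "p6 i = p3 (s6 i)" for i
    \<comment> \<open>General position excludes collinear triples. Chords may still be parallel and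
      lines through pairs of points concurrent, hence the weak inequalities here and for six
      points.\<close>
    obtain s4 t4 where "homogeneous (\<lambda>xs. 0 \<le> cross2 (p6 (xs ! 3) - p6 (xs ! 0)) (p6 (xs ! 2) - p6 (xs ! 1))) 4 n7 N4 s4 t4"
      using N4 by blast
    note s4 = homogeneousD(1,2)[OF this] and t4 = homogeneousD(3)[OF this]
    define q where "q i = p6 (s4 i)" for i
    have qS: "q i \<in> S" if "i < n7" for i using that s4 s6 p3 by (simp add: q_def p6_def)
    have tri: "0 < \<sigma> * orient (q i) (q k) (q j)" if "i < j" "j < k" "k < n7" for i j k
      unfolding q_def p6_def using that s4 s6 by (intro or3) auto
    have six_eq: "(orient (q a) (q b) (q i) * orient (q c) (q d) (q j) \<le> orient (q c) (q d) (q i) * orient (q a) (q b) (q j)) = t6"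
      if "a < i" "i < c" "c < b" "b < j" "j < d" "d < n7" for a i c b j d
      using t6[of "[s4 a, s4 i, s4 c, s4 b, s4 j, s4 d]"] that s4 by (simp add: q_def p6_def Let_def numeral_eq_Suc)
    have "t6"
    proof (rule ccontr)
      assume "\<not> t6"
      then show False
        using six_eq[of 0 1 2 3 4 5] six_eq[of 1 2 3 4 5 6]
        by (intro six_point_inequality[of \<sigma> q]) (auto simp: n7_def not_le intro!: tri)
    qed
    with six_eq have six: "orient (q a) (q b) (q i) * orient (q c) (q d) (q j) \<le> orient (q c) (q d) (q i) * orient (q a) (q b) (q j)"
      if "a < i" "i < c" "c < b" "b < j" "j < d" "d < n7" for a i c b j d using that by blast
    define \<tau> :: real where "\<tau> = (if t4 then 1 else -1)"
    have quad: "0 \<le> \<tau> * cross2 (q l - q i) (q k - q j)" if "i < j" "j < k" "k < l" "l < n7" for i j k l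
      using t4[of "[i,j,k,l]"] that by (auto simp: q_def \<tau>_def numeral_eq_Suc)
    have sg: "\<sigma> = 1 \<or> \<sigma> = -1" "\<tau> = 1 \<or> \<tau> = -1" by (auto simp: \<sigma>_def \<tau>_def)
    have nn: "n \<le> n7" by (simp add: n7_def)
    have side_eq: "\<epsilon> * cross2 (x - a) (b - a) = \<epsilon> * orient a b x" for \<epsilon> a b x by (simp add: orient_def)
    show "\<exists>q \<epsilon>. chain q n \<epsilon> \<and> (\<forall>i<n. q i \<in> S)"
    proof (cases "\<sigma> = \<tau>")
      case True
      have "chain q n \<sigma>"
      proof (unfold_locales, unfold side_eq)
        show "0 < \<sigma> * orient (q i) (q k) (q j)" if "i < j" "j < k" "k < n" for i j k using tri that nn by auto
        show "0 \<le> \<sigma> * cross2 (q l - q i) (q k - q j)" if "i < j" "j < k" "k < l" "l < n" for i j k l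
          using quad that nn True by auto
        show "\<sigma> * orient (q a) (q b) (q i) * (\<sigma> * orient (q c) (q d) (q j)) \<le> \<sigma> * orient (q c) (q d) (q i) * (\<sigma> * orient (q a) (q b) (q j))"
          if "a < i" "i < c" "c < b" "b < j" "j < d" "d < n" for a i c b j d
          using six[of a i c b j d] that nn sg(1) by auto
      qed
      then show ?thesis using qS nn by (intro exI[of _ q] exI[of _ \<sigma>]) auto
    next
      case False
      then have ts: "\<tau> = - \<sigma>" using sg by auto
      \<comment> \<open>Reversal changes the sign of every triple but not of a quadruple, where both
        difference vectors are negated. In the six-point condition it exchanges the two lines and
        the two points, which yields the same inequality.\<close>
      define q' where "q' i = q (n - 1 - i)" for i
      have flip: "orient (q b) (q a) x = - orient (q a) (q b) x" for a b x by (simp add: orient_def cross2_def algebra_simps)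
      have "chain q' n \<tau>"
      proof (unfold_locales, unfold side_eq)
        show "0 < \<tau> * orient (q' i) (q' k) (q' j)" if "i < j" "j < k" "k < n" for i j k
        proof -
          have "0 < \<sigma> * orient (q (n - 1 - k)) (q (n - 1 - i)) (q (n - 1 - j))" using that nn by (intro tri) auto
          then show ?thesis unfolding ts q'_def by (subst flip) simp
        qed
        show "0 \<le> \<tau> * cross2 (q' l - q' i) (q' k - q' j)" if "i < j" "j < k" "k < l" "l < n" for i j k l
        proof -
          have "0 \<le> \<tau> * cross2 (q (n - 1 - i) - q (n - 1 - l)) (q (n - 1 - j) - q (n - 1 - k))"
            using that nn by (intro quad) auto
          then show ?thesis by (simp add: q'_def cross2_def algebra_simps)
        qed
        show "\<tau> * orient (q' a) (q' b) (q' i) * (\<tau> * orient (q' c) (q' d) (q' j)) \<le> \<tau> * orient (q' c) (q' d) (q' i) * (\<tau> * orient (q' a) (q' b) (q' j))"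
          if "a < i" "i < c" "c < b" "b < j" "j < d" "d < n" for a i c b j d
        proof -
          have "orient (q (n-1-d)) (q (n-1-c)) (q (n-1-j)) * orient (q (n-1-b)) (q (n-1-a)) (q (n-1-i))
             \<le> orient (q (n-1-b)) (q (n-1-a)) (q (n-1-j)) * orient (q (n-1-d)) (q (n-1-c)) (q (n-1-i))"
            using that nn by (intro six) auto
          then have "orient (q' a) (q' b) (q' i) * orient (q' c) (q' d) (q' j) \<le> orient (q' c) (q' d) (q' i) * orient (q' a) (q' b) (q' j)"
            unfolding q'_def flip[of "n-1-c"] flip[of "n-1-a"] by (simp add: mult.commute)
          then show ?thesis using sg(2) by auto
        qed
      qed
      then show ?thesis using qS nn by (intro exI[of _ q'] exI[of _ \<tau>]) (auto simp: q'_def)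
    qed
  qed
qed

subsection \<open>Graphs with a noncrossing order\<close>

lemma nerve_isomorphic_graph_complex:
  fixes P :: "'v \<Rightarrow> (real^'d) set" and D :: "'v \<Rightarrow> (real^'d) set"
  assumes gr: "simple_graph V E" and vs: "set vs = V" "distinct vs"
    and D: "\<And>v. v \<in> V \<Longrightarrow> convex (D v)" "\<And>v. v \<in> V \<Longrightarrow> P v \<subseteq> D v" and adm: "admissible E V D"
    and ne: "\<And>v. v \<in> V \<Longrightarrow> P v \<noteq> {}"
    and edge: "\<And>u v. u \<in> V \<Longrightarrow> v \<in> V \<Longrightarrow> u \<noteq> v \<Longrightarrow> {u, v} \<in> E \<Longrightarrow> convex hull P u \<inter> convex hull P v \<noteq> {}"
  shows "complex_isomorphic (nerve (length vs) (\<lambda>i. P (vs ! (i - 1)))) (graph_complex V E)"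
proof -
  define f where "f i = vs ! (i - 1)" for i :: nat
  let ?m = "length vs"
  have bij: "bij_betw f {1..?m} V"
  proof -
    have "bij_betw ((!) vs) {..<?m} V" using bij_betw_nth[OF vs(2)] vs(1) by simp
    moreover have "bij_betw (\<lambda>i. i - 1) {1..?m} {..<?m}"
      by (rule bij_betw_byWitness[where f' = Suc]) auto
    ultimately have "bij_betw ((!) vs \<circ> (\<lambda>i. i - 1)) {1..?m} V" using bij_betw_trans by blast
    then show ?thesis by (simp add: f_def[abs_def] o_def)
  qed
  have fV: "f i \<in> V" if "i \<in> {1..?m}" for i using bij that by (auto simp: bij_betw_def)
  have finj: "f i \<noteq> f j" if "i \<in> {1..?m}" "j \<in> {1..?m}" "i \<noteq> j" for i j
    using bij that by (auto simp: bij_betw_def inj_on_def)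
  have hullD: "convex hull P v \<subseteq> D v" if "v \<in> V" for v using D that by (simp add: hull_minimal)
  let ?N = "nerve ?m (\<lambda>i. P (f i))" and ?K = "graph_complex V E"
  have sing: "{i} \<in> ?N" if "i \<in> {1..?m}" for i
    using ne[OF fV[OF that]] that by (auto simp: nerve_def)
  have UN: "\<Union>?N = {1..?m}"
  proof
    show "\<Union>?N \<subseteq> {1..?m}" unfolding nerve_def by blast
    show "{1..?m} \<subseteq> \<Union>?N" using sing by blast
  qed
  have UK: "\<Union>?K = V" using gr by (auto simp: graph_complex_def simple_graph_def)
  have iff: "\<sigma> \<in> ?N \<longleftrightarrow> f ` \<sigma> \<in> ?K" if sub: "\<sigma> \<subseteq> {1..?m}" for \<sigma>
  proof
    assume "\<sigma> \<in> ?N"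
    then obtain x where x: "\<And>i. i \<in> \<sigma> \<Longrightarrow> x \<in> convex hull P (f i)" unfolding nerve_def by blast
    then have xD: "x \<in> D (f i)" if "i \<in> \<sigma>" for i using hullD[OF fV] that sub by blast
    \<comment> \<open>A larger face contains three different indices, so the absence of triple
      points excludes faces of every higher dimension.\<close>
    consider "\<sigma> = {}" | i where "\<sigma> = {i}" | i j where "\<sigma> = {i, j}" "i \<noteq> j"
      | i j k where "i \<in> \<sigma>" "j \<in> \<sigma>" "k \<in> \<sigma>" "i \<noteq> j" "j \<noteq> k" "i \<noteq> k" by blast
    then show "f ` \<sigma> \<in> ?K"
    proof cases
      case 1 then show ?thesis by (simp add: graph_complex_def)
    next
      case 2 then show ?thesis using fV[of i] sub by (auto simp: graph_complex_def)
    next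
      case 3
      then have "{f i, f j} \<in> E"
        using admissible_edge[OF adm, of "f i" "f j" x] xD[of i] xD[of j] fV finj sub by auto
      then show ?thesis using 3 by (simp add: graph_complex_def)
    next
      case 4
      then have "False" using admissible_triple[OF adm, of "f i" "f j" "f k" x] xD fV finj sub by blast
      then show ?thesis ..
    qed
  next
    assume K: "f ` \<sigma> \<in> ?K"
    have injs: "inj_on f \<sigma>" using bij sub by (auto simp: bij_betw_def intro: inj_on_subset)
    consider "f ` \<sigma> = {}" | v where "f ` \<sigma> = {v}" | "f ` \<sigma> \<in> E" using K by (auto simp: graph_complex_def)
    then show "\<sigma> \<in> ?N"
    proof cases
      case 1 then show ?thesis by (simp add: nerve_def)
    next
      case 2
      then have "card \<sigma> = 1" using card_image[OF injs] by simp
      then obtain i where "\<sigma> = {i}" by (auto simp: card_1_singleton_iff)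
      then show ?thesis using sing sub by auto
    next
      case 3
      then have "card \<sigma> = 2" using gr card_image[OF injs] by (auto simp: simple_graph_def)
      then obtain i j where ij: "\<sigma> = {i, j}" "i \<noteq> j" by (auto simp: card_2_iff)
      then have "convex hull P (f i) \<inter> convex hull P (f j) \<noteq> {}"
        using edge[of "f i" "f j"] fV finj sub 3 by auto
      then show ?thesis using ij sub by (auto simp: nerve_def)
    qed
  qed
  show ?thesis
    unfolding complex_isomorphic_def UK
    using bij iff UN UK unfolding f_def[symmetric] by (intro exI[of _ f]) auto
qed

text \<open>The chain construction starts from two different vertices, so a single vertex is treated
  separately.\<close>

lemma d_Tverberg_singleton: "d_Tverberg TYPE(2) (graph_complex {v} {})"
  unfolding d_Tverberg_def
proof (rule exI[of _ 1], intro allI impI, elim conjE)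
  fix S :: "(real^2) set" assume S: "finite S" "1 \<le> card S"
  then have ne: "S \<noteq> {}" by auto
  have "complex_isomorphic (nerve (length [v]) (\<lambda>i. (\<lambda>_. S) ([v] ! (i - 1)))) (graph_complex {v} {})"
    by (rule nerve_isomorphic_graph_complex[where D = "\<lambda>_. UNIV"])
      (use ne in \<open>auto simp: simple_graph_def admissible_def\<close>)
  then show "\<exists>m P. indexed_partition m P S \<and> complex_isomorphic (nerve m P) (graph_complex {v} {})"
    using ne by (intro exI[of _ 1] exI[of _ "\<lambda>_. S"]) (auto simp: indexed_partition_def disjoint_family_on_def)
qed

context chain
begin

lemma chain_partition:
  fixes V :: "'v set"
  assumes gr: "simple_graph V E" and V: "set (a # ys @ [b]) = V" and dist: "distinct (a # ys @ [b])"
    and nc: "noncrossing E (a # ys @ [b])" and n: "n = 2 * room (length ys) + 3"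
    and S: "\<And>i. i < n \<Longrightarrow> q i \<in> S"
  shows "\<exists>m P. indexed_partition m P S \<and> complex_isomorphic (nerve m P) (graph_complex V E)"
proof -
  \<comment> \<open>The window \<open>{0<..<d}\<close> has exactly \<open>room (length ys)\<close>
    points on each side of \<open>q c\<close>. The point \<open>q 0\<close> stays outside of it and
    makes the part of \<open>a\<close> nonempty.\<close>
  define c d where "c = room (length ys) + 1" and "d = 2 * room (length ys) + 2"
  define L where "L = {x. 0 < side c d x}"
  define D where "D v = (if v = b then L else if {a,b} \<in> E then UNIV else - L)" for v :: 'v
  have rm: "4 \<le> room (length ys)" using room_mono[of 0 "length ys"] by simp
  have ord: "0 < c" "c < d" "d < n" "3 \<le> n" using n rm by (auto simp: c_def d_def)
  have ab: "a \<noteq> b" using dist by auto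
  have cvL: "convex L" "convex (- L)"
    using convex_pos_affine_fun[OF affine_fun_side] convex_nonpos_affine_fun[OF affine_fun_side] by (auto simp: L_def)
  have port: "port E {a,b} D a b UNIV c d 0 d UNIV"
    unfolding port_def using ab ord by (auto simp: D_def L_def)
  have adm: "admissible E {a,b} D"
    unfolding admissible_def using ab by (auto simp: D_def insert_commute split: if_splits)
  have "\<exists>D' \<phi>. filled E {a,b} D a b ys UNIV {0<..<d} D' \<phi>"
    by (rule fill_block[OF port adm _ dist _ nc]) (use cvL dist in \<open>auto simp: D_def c_def d_def\<close>)
  then obtain D' \<phi> where fill: "filled E {a,b} D a b ys UNIV {0<..<d} D' \<phi>" by blast
  note T = filledD[OF fill]
  have FV: "{a,b} \<union> set ys = V" using V by auto
  have inj: "inj_on q {..<n}" using inj_on_q ord by simp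
  have q0: "q 0 \<in> D' a"
  proof -
    have "side c d (q 0) < 0" using ord by (intro side_neg_left) auto
    then have "q 0 \<in> D a" using ab by (auto simp: D_def L_def)
    then show ?thesis using T(7)[of 0] ord by auto
  qed
  have cov: "\<exists>v\<in>V. x \<in> D' v" for x
  proof -
    have "x \<in> (\<Union>v\<in>{a,b}. D v)" using ab by (auto simp: D_def)
    then show ?thesis using T(5) FV by auto
  qed
  \<comment> \<open>Window points follow their labels. Points off the chain, and chain points behind
    the window, go to an arbitrary set containing them; the covering provides one.\<close>
  define A where "A x = (if \<exists>i\<in>{0<..<d}. x = q i then \<phi> (inv_into {..<n} q x) else if x = q 0 then a
     else (SOME v. v \<in> V \<and> x \<in> D' v))" for x
  have Aq: "A (q i) = \<phi> i" if "i \<in> {0<..<d}" for i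
  proof -
    have "\<exists>j\<in>{0<..<d}. q i = q j" using that by blast
    moreover have "inv_into {..<n} q (q i) = i" using that ord by (intro inv_into_f_f[OF inj]) auto
    ultimately show ?thesis by (simp only: A_def if_True)
  qed
  have A0: "A (q 0) = a"
  proof -
    have "\<not> (\<exists>i\<in>{0<..<d}. q 0 = q i)" using inj_onD[OF inj, of 0] ord by force
    then show ?thesis unfolding A_def by (simp only: if_False if_True refl)
  qed
  have AD: "A x \<in> V \<and> x \<in> D' (A x)" for x
  proof -
    consider i where "i \<in> {0<..<d}" "x = q i" | "x = q 0" | "\<not> (\<exists>i\<in>{0<..<d}. x = q i)" "x \<noteq> q 0" by blast
    then show ?thesis
    proof cases
      case 1 then show ?thesis using Aq T(8)[of i] T(9)[of i] FV by auto
    next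
      case 2 then show ?thesis using A0 q0 FV by auto
    next
      case 3
      then have "A x = (SOME v. v \<in> V \<and> x \<in> D' v)" unfolding A_def by (simp only: if_False)
      then show ?thesis using someI_ex[of "\<lambda>v. v \<in> V \<and> x \<in> D' v"] cov[of x] by auto
    qed
  qed
  define P where "P v = {x \<in> S. A x = v}" for v
  define vs where "vs = a # ys @ [b]"
  have ne: "P v \<noteq> {}" if v: "v \<in> V" for v
  proof (cases "v = a")
    case True
    then have "q 0 \<in> P v" using A0 S[of 0] ord by (auto simp: P_def)
    then show ?thesis by auto
  next
    case False
    then obtain i where i: "i \<in> {0<..<d}" "\<phi> i = v" using T(10)[of v] v FV by auto
    then have "q i \<in> P v" using Aq[of i] S[of i] ord by (auto simp: P_def)
    then show ?thesis by auto
  qed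
  have edge: "convex hull P u \<inter> convex hull P v \<noteq> {}" if uv: "u \<in> V" "v \<in> V" "u \<noteq> v" "{u, v} \<in> E" for u v
  proof -
    have "alternates \<phi> {0<..<d} u v" using T(11)[of u v] uv FV by auto
    then obtain i j k l where w: "i \<in> {0<..<d}" "j \<in> {0<..<d}" "k \<in> {0<..<d}" "l \<in> {0<..<d}"
      and lt: "i < j" "j < k" "k < l" and eq: "{\<phi> i, \<phi> j} = {u, v}" "\<phi> k = \<phi> i" "\<phi> l = \<phi> j"
      unfolding alternates_def by blast
    have "convex hull {q i, q k} \<inter> convex hull {q j, q l} \<noteq> {}"
      using lt w ord by (intro segments_cross) auto
    moreover have "{q i, q k} \<subseteq> P (\<phi> i)" "{q j, q l} \<subseteq> P (\<phi> j)"
      using Aq w eq S ord by (auto simp: P_def)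
    ultimately have "convex hull P (\<phi> i) \<inter> convex hull P (\<phi> j) \<noteq> {}"
      using hull_mono[of "{q i, q k}" "P (\<phi> i)" convex] hull_mono[of "{q j, q l}" "P (\<phi> j)" convex] by blast
    moreover have "(\<phi> i = u \<and> \<phi> j = v) \<or> (\<phi> i = v \<and> \<phi> j = u)" using eq(1) uv(3) by (auto simp: doubleton_eq_iff)
    ultimately show ?thesis by (auto simp: Int_commute)
  qed
  have "complex_isomorphic (nerve (length vs) (\<lambda>i. P (vs ! (i - 1)))) (graph_complex V E)"
    by (rule nerve_isomorphic_graph_complex[OF gr _ _ _ _ _ ne edge, where D = D'])
      (use V dist T(4,6) FV AD in \<open>auto simp: vs_def P_def\<close>)
  moreover have "indexed_partition (length vs) (\<lambda>i. P (vs ! (i - 1))) S"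
    unfolding indexed_partition_def
  proof (intro conjI ballI)
    have vsV: "set vs = V" "distinct vs" using V dist by (auto simp: vs_def)
    show "P (vs ! (i - 1)) \<noteq> {}" if "i \<in> {1..length vs}" for i
      using ne[of "vs ! (i - 1)"] vsV(1) nth_mem[of "i - 1" vs] that by auto
    show "disjoint_family_on (\<lambda>i. P (vs ! (i - 1))) {1..length vs}"
      unfolding disjoint_family_on_def
    proof (intro ballI impI)
      fix i j assume ij: "i \<in> {1..length vs}" "j \<in> {1..length vs}" "i \<noteq> j"
      then have "vs ! (i - 1) \<noteq> vs ! (j - 1)" using vsV(2) by (subst nth_eq_iff_index_eq) auto
      then show "P (vs ! (i - 1)) \<inter> P (vs ! (j - 1)) = {}" by (auto simp: P_def)
    qed
    show "(\<Union>i\<in>{1..length vs}. P (vs ! (i - 1))) = S"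
    proof
      show "S \<subseteq> (\<Union>i\<in>{1..length vs}. P (vs ! (i - 1)))"
      proof
        fix x assume x: "x \<in> S"
        have "A x \<in> set vs" using AD vsV by auto
        then obtain k where "k < length vs" "vs ! k = A x" by (auto simp: in_set_conv_nth)
        then show "x \<in> (\<Union>i\<in>{1..length vs}. P (vs ! (i - 1)))"
          using x by (intro UN_I[of "Suc k"]) (auto simp: P_def)
      qed
    qed (auto simp: P_def)
  qed
  ultimately show ?thesis by blast
qed

end

lemma d_Tverberg_if_noncrossing:
  assumes gr: "simple_graph V E" and vs: "set vs = V" "distinct vs" "vs \<noteq> []" and nc: "noncrossing E vs"
  shows "d_Tverberg TYPE(2) (graph_complex V E)"
proof (cases "length vs = 1")
  case True
  then obtain v where v: "vs = [v]" by (auto simp: length_Suc_conv)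
  have "card e \<le> 1" if "e \<in> E" for e
    using card_mono[of "{v}" e] that gr vs(1) v by (auto simp: simple_graph_def)
  then have "E = {}" using gr by (fastforce simp: simple_graph_def)
  then show ?thesis using d_Tverberg_singleton[of v] v vs(1) by simp
next
  case False
  obtain a us where us: "vs = a # us" using vs(3) by (cases vs) auto
  then have "us \<noteq> []" using False by auto
  then have vs_eq: "vs = a # butlast us @ [last us]" using us by simp
  define ys b where "ys = butlast us" and "b = last us"
  have e: "vs = a # ys @ [b]" using vs_eq by (simp add: ys_def b_def)
  \<comment> \<open>\<open>room\<close> does not depend on the locale parameters, so the length, and
    with it \<open>N\<close>, is fixed before the point set is given.\<close>
  let ?n = "2 * chain.room (length ys) + 3"
  obtain N where N: "\<forall>S :: (real^2) set. finite S \<and> general_position S \<and> N \<le> card S \<longrightarrow>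
     (\<exists>q \<epsilon>. chain q ?n \<epsilon> \<and> (\<forall>i< ?n. q i \<in> S))"
    by (rule exE[OF chain_exists[of ?n]])
  show ?thesis
    unfolding d_Tverberg_def
  proof (rule exI[of _ N], intro allI impI)
    fix S :: "(real^2) set" assume "finite S \<and> general_position S \<and> N \<le> card S"
    then obtain q \<epsilon> where "chain q ?n \<epsilon>" and qS: "\<forall>i< ?n. q i \<in> S" using N by blast
    then interpret chain q ?n \<epsilon> "\<lambda>a b x. \<epsilon> * cross2 (x - q a) (q b - q a)" by auto
    show "\<exists>m P. indexed_partition m P S \<and> complex_isomorphic (nerve m P) (graph_complex V E)"
      by (rule chain_partition[OF gr, of a ys b]) (use e vs nc qS in auto)
  qed
qed

subsection \<open>Combining noncrossing orders\<close>

lemma nth_append_mem: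
  assumes "distinct (xs @ ys)" "t < length (xs @ ys)"
  shows "(xs @ ys) ! t \<in> set xs \<longleftrightarrow> t < length xs" "(xs @ ys) ! t \<in> set ys \<longleftrightarrow> length xs \<le> t"
proof -
  have 1: "(xs @ ys) ! t \<in> set xs" if "t < length xs" using that by (simp add: nth_append)
  have 2: "(xs @ ys) ! t \<in> set ys" if "length xs \<le> t" using that assms(2) by (simp add: nth_append)
  have 3: "set xs \<inter> set ys = {}" using assms(1) by simp
  show "(xs @ ys) ! t \<in> set xs \<longleftrightarrow> t < length xs" "(xs @ ys) ! t \<in> set ys \<longleftrightarrow> length xs \<le> t"
    using 1 2 3 by (meson disjoint_iff not_le)+
qed

text \<open>Edges in different blocks do not interleave, and an edge between the first and the last
  vertex crosses nothing.\<close>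

lemma noncrossing_append:
  assumes xs: "noncrossing E xs" and ys: "noncrossing E ys" and dist: "distinct (xs @ ys)"
    and edges: "\<And>u v. {u, v} \<in> E \<Longrightarrow> u \<in> set (xs @ ys) \<Longrightarrow> v \<in> set (xs @ ys) \<Longrightarrow>
      {u, v} \<subseteq> set xs \<or> {u, v} \<subseteq> set ys \<or> {u, v} = {hd (xs @ ys), last (xs @ ys)}"
  shows "noncrossing E (xs @ ys)"
  unfolding noncrossing_def
proof (intro allI impI notI, elim conjE)
  let ?L = "xs @ ys" and ?m = "length xs"
  fix i j k l assume o: "i < j" "j < k" "k < l" "l < length ?L" and e: "{?L ! i, ?L ! k} \<in> E" "{?L ! j, ?L ! l} \<in> E"
  have ne: "?L \<noteq> []" using o by auto
  note inx = nth_append_mem(1)[OF dist] and iny = nth_append_mem(2)[OF dist]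
  have hd: "?L ! t = hd ?L \<longleftrightarrow> t = 0" if "t < length ?L" for t
    using that nth_eq_iff_index_eq[OF dist that, of 0] ne by (simp add: hd_conv_nth)
  have la: "?L ! t = last ?L \<longleftrightarrow> t = length ?L - 1" if "t < length ?L" for t
    using that nth_eq_iff_index_eq[OF dist that, of "length ?L - 1"] ne unfolding last_conv_nth[OF ne] by auto
  have cl: "(s < ?m \<and> t < ?m) \<or> (?m \<le> s \<and> ?m \<le> t) \<or> (s = 0 \<and> t = length ?L - 1)"
    if st: "s < t" "t < length ?L" "{?L ! s, ?L ! t} \<in> E" for s t
  proof -
    have mem: "?L ! s \<in> set ?L" "?L ! t \<in> set ?L" using st by (intro nth_mem; simp)+
    have "{?L ! s, ?L ! t} \<subseteq> set xs \<or> {?L ! s, ?L ! t} \<subseteq> set ys \<or> {?L ! s, ?L ! t} = {hd ?L, last ?L}"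
      by (rule edges[OF st(3) mem])
    then have "(s < ?m \<and> t < ?m) \<or> (?m \<le> s \<and> ?m \<le> t) \<or> (s = 0 \<and> t = length ?L - 1) \<or> (s = length ?L - 1 \<and> t = 0)"
      using st by (simp only: insert_subset empty_subsetI simp_thms doubleton_eq_iff inx iny hd la less_trans[OF st(1,2)])
    then show ?thesis using st(1) by auto
  qed
  consider "i < ?m" "k < ?m" "j < ?m" "l < ?m" | "?m \<le> i" using cl[of i k] cl[of j l] o e by linarith
  then show False
  proof cases
    case 1
    then show ?thesis using noncrossingD[OF xs, of i j k l] o e by (simp add: nth_append)
  next
    case 2
    then show ?thesis using noncrossingD[OF ys, of "i - ?m" "j - ?m" "k - ?m" "l - ?m"] o e by (simp add: nth_append)
  qed
qed

text \<open>Edges of both blocks may end at the shared vertex, but a crossing requires four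
  different positions in alternating order.\<close>

lemma noncrossing_glue:
  assumes xs: "noncrossing E (xs @ [y])" and ys: "noncrossing E (y # ys)" and dist: "distinct (xs @ y # ys)"
    and edges: "\<And>u v. {u, v} \<in> E \<Longrightarrow> u \<in> set (xs @ y # ys) \<Longrightarrow> v \<in> set (xs @ y # ys) \<Longrightarrow>
      {u, v} \<subseteq> set (xs @ [y]) \<or> {u, v} \<subseteq> set (y # ys) \<or> {u, v} = {hd (xs @ y # ys), last (xs @ y # ys)}"
  shows "noncrossing E (xs @ y # ys)"
  unfolding noncrossing_def
proof (intro allI impI notI, elim conjE)
  let ?L = "xs @ y # ys" and ?m = "length xs"
  fix i j k l assume o: "i < j" "j < k" "k < l" "l < length ?L" and e: "{?L ! i, ?L ! k} \<in> E" "{?L ! j, ?L ! l} \<in> E"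
  have ne: "?L \<noteq> []" by simp
  have inx: "?L ! t \<in> set (xs @ [y]) \<longleftrightarrow> t \<le> ?m" if "t < length ?L" for t
    using nth_append_mem(1)[of "xs @ [y]" ys t] dist that by (simp add: less_Suc_eq_le)
  note iny = nth_append_mem(2)[OF dist]
  have hd: "?L ! t = hd ?L \<longleftrightarrow> t = 0" if "t < length ?L" for t
    using that nth_eq_iff_index_eq[OF dist that, of 0] ne by (simp add: hd_conv_nth)
  have la: "?L ! t = last ?L \<longleftrightarrow> t = length ?L - 1" if "t < length ?L" for t
    using that nth_eq_iff_index_eq[OF dist that, of "length ?L - 1"] ne unfolding last_conv_nth[OF ne] by auto
  have cl: "(s \<le> ?m \<and> t \<le> ?m) \<or> (?m \<le> s \<and> ?m \<le> t) \<or> (s = 0 \<and> t = length ?L - 1)"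
    if st: "s < t" "t < length ?L" "{?L ! s, ?L ! t} \<in> E" for s t
  proof -
    have mem: "?L ! s \<in> set ?L" "?L ! t \<in> set ?L" using st by (intro nth_mem; simp)+
    have "{?L ! s, ?L ! t} \<subseteq> set (xs @ [y]) \<or> {?L ! s, ?L ! t} \<subseteq> set (y # ys) \<or> {?L ! s, ?L ! t} = {hd ?L, last ?L}"
      by (rule edges[OF st(3) mem])
    then have "(s \<le> ?m \<and> t \<le> ?m) \<or> (?m \<le> s \<and> ?m \<le> t) \<or> (s = 0 \<and> t = length ?L - 1) \<or> (s = length ?L - 1 \<and> t = 0)"
      using st by (simp only: insert_subset empty_subsetI simp_thms doubleton_eq_iff inx iny hd la less_trans[OF st(1,2)])
    then show ?thesis using st(1) by auto
  qed
  consider "i \<le> ?m" "k \<le> ?m" "j \<le> ?m" "l \<le> ?m" | "?m \<le> i" using cl[of i k] cl[of j l] o e by linarith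
  then show False
  proof cases
    case 1
    have "?L ! t = (xs @ [y]) ! t" if "t \<le> ?m" for t using that by (auto simp: nth_append)
    then show ?thesis using noncrossingD[OF xs, of i j k l] o e 1 by simp
  next
    case 2
    then show ?thesis using noncrossingD[OF ys, of "i - ?m" "j - ?m" "k - ?m" "l - ?m"] o e by (simp add: nth_append)
  qed
qed

text \<open>In the cyclic order the chord \<open>ab\<close> separates \<open>xs\<close> from
  \<open>ys\<close>; the list \<open>a # b # ys\<close> is the arc from \<open>b\<close> back to
  \<open>a\<close>, read from \<open>a\<close>.\<close>

lemma noncrossing_chord:
  assumes xs: "noncrossing E (a # xs @ [b])" and ys: "noncrossing E (a # b # ys)" and dist: "distinct (a # xs @ b # ys)"
    and edges: "\<And>u v. {u, v} \<in> E \<Longrightarrow> u \<in> set (a # xs @ b # ys) \<Longrightarrow> v \<in> set (a # xs @ b # ys) \<Longrightarrow>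
      {u, v} \<subseteq> set (a # xs @ [b]) \<or> {u, v} \<subseteq> set (a # b # ys)"
  shows "noncrossing E (a # xs @ b # ys)"
  unfolding noncrossing_def
proof (intro allI impI notI, elim conjE)
  let ?L = "a # xs @ b # ys" and ?m = "Suc (length xs)"
  fix i j k l assume o: "i < j" "j < k" "k < l" "l < length ?L" and e: "{?L ! i, ?L ! k} \<in> E" "{?L ! j, ?L ! l} \<in> E"
  have L1: "?L ! t = (a # xs @ [b]) ! t" if "t \<le> ?m" for t using that by (auto simp: nth_append nth_Cons')
  have L2: "?L ! t = (a # b # ys) ! (if t = 0 then 0 else t - length xs)" if "t = 0 \<or> ?m \<le> t" for t
    using that by (auto simp: nth_append nth_Cons')
  have inx: "t \<le> ?m" if t: "t < length ?L" "?L ! t \<in> set (a # xs @ [b])" for t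
  proof (rule ccontr)
    assume "\<not> t \<le> ?m"
    then have "?L ! t = ys ! (t - Suc ?m)" "t - Suc ?m < length ys" using t(1) by (auto simp: nth_append nth_Cons')
    then have "?L ! t \<in> set ys" by simp
    then show False using dist t(2) by auto
  qed
  have iny: "t = 0 \<or> ?m \<le> t" if t: "t < length ?L" "?L ! t \<in> set (a # b # ys)" for t
  proof (rule ccontr)
    assume "\<not> (t = 0 \<or> ?m \<le> t)"
    then have "?L ! t = xs ! (t - 1)" "t - 1 < length xs" by (auto simp: nth_append nth_Cons')
    then have "?L ! t \<in> set xs" by simp
    then show False using dist t(2) by auto
  qed
  have cl: "(s \<le> ?m \<and> t \<le> ?m) \<or> ((s = 0 \<or> ?m \<le> s) \<and> ?m \<le> t)"
    if st: "s < t" "t < length ?L" "{?L ! s, ?L ! t} \<in> E" for s t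
  proof -
    have mem: "?L ! s \<in> set ?L" "?L ! t \<in> set ?L" using st by (intro nth_mem; simp)+
    from edges[OF st(3) mem] show ?thesis
    proof
      assume "{?L ! s, ?L ! t} \<subseteq> set (a # xs @ [b])"
      then show ?thesis using inx[of s] inx[of t] st by simp
    next
      assume "{?L ! s, ?L ! t} \<subseteq> set (a # b # ys)"
      then have "s = 0 \<or> ?m \<le> s" "t = 0 \<or> ?m \<le> t" using iny[of s] iny[of t] st by simp_all
      then show ?thesis using st(1) by auto
    qed
  qed
  consider "l \<le> ?m" | "i = 0 \<or> ?m \<le> i" "?m \<le> j" using cl[of i k] cl[of j l] o e by linarith
  then show False
  proof cases
    case 1
    have eqs: "?L ! i = (a # xs @ [b]) ! i" "?L ! j = (a # xs @ [b]) ! j" "?L ! k = (a # xs @ [b]) ! k"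
        "?L ! l = (a # xs @ [b]) ! l"
      using 1 o by (intro L1; linarith)+
    have "l < length (a # xs @ [b])" using 1 by simp
    from noncrossingD[OF xs o(1,2,3) this] show ?thesis using e unfolding eqs by blast
  next
    case 2
    let ?f = "\<lambda>t. if t = 0 then 0 else t - length xs"
    have "?f i < ?f j" "?f j < ?f k" "?f k < ?f l" "?f l < length (a # b # ys)" using 2 o by auto
    note nc' = noncrossingD[OF ys this]
    have eqs: "?L ! i = (a # b # ys) ! ?f i" "?L ! j = (a # b # ys) ! ?f j" "?L ! k = (a # b # ys) ! ?f k"
        "?L ! l = (a # b # ys) ! ?f l"
      using 2 o by (intro L2; linarith)+
    show ?thesis using nc' e unfolding eqs by blast
  qed
qed

text \<open>Crossing depends only on the cyclic order.\<close>

lemma noncrossing_rotate: "noncrossing E (x # xs) \<longleftrightarrow> noncrossing E (xs @ [x])"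
proof
  assume nc: "noncrossing E (x # xs)"
  show "noncrossing E (xs @ [x])"
    unfolding noncrossing_def
  proof (intro allI impI notI, elim conjE)
    let ?L = "xs @ [x]"
    fix i j k l assume o: "i < j" "j < k" "k < l" "l < length ?L" and e: "{?L ! i, ?L ! k} \<in> E" "{?L ! j, ?L ! l} \<in> E"
    show False
    proof (cases "l = length xs")
      case True
      then show ?thesis using noncrossingD[OF nc, of 0 "Suc i" "Suc j" "Suc k"] o e by (auto simp: nth_append insert_commute)
    next
      case False
      then show ?thesis using noncrossingD[OF nc, of "Suc i" "Suc j" "Suc k" "Suc l"] o e by (auto simp: nth_append)
    qed
  qed
next
  assume nc: "noncrossing E (xs @ [x])"
  show "noncrossing E (x # xs)"
    unfolding noncrossing_def
  proof (intro allI impI notI, elim conjE)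
    let ?L = "x # xs"
    fix i j k l assume o: "i < j" "j < k" "k < l" "l < length ?L" and e: "{?L ! i, ?L ! k} \<in> E" "{?L ! j, ?L ! l} \<in> E"
    obtain j' k' l' where s: "j = Suc j'" "k = Suc k'" "l = Suc l'" using o by (metis less_imp_Suc_add)
    show False
    proof (cases i)
      case 0
      then show ?thesis using noncrossingD[OF nc, of j' k' l' "length xs"] o e s by (auto simp: nth_append insert_commute)
    next
      case (Suc i')
      then show ?thesis using noncrossingD[OF nc, of i' j' k' l'] o e s by (auto simp: nth_append)
    qed
  qed
qed

lemma noncrossing_rev:
  assumes "noncrossing E xs" shows "noncrossing E (rev xs)"
  unfolding noncrossing_def
proof (intro allI impI notI, elim conjE)
  let ?n = "length xs - 1"
  fix i j k l assume o: "i < j" "j < k" "k < l" "l < length (rev xs)"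
    and e: "{rev xs ! i, rev xs ! k} \<in> E" "{rev xs ! j, rev xs ! l} \<in> E"
  have r: "rev xs ! t = xs ! (?n - t)" if "t < length xs" for t using that by (simp add: rev_nth)
  have "?n - l < ?n - k" "?n - k < ?n - j" "?n - j < ?n - i" "?n - i < length xs" using o by auto
  from noncrossingD[OF assms this] show False
    using e r[of i] r[of j] r[of k] r[of l] o by (simp add: insert_commute)
qed

subsection \<open>Walks and components\<close>

abbreviation walk :: "'v set set \<Rightarrow> 'v list \<Rightarrow> bool" where
  "walk E \<equiv> successively (\<lambda>u v. {u, v} \<in> E)"

lemma walk_rev [simp]: "walk E (rev xs) = walk E xs"
  by (simp add: successively_rev insert_commute)

lemma walk_append_shared: "walk E (xs @ [y]) \<Longrightarrow> walk E (y # ys) \<Longrightarrow> walk E (xs @ y # ys)"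
  by (cases xs rule: rev_cases) (auto simp: successively_append_iff)

lemma walk_appendD: "walk E (xs @ ys) \<Longrightarrow> walk E xs" "walk E (xs @ ys) \<Longrightarrow> walk E ys"
  by (auto simp: successively_append_iff)

definition edge_rel :: "'v set set \<Rightarrow> 'v set \<Rightarrow> ('v \<times> 'v) set" where
  "edge_rel E A = {(u, v). {u, v} \<in> E \<and> u \<in> A \<and> v \<in> A}"

definition component :: "'v set set \<Rightarrow> 'v set \<Rightarrow> 'v \<Rightarrow> 'v set" where
  "component E A b = {v. (b, v) \<in> (edge_rel E A)\<^sup>*}"

lemma component_self [simp]: "b \<in> component E A b"
  by (simp add: component_def)

lemma component_subset: "b \<in> A \<Longrightarrow> component E A b \<subseteq> A"
proof
  fix v assume b: "b \<in> A" and "v \<in> component E A b"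
  then have "(b, v) \<in> (edge_rel E A)\<^sup>*" by (simp add: component_def)
  then show "v \<in> A" using b by (induction rule: rtrancl_induct) (auto simp: edge_rel_def)
qed

lemma component_mono:
  assumes "A \<subseteq> A'" shows "component E A b \<subseteq> component E A' b"
proof -
  have "edge_rel E A \<subseteq> edge_rel E A'" using assms by (auto simp: edge_rel_def)
  from rtrancl_mono[OF this] show ?thesis unfolding component_def by blast
qed

lemma component_step: "v \<in> component E A b \<Longrightarrow> {v, w} \<in> E \<Longrightarrow> v \<in> A \<Longrightarrow> w \<in> A \<Longrightarrow> w \<in> component E A b"
  unfolding component_def by (auto simp: edge_rel_def intro: rtrancl.rtrancl_into_rtrancl)

lemma component_walk:
  assumes "walk E xs" "set xs \<subseteq> A" "hd xs \<in> component E A b" shows "set xs \<subseteq> component E A b"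
  using assms
proof (induction xs)
  case (Cons x xs)
  show ?case
  proof (cases xs)
    case Nil then show ?thesis using Cons.prems by simp
  next
    case (Cons y zs)
    then have "y \<in> component E A b" using component_step[of x E A b y] Cons.prems by auto
    then have "set xs \<subseteq> component E A b" using Cons.IH Cons.prems Cons by auto
    then show ?thesis using Cons.prems by auto
  qed
qed simp

text \<open>The path grows at its start. A vertex met again becomes the new start, and everything
  before it is dropped.\<close>

lemma component_path:
  assumes "v \<in> component E A b" "b \<in> A"
  shows "\<exists>xs. walk E (xs @ [b]) \<and> distinct (xs @ [b]) \<and> set (xs @ [b]) \<subseteq> A \<and> hd (xs @ [b]) = v"
proof -
  have "(b, v) \<in> (edge_rel E A)\<^sup>*" using assms by (simp add: component_def)
  then show ?thesis
  proof (induction rule: rtrancl_induct)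
    case base
    then show ?case using assms(2) by (intro exI[of _ "[]"]) auto
  next
    case (step v w)
    then obtain xs where xs: "walk E (xs @ [b])" "distinct (xs @ [b])" "set (xs @ [b]) \<subseteq> A" "hd (xs @ [b]) = v" by blast
    have vw: "{v, w} \<in> E" "w \<in> A" using step.hyps by (auto simp: edge_rel_def)
    show ?case
    proof (cases "w \<in> set (xs @ [b])")
      case False
      have "walk E ((w # xs) @ [b])"
        using xs(1,4) vw by (cases xs) (auto simp: insert_commute)
      then show ?thesis using xs False vw by (intro exI[of _ "w # xs"]) auto
    next
      case True
      show ?thesis
      proof (cases "w = b")
        case True
        then show ?thesis using assms(2) by (intro exI[of _ "[]"]) auto
      next
        case False
        then have "w \<in> set xs" using True by auto
        then obtain x1 x2 where x: "xs = x1 @ w # x2" by (meson split_list)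
        then have "walk E ((w # x2) @ [b])" using xs(1) walk_appendD(2)[of E x1 "w # x2 @ [b]"] by simp
        then show ?thesis using xs x by (intro exI[of _ "w # x2"]) auto
      qed
    qed
  qed
qed

subsection \<open>Graphs without thetas and crossed cycles\<close>

text \<open>Excludes subdivisions of the complete bipartite graph \<open>K_{2,3}\<close>.\<close>

definition theta_free :: "'v set set \<Rightarrow> bool" where
  "theta_free E \<longleftrightarrow> (\<forall>a z l1 l2 l3. l1 \<noteq> [] \<longrightarrow> l2 \<noteq> [] \<longrightarrow> l3 \<noteq> [] \<longrightarrow> distinct (a # z # l1 @ l2 @ l3) \<longrightarrow>
     walk E (a # l1 @ [z]) \<longrightarrow> walk E (a # l2 @ [z]) \<longrightarrow> \<not> walk E (a # l3 @ [z]))"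

text \<open>Excludes subdivisions of the complete graph on four vertices in which two opposite
  edges, here \<open>ab\<close> and \<open>uv\<close>, are not subdivided.\<close>

definition crossed_cycle_free :: "'v set set \<Rightarrow> bool" where
  "crossed_cycle_free E \<longleftrightarrow> (\<forall>a b l1 l2 u v. {a, b} \<in> E \<longrightarrow> distinct (a # b # l1 @ l2) \<longrightarrow>
     walk E (a # l1 @ [b]) \<longrightarrow> walk E (a # l2 @ [b]) \<longrightarrow> u \<in> set l1 \<longrightarrow> v \<in> set l2 \<longrightarrow> {u, v} \<notin> E)"

lemma theta_freeD:
  assumes "theta_free E" "l1 \<noteq> []" "l2 \<noteq> []" "l3 \<noteq> []" "distinct (a # z # l1 @ l2 @ l3)"
    "walk E (a # l1 @ [z])" "walk E (a # l2 @ [z])" "walk E (a # l3 @ [z])"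
  shows False
  using assms unfolding theta_free_def by blast

lemma crossed_cycle_freeD:
  assumes "crossed_cycle_free E" "{a, b} \<in> E" "distinct (a # b # l1 @ l2)"
    "walk E (a # l1 @ [b])" "walk E (a # l2 @ [b])" "u \<in> set l1" "v \<in> set l2" "{u, v} \<in> E"
  shows False
  using assms unfolding crossed_cycle_free_def by blast

definition two_ways :: "'v set set \<Rightarrow> 'v \<Rightarrow> 'v \<Rightarrow> 'v set \<Rightarrow> bool" where
  "two_ways E a b X \<longleftrightarrow> (\<exists>l1 l2. l1 \<noteq> [] \<and> l2 \<noteq> [] \<and> distinct (l1 @ l2) \<and> set (l1 @ l2) \<subseteq> X \<and>
     walk E (a # l1 @ [b]) \<and> walk E (a # l2 @ [b]))"

text \<open>There is a path from \<open>a\<close> to \<open>b\<close> outside of \<open>X\<close> which forces \<open>X\<close> to lie on one side of it.\<close>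

definition outer :: "'v set set \<Rightarrow> 'v \<Rightarrow> 'v \<Rightarrow> 'v set \<Rightarrow> bool" where
  "outer E a b X \<longleftrightarrow> (\<exists>l. distinct l \<and> set l \<inter> ({a, b} \<union> X) = {} \<and> walk E (a # l @ [b]) \<and> (l = [] \<longrightarrow> \<not> two_ways E a b X))"

text \<open>Among the neighbours of \<open>a\<close> in the component of \<open>b\<close>, take the one whose deletion leaves the smallest component.\<close>

lemma separating_neighbour:
  assumes tf: "theta_free E" and fin: "finite X" and a: "a \<notin> X" "b \<notin> X" "a \<noteq> b" and out: "outer E a b X"
    and N: "y0 \<in> component E (insert b X) b" "y0 \<in> X" "{a, y0} \<in> E"
  shows "\<exists>y. y \<in> component E (insert b X) b \<and> y \<in> X \<and> {a, y} \<in> E \<and>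
    (\<forall>y'\<in>X. {a, y'} \<in> E \<longrightarrow> y' \<noteq> y \<longrightarrow> y' \<notin> component E (insert b X - {y}) b)"
proof -
  define B where "B y = component E (insert b X - {y}) b" for y
  define Q where "Q y \<longleftrightarrow> y \<in> component E (insert b X) b \<and> y \<in> X \<and> {a, y} \<in> E" for y
  obtain y where y: "Q y" and min: "\<And>y'. Q y' \<Longrightarrow> card (B y) \<le> card (B y')"
    using ex_has_least_nat[of Q y0 "\<lambda>y. card (B y)"] N by (auto simp: Q_def)
  have Bsub: "B y \<subseteq> insert b X - {y}" if "y \<in> X" for y
    unfolding B_def using that a by (intro component_subset) auto
  have False if y': "y' \<in> X" "{a, y'} \<in> E" "y' \<noteq> y" "y' \<in> B y" for y'
  proof -
    have yX: "y \<in> X" "{a, y} \<in> E" using y by (auto simp: Q_def)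
    have mono: "B w \<subseteq> component E (insert b X) b" for w
      unfolding B_def by (rule component_mono) blast
    have Qy': "Q y'" using y' mono[of y] by (auto simp: Q_def)
    show False
    proof (cases "y \<in> B y'")
      case False
      \<comment> \<open>A walk from \<open>b\<close> that avoids \<open>y'\<close> does not reach
        \<open>y\<close> either, so it stays in \<open>B y\<close>. Since \<open>y'\<close> is in
        \<open>B y\<close> but not in \<open>B y'\<close>, minimality is violated.\<close>
      have "v \<in> B y" if "v \<in> B y'" for v
      proof -
        have "(b, v) \<in> (edge_rel E (insert b X - {y'}))\<^sup>*" using that by (simp add: B_def component_def)
        then have "v \<in> B y \<and> v \<in> B y'"
        proof (induction rule: rtrancl_induct)
          case base then show ?case by (simp add: B_def)
        next
          case (step v w)
          have e: "{v, w} \<in> E" "w \<in> insert b X - {y'}" "v \<in> insert b X - {y'}" using step.hyps by (auto simp: edge_rel_def)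
          then have w: "w \<in> B y'" using component_step[of v E _ b w] step.IH by (auto simp: B_def)
          then have "w \<noteq> y" using False by auto
          then have "w \<in> insert b X - {y}" "v \<in> insert b X - {y}" using e step.IH Bsub[OF yX(1)] by auto
          then show ?case using component_step[of v E _ b w] step.IH e w by (auto simp: B_def)
        qed
        then show ?thesis ..
      qed
      moreover have "y' \<notin> B y'" using Bsub[OF y'(1)] by auto
      ultimately have "B y' \<subset> B y" using y'(4) by auto
      moreover have "finite (B y)" using Bsub[OF yX(1)] fin by (meson finite_Diff finite_insert finite_subset)
      ultimately have "card (B y') < card (B y)" by (rule psubset_card_mono[rotated])
      then show False using min[OF Qy'] by simp
    next
      case True
      \<comment> \<open>Two paths to \<open>b\<close>, each avoiding the start of the other. Cut at
        the first vertex \<open>z\<close> of \<open>ps\<close> on \<open>qs\<close> and extended by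
        \<open>a\<close>, they become disjoint paths from \<open>a\<close> to
        \<open>z\<close>.\<close>
      obtain ps where ps: "walk E (ps @ [b])" "distinct (ps @ [b])" "set (ps @ [b]) \<subseteq> insert b X - {y'}" "hd (ps @ [b]) = y"
        using component_path[of y E "insert b X - {y'}" b] True y'(1) a by (auto simp: B_def)
      obtain qs where qs: "walk E (qs @ [b])" "distinct (qs @ [b])" "set (qs @ [b]) \<subseteq> insert b X - {y}" "hd (qs @ [b]) = y'"
        using component_path[of y' E "insert b X - {y}" b] y'(4) yX(1) a by (auto simp: B_def)
      have "\<exists>z\<in>set (ps @ [b]). z \<in> set (qs @ [b])" by simp
      from split_list_first_prop[where P = "\<lambda>z. z \<in> set (qs @ [b])", OF this]
      obtain p1 z p2 where p: "ps @ [b] = p1 @ z # p2" "z \<in> set (qs @ [b])" "\<forall>x\<in>set p1. x \<notin> set (qs @ [b])" by blast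
      obtain q1 q2 where q: "qs @ [b] = q1 @ z # q2" using split_list[OF p(2)] by blast
      have "y \<notin> set (qs @ [b])" using qs(3) by blast
      then have "z \<noteq> y" using p(2) by blast
      then obtain p1' where p1: "p1 = y # p1'" using ps(4) p(1) by (cases p1) auto
      have "y' \<notin> set (ps @ [b])" using ps(3) by blast
      then have "z \<noteq> y'" using p(1) by auto
      then obtain q1' where q1: "q1 = y' # q1'" using qs(4) q by (cases q1) auto
      have wp: "walk E (p1 @ [z])" using walk_appendD(1)[of E "p1 @ [z]" p2] ps(1) p(1) by simp
      have wq: "walk E (q1 @ [z])" using walk_appendD(1)[of E "q1 @ [z]" q2] qs(1) q by simp
      have wq2: "walk E (z # q2)" using walk_appendD(2)[of E q1 "z # q2"] qs(1) q by simp
      have w1: "walk E (a # p1 @ [z])" using wp yX(2) p1 by simp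
      have w2: "walk E (a # q1 @ [z])" using wq y'(2) q1 by simp
      have dq: "distinct (q1 @ z # q2)" using qs(2) q by simp
      have dp: "distinct (p1 @ z # p2)" using ps(2) p(1) by simp
      have sq: "set (q1 @ z # q2) \<subseteq> insert b X" using qs(3) q by auto
      have sp: "set (p1 @ z # p2) \<subseteq> insert b X" using ps(3) p(1) by auto
      have disj: "set p1 \<inter> set (q1 @ z # q2) = {}" using p(3) q by auto
      have bq: "b \<in> set (q1 @ z # q2)" using q by (metis in_set_conv_decomp)
      have ab: "a \<notin> insert b X" using a by auto
      obtain l where l: "distinct l" "set l \<inter> ({a, b} \<union> X) = {}" "walk E (a # l @ [b])" "l = [] \<longrightarrow> \<not> two_ways E a b X"
        using out unfolding outer_def by blast
      \<comment> \<open>The outer path yields the third path of a theta: from \<open>a\<close> to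
        \<open>b\<close> and, if \<open>z \<noteq> b\<close>, back along the rest of
        \<open>qs\<close> to \<open>z\<close>. If it is the mere edge \<open>ab\<close> and
        \<open>z = b\<close>, the first two paths contradict the last clause of
        \<open>outer\<close>.\<close>
      show False
      proof (cases "z = b")
        case True
        have pX: "set p1 \<subseteq> X" using disj bq sp by auto
        have qX: "set q1 \<subseteq> X" using dq sq True by auto
        show ?thesis
        proof (cases "l = []")
          case True
          have "two_ways E a b X" unfolding two_ways_def
            using p1 q1 disj dp dq pX qX w1 w2 \<open>z = b\<close> by (intro exI[of _ p1] exI[of _ q1]) auto
          then show ?thesis using l True by simp
        next
          case False
          show ?thesis
            by (rule theta_freeD[OF tf, of p1 q1 l a b])
              (use p1 q1 disj dp dq pX qX w1 w2 \<open>z = b\<close> False l a in auto)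
        qed
      next
        case False
        then have q2: "q2 \<noteq> []" "last q2 = b" using q by (auto, metis last_ConsR last_appendR last_snoc list.distinct(1))
        then obtain q2' where q2': "q2 = q2' @ [b]" by (metis append_butlast_last_id)
        have "walk E (rev (z # q2))" using wq2 unfolding walk_rev .
        then have "walk E ((a # l) @ b # (rev q2' @ [z]))"
          using l(3) q2' by - (rule walk_append_shared, auto)
        then have w3: "walk E (a # (l @ rev q2) @ [z])" using q2' by simp
        show ?thesis
          by (rule theta_freeD[OF tf, of p1 q1 "l @ rev q2" a z])
            (use p1 q1 q2 disj dp dq sp sq ab w1 w2 w3 l in auto)
      qed
    qed
  qed
  then show ?thesis using y unfolding Q_def B_def by blast
qed

text \<open>Placing \<open>a\<close> first and \<open>b\<close> last leaves room for an edge
  \<open>ab\<close> on the outside, and the path from \<open>outer\<close> stands in for this edge.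
  When \<open>X\<close> is split, the outer path of a piece is assembled from the old one and paths
  through the other piece, so both statements are proved by one induction.\<close>

lemma noncrossing_order_exists:
  assumes tf: "theta_free E" and cf: "crossed_cycle_free E"
  shows "finite X \<Longrightarrow>
     (\<forall>a. a \<notin> X \<longrightarrow> (\<exists>ys. set ys = X \<and> distinct ys \<and> noncrossing E (a # ys))) \<and>
     (\<forall>a b. a \<notin> X \<longrightarrow> b \<notin> X \<longrightarrow> a \<noteq> b \<longrightarrow> outer E a b X \<longrightarrow>
       (\<exists>ys. set ys = X \<and> distinct ys \<and> noncrossing E (a # ys @ [b])))"
proof (induction "card X" arbitrary: X rule: less_induct)
  case less
  have fin: "finite X" by (rule less.prems)
  have IH1: "\<exists>ys. set ys = Y \<and> distinct ys \<and> noncrossing E (a # ys)" if "Y \<subset> X" "a \<notin> Y" for Y a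
    using less.hyps[of Y] psubset_card_mono[OF fin that(1)] that fin by (meson finite_subset psubset_imp_subset)
  have IH2: "\<exists>ys. set ys = Y \<and> distinct ys \<and> noncrossing E (a # ys @ [b])"
    if "Y \<subset> X" "a \<notin> Y" "b \<notin> Y" "a \<noteq> b" "outer E a b Y" for Y a b
    using less.hyps[of Y] psubset_card_mono[OF fin that(1)] that fin by (meson finite_subset psubset_imp_subset)
  have one: "\<exists>ys. set ys = X \<and> distinct ys \<and> noncrossing E (a # ys)" if a: "a \<notin> X" for a
  proof -
    consider "X = {}" | "X \<noteq> {}" "\<forall>x\<in>X. {a, x} \<notin> E" | b where "b \<in> X" "{a, b} \<in> E" by blast
    then show ?thesis
    proof cases
      case 1
      then show ?thesis by (auto simp: noncrossing_def)
    next
      case 2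
      then obtain x where x: "x \<in> X" by blast
      then obtain ys where ys: "set ys = X - {x}" "distinct ys" "noncrossing E (x # ys)" using IH1[of "X - {x}" x] by auto
      have "noncrossing E ([a] @ x # ys)"
      proof (rule noncrossing_append[OF _ ys(3)])
        show "noncrossing E [a]" by (simp add: noncrossing_def)
        show "distinct ([a] @ x # ys)" using ys a x by auto
        show "{u, v} \<subseteq> set [a] \<or> {u, v} \<subseteq> set (x # ys) \<or> {u, v} = {hd ([a] @ x # ys), last ([a] @ x # ys)}"
          if uv: "{u, v} \<in> E" "u \<in> set ([a] @ x # ys)" "v \<in> set ([a] @ x # ys)" for u v
        proof -
          have "set (x # ys) = X" using ys x by auto
          moreover have "{v, u} \<in> E" using uv by (simp add: insert_commute)
          ultimately show ?thesis using 2(2) uv by auto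
        qed
      qed
      then show ?thesis using ys x by (intro exI[of _ "x # ys"]) auto
    next
      case 3
      let ?X = "X - {b}"
      have ab: "a \<noteq> b" using a 3 by auto
      \<comment> \<open>Without two ways the edge \<open>ab\<close> is itself an outer path, and
        \<open>b\<close> can be last. Otherwise the two ways lie in different components, and each
        is the outer path for the other side of the chord \<open>ab\<close>.\<close>
      show ?thesis
      proof (cases "two_ways E a b ?X")
        case False
        have "outer E a b ?X" unfolding outer_def using False 3 by (intro exI[of _ "[]"]) auto
        then obtain ys where ys: "set ys = ?X" "distinct ys" "noncrossing E (a # ys @ [b])"
          using IH2[of ?X a b] 3 a ab by auto
        then show ?thesis using 3 by (intro exI[of _ "ys @ [b]"]) auto
      next
        case True
        then obtain l1 l2 where l: "l1 \<noteq> []" "l2 \<noteq> []" "distinct (l1 @ l2)" "set (l1 @ l2) \<subseteq> ?X"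
          "walk E (a # l1 @ [b])" "walk E (a # l2 @ [b])" unfolding two_ways_def by blast
        define c where "c = hd l1"
        have c: "c \<in> set l1" using l(1) by (simp add: c_def)
        moreover have "set l1 \<subseteq> ?X" using l(4) by simp
        ultimately have cX: "c \<in> ?X" by blast
        define S1 where "S1 = component E ?X c"
        define S2 where "S2 = ?X - S1"
        have S1X: "S1 \<subseteq> ?X" unfolding S1_def using cX by (intro component_subset)
        have l1S: "set l1 \<subseteq> S1" unfolding S1_def
        proof (rule component_walk)
          show "walk E l1" using walk_appendD(1)[of E l1 "[b]"] l(1,5) by (cases l1) auto
          show "set l1 \<subseteq> ?X" using l by auto
          show "hd l1 \<in> component E ?X c" by (simp add: c_def)
        qed
        \<comment> \<open>A path joining \<open>l1\<close> to \<open>l2\<close> is shortened until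
          it meets each of them in one end only. A single edge then gives a crossed cycle. A longer
          path forms a theta with the two paths between its ends that run through \<open>a\<close>
          and through \<open>b\<close>.\<close>
        have l2S: "set l2 \<inter> S1 = {}"
        proof (rule ccontr)
          assume "set l2 \<inter> S1 \<noteq> {}"
          then obtain x where x: "x \<in> set l2" "x \<in> component E ?X c" by (auto simp: S1_def)
          obtain ps0 where ps0: "walk E (ps0 @ [c])" "distinct (ps0 @ [c])" "set (ps0 @ [c]) \<subseteq> ?X" "hd (ps0 @ [c]) = x"
            using component_path[OF x(2) cX] by blast
          define ps where "ps = rev (ps0 @ [c])"
          have ps: "walk E ps" "distinct ps" "set ps \<subseteq> ?X" "hd ps = c" "x \<in> set ps" "ps \<noteq> []"
          proof -
            show "walk E ps" unfolding ps_def walk_rev by (rule ps0(1))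
            show "distinct ps" "set ps \<subseteq> ?X" "hd ps = c" "ps \<noteq> []" using ps0 by (auto simp: ps_def)
            show "x \<in> set ps" using ps0(4) by (cases ps0) (auto simp: ps_def)
          qed
          have "\<exists>v\<in>set ps. v \<in> set l2" using ps x by blast
          from split_list_first_prop[where P = "\<lambda>v. v \<in> set l2", OF this]
          obtain p1 v p2 where p: "ps = p1 @ v # p2" "v \<in> set l2" "\<forall>x\<in>set p1. x \<notin> set l2" by blast
          have "c \<notin> set l2" using c l(3) by auto
          then have "p1 \<noteq> []" using p ps(4) by (cases p1) auto
          then have "c \<in> set p1" using p ps(4) by (cases p1) auto
          then have "\<exists>u\<in>set p1. u \<in> set l1" using c by blast
          from split_list_last_prop[where P = "\<lambda>u. u \<in> set l1", OF this]
          obtain r1 u r where r: "p1 = r1 @ u # r" "u \<in> set l1" "\<forall>x\<in>set r. x \<notin> set l1" by blast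
          have "walk E (r1 @ (u # r @ [v]) @ p2)" using ps(1) p(1) r(1) by simp
          then have wr: "walk E (u # r @ [v])" using walk_appendD by blast
          have rX: "set r \<subseteq> ?X" "distinct (u # r @ [v])" using ps(2,3) p(1) r(1) by auto
          have rd: "set r \<inter> set l1 = {}" "set r \<inter> set l2 = {}" using r p by auto
          have dist: "distinct (a # b # l1 @ l2)" using l(3,4) a 3 by auto
          show False
          proof (cases "r = []")
            case True
            then show ?thesis using crossed_cycle_freeD[OF cf 3(2) dist l(5,6) r(2) p(2)] wr by simp
          next
            case False
            obtain l1a l1b where l1: "l1 = l1a @ u # l1b" using split_list[OF r(2)] by blast
            obtain l2a l2b where l2: "l2 = l2a @ v # l2b" using split_list[OF p(2)] by blast
            have "walk E ((a # l1a @ [u]) @ l1b @ [b])" using l(5) l1 by simp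
            then have 1: "walk E (a # l1a @ [u])" by (rule walk_appendD)
            have "walk E ((a # l1a) @ (u # l1b @ [b]))" using l(5) l1 by simp
            then have 2: "walk E (u # l1b @ [b])" by (rule walk_appendD)
            have "walk E ((a # l2a @ [v]) @ l2b @ [b])" using l(6) l2 by simp
            then have 3: "walk E (a # l2a @ [v])" by (rule walk_appendD)
            have "walk E ((a # l2a) @ (v # l2b @ [b]))" using l(6) l2 by simp
            then have 4: "walk E (v # l2b @ [b])" by (rule walk_appendD)
            have "walk E (rev (a # l1a @ [u]))" using 1 unfolding walk_rev .
            then have "walk E ((u # rev l1a) @ a # (l2a @ [v]))" using 3 by - (rule walk_append_shared, auto)
            then have w2: "walk E (u # (rev l1a @ a # l2a) @ [v])" by simp
            have "walk E (rev (v # l2b @ [b]))" using 4 unfolding walk_rev .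
            then have "walk E ((u # l1b) @ b # (rev l2b @ [v]))" using 2 by - (rule walk_append_shared, auto)
            then have w3: "walk E (u # (l1b @ b # rev l2b) @ [v])" by simp
            show ?thesis
              by (rule theta_freeD[OF tf False _ _ _ wr w2 w3]) (use l1 l2 dist rX rd a in auto)
          qed
        qed
        have out1: "outer E a b S1" unfolding outer_def
          using l l2S a 3 by (intro exI[of _ l2]) auto
        have out2: "outer E a b S2" unfolding outer_def
          using l l1S a 3 by (intro exI[of _ l1]) (auto simp: S2_def)
        obtain ys1 where ys1: "set ys1 = S1" "distinct ys1" "noncrossing E (a # ys1 @ [b])"
          using IH2[OF _ _ _ ab out1] S1X 3 a by blast
        have "S2 \<subset> X" using 3 by (auto simp: S2_def)
        then obtain ys2 where ys2: "set ys2 = S2" "distinct ys2" "noncrossing E (a # ys2 @ [b])"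
          using IH2[OF _ _ _ ab out2] 3 a by (auto simp: S2_def)
        have "noncrossing E (rev (a # ys2 @ [b]))" by (rule noncrossing_rev[OF ys2(3)])
        then have nc2: "noncrossing E (a # b # rev ys2)" unfolding noncrossing_rotate[of E a] by simp
        have "noncrossing E (a # ys1 @ b # rev ys2)"
        proof (rule noncrossing_chord[OF ys1(3) nc2])
          show "distinct (a # ys1 @ b # rev ys2)" using ys1 ys2 S1X a 3 by (auto simp: S2_def)
          show "{u, v} \<subseteq> set (a # ys1 @ [b]) \<or> {u, v} \<subseteq> set (a # b # rev ys2)"
            if uv: "{u, v} \<in> E" "u \<in> set (a # ys1 @ b # rev ys2)" "v \<in> set (a # ys1 @ b # rev ys2)" for u v
          proof -
            have no: False if "{s, t} \<in> E" "s \<in> S1" "t \<in> S2" for s t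
              using component_step[of s E ?X c t] that S1X by (auto simp: S1_def S2_def)
            have vu: "{v, u} \<in> E" using uv(1) by (simp add: insert_commute)
            show ?thesis using no[OF uv(1)] no[OF vu] uv(2,3) ys1(1) ys2(1) by auto
          qed
        qed
        then show ?thesis using ys1 ys2 S1X 3 by (intro exI[of _ "ys1 @ b # rev ys2"]) (auto simp: S2_def)
      qed
    qed
  qed
  moreover have "\<exists>ys. set ys = X \<and> distinct ys \<and> noncrossing E (a # ys @ [b])"
    if a: "a \<notin> X" and b: "b \<notin> X" and ab: "a \<noteq> b" and out: "outer E a b X" for a b
  proof -
    let ?K = "component E (insert b X) b"
    have KX: "?K \<subseteq> insert b X" by (rule component_subset) simp
    show ?thesis
    proof (cases "\<exists>y\<in>X. y \<in> ?K \<and> {a, y} \<in> E")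
      case nbr: False
      define Xb where "Xb = ?K - {b}"
      define Xa where "Xa = X - ?K"
      have sub: "Xa \<subseteq> X" "Xb \<subseteq> X" using KX by (auto simp: Xa_def Xb_def)
      \<comment> \<open>One of the two parts may be all of \<open>X\<close>, where the induction
        hypothesis does not apply but \<open>one\<close> does.\<close>
      have ex: "\<exists>ys. set ys = Y \<and> distinct ys \<and> noncrossing E (x # ys)" if "Y \<subseteq> X" "x \<notin> Y" "x \<notin> X" for Y x
        using IH1[of Y x] one[of x] that by (cases "Y = X") auto
      obtain ysa where ysa: "set ysa = Xa" "distinct ysa" "noncrossing E (a # ysa)" using ex[of Xa a] sub a by auto
      obtain ysb where ysb: "set ysb = Xb" "distinct ysb" "noncrossing E (b # ysb)" using ex[of Xb b] sub b by (auto simp: Xb_def)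
      have ncb: "noncrossing E (ysb @ [b])" by (rule noncrossing_rotate[THEN iffD1, OF ysb(3)])
      have "noncrossing E ((a # ysa) @ (ysb @ [b]))"
      proof (rule noncrossing_append[OF ysa(3) ncb])
        have "a \<notin> Xa" "a \<notin> Xb" "b \<notin> Xa" "b \<notin> Xb" "Xa \<inter> Xb = {}"
          using sub a b unfolding Xa_def Xb_def by blast+
        then show "distinct ((a # ysa) @ ysb @ [b])" using ysa(1,2) ysb(1,2) ab by simp
        show "{u, v} \<subseteq> set (a # ysa) \<or> {u, v} \<subseteq> set (ysb @ [b]) \<or> {u, v} = {hd ((a # ysa) @ ysb @ [b]), last ((a # ysa) @ ysb @ [b])}"
          if uv: "{u, v} \<in> E" "u \<in> set ((a # ysa) @ ysb @ [b])" "v \<in> set ((a # ysa) @ ysb @ [b])" for u v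
        proof -
          have Kb: "set (ysb @ [b]) = ?K" using ysb(1) by (simp add: Xb_def insert_absorb)
          have no: "s = a \<and> t = b" if st: "{s, t} \<in> E" "s \<in> insert a Xa" "t \<in> ?K" for s t
          proof (cases "s = a")
            case True
            have "t \<in> insert b X" using KX st(3) by blast
            then show ?thesis using nbr True st by blast
          next
            case neq: False
            then have s: "s \<in> X" "s \<notin> ?K" using st(2) by (simp_all add: Xa_def)
            have "t \<in> insert b X" using KX st(3) by blast
            moreover have "{t, s} \<in> E" using st(1) by (simp add: insert_commute)
            ultimately have "s \<in> ?K" using component_step[OF st(3)] s(1) by blast
            then show ?thesis using s(2) by blast
          qed
          have vu: "{v, u} \<in> E" using uv(1) by (simp add: insert_commute)
          have mem: "u \<in> insert a Xa \<or> u \<in> ?K" "v \<in> insert a Xa \<or> v \<in> ?K"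
            using uv(2,3) ysa(1) unfolding Kb[symmetric] by auto
          consider "u \<in> insert a Xa" "v \<in> insert a Xa" | "u \<in> ?K" "v \<in> ?K" | "u \<in> insert a Xa" "v \<in> ?K"
            | "v \<in> insert a Xa" "u \<in> ?K" using mem by blast
          then show ?thesis
          proof cases
            case 1 then show ?thesis using ysa(1) by simp
          next
            case 2 then show ?thesis unfolding Kb[symmetric] by simp
          next
            case 3
            then have "u = a \<and> v = b" by (rule no[OF uv(1)])
            then show ?thesis by simp
          next
            case 4
            then have "v = a \<and> u = b" by (rule no[OF vu])
            then show ?thesis by (simp add: insert_commute)
          qed
        qed
      qed
      moreover have "Xa \<union> Xb = X" "Xa \<inter> Xb = {}" using KX b unfolding Xa_def Xb_def by blast+
      ultimately show ?thesis using ysa(1,2) ysb(1,2) by (intro exI[of _ "ysa @ ysb"]) simp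
    next
      case True
      then obtain y0 where "y0 \<in> ?K" "y0 \<in> X" "{a, y0} \<in> E" by blast
      then obtain y where y: "y \<in> ?K" "y \<in> X" "{a, y} \<in> E"
        and sep: "\<And>y'. y' \<in> X \<Longrightarrow> {a, y'} \<in> E \<Longrightarrow> y' \<noteq> y \<Longrightarrow> y' \<notin> component E (insert b X - {y}) b"
        using separating_neighbour[OF tf fin a b ab out] by blast
      let ?B = "component E (insert b X - {y}) b"
      have yb: "y \<noteq> b" using y b by auto
      have BX: "?B \<subseteq> insert b X - {y}" using yb by (intro component_subset) auto
      define X2 where "X2 = ?B - {b}"
      define X1 where "X1 = X - X2 - {y}"
      have XX: "X = X1 \<union> {y} \<union> X2" "X1 \<inter> X2 = {}" "y \<notin> X1" "y \<notin> X2" "b \<notin> X1" "b \<notin> X2" "a \<notin> X1" "a \<notin> X2"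
        using BX y a b by (auto simp: X1_def X2_def)
      obtain t where t: "walk E (t @ [b])" "distinct (t @ [b])" "set (t @ [b]) \<subseteq> insert b X" "hd (t @ [b]) = y"
        using component_path[OF y(1)] by auto
      obtain t' where t': "t = y # t'" using t(4) yb by (cases t) auto
      have "set (rev (t' @ [b])) \<subseteq> ?B"
      proof (rule component_walk)
        show "walk E (rev (t' @ [b]))" unfolding walk_rev using t(1) t' by (cases t') auto
        show "set (rev (t' @ [b])) \<subseteq> insert b X - {y}" using t t' by auto
        show "hd (rev (t' @ [b])) \<in> ?B" by simp
      qed
      then have tB: "set t' \<subseteq> X2" using t t' by (auto simp: X2_def)
      obtain l where l: "distinct l" "set l \<inter> ({a, b} \<union> X) = {}" "walk E (a # l @ [b])"
        using out unfolding outer_def by blast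
      \<comment> \<open>Outer paths for the two blocks: from \<open>a\<close> along the old path to
        \<open>b\<close> and back to \<open>y\<close> through \<open>X2\<close>; from
        \<open>y\<close> to \<open>a\<close> and along the old path to \<open>b\<close>. Both have
        inner vertices.\<close>
      have out1: "outer E a y X1"
        unfolding outer_def
      proof (intro exI[of _ "l @ b # rev t'"] conjI)
        show "distinct (l @ b # rev t')" using l t t' tB XX by auto
        show "set (l @ b # rev t') \<inter> ({a, y} \<union> X1) = {}" using l tB XX ab yb by auto
        have "walk E (rev (t @ [b]))" unfolding walk_rev by (rule t(1))
        then have "walk E ((a # l) @ b # (rev t' @ [y]))" using l(3) t' by - (rule walk_append_shared, auto)
        then show "walk E (a # (l @ b # rev t') @ [y])" by simp
      qed simp
      have out2: "outer E y b X2"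
        unfolding outer_def
      proof (intro exI[of _ "a # l"] conjI)
        show "distinct (a # l)" "set (a # l) \<inter> ({y, b} \<union> X2) = {}" using l XX ab a y by auto
        show "walk E (y # (a # l) @ [b])" using l(3) y(3) by (simp add: insert_commute)
      qed simp
      have "X1 \<subset> X" "X2 \<subset> X" using XX by auto
      obtain ys1 where ys1: "set ys1 = X1" "distinct ys1" "noncrossing E (a # ys1 @ [y])"
        using IH2[OF \<open>X1 \<subset> X\<close> _ _ _ out1] XX a y by auto
      obtain ys2 where ys2: "set ys2 = X2" "distinct ys2" "noncrossing E (y # ys2 @ [b])"
        using IH2[OF \<open>X2 \<subset> X\<close> _ _ _ out2] XX yb by auto
      have "noncrossing E ((a # ys1) @ y # (ys2 @ [b]))"
      proof (rule noncrossing_glue)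
        show "noncrossing E ((a # ys1) @ [y])" "noncrossing E (y # ys2 @ [b])" using ys1 ys2 by auto
        show "distinct ((a # ys1) @ y # ys2 @ [b])" using ys1 ys2 XX a b ab y yb by auto
        show "{u, v} \<subseteq> set ((a # ys1) @ [y]) \<or> {u, v} \<subseteq> set (y # ys2 @ [b]) \<or>
          {u, v} = {hd ((a # ys1) @ y # ys2 @ [b]), last ((a # ys1) @ y # ys2 @ [b])}"
          if uv: "{u, v} \<in> E" "u \<in> set ((a # ys1) @ y # ys2 @ [b])" "v \<in> set ((a # ys1) @ y # ys2 @ [b])" for u v
        proof -
          have BX2: "?B = insert b X2" by (simp add: X2_def insert_absorb)
          have no: "s = a \<and> t = b" if st: "{s, t} \<in> E" "s \<in> insert a X1" "t \<in> ?B" for s t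
          proof (cases "s = a")
            case True
            have "t \<in> insert b X" "t \<noteq> y" using BX st(3) by blast+
            then show ?thesis using sep[of t] True st by blast
          next
            case neq: False
            then have s: "s \<in> insert b X - {y}" "s \<notin> ?B" using st(2) XX unfolding BX2 by auto
            have "t \<in> insert b X - {y}" using BX st(3) by blast
            moreover have "{t, s} \<in> E" using st(1) by (simp add: insert_commute)
            ultimately have "s \<in> ?B" using component_step[OF st(3)] s(1) by blast
            then show ?thesis using s(2) by blast
          qed
          have vu: "{v, u} \<in> E" using uv(1) by (simp add: insert_commute)
          have mem: "u \<in> insert a X1 \<or> u \<in> ?B \<or> u = y" "v \<in> insert a X1 \<or> v \<in> ?B \<or> v = y"
            using uv(2,3) ys1(1) ys2(1) unfolding BX2 by auto
          consider "u \<in> insert a X1 \<union> {y}" "v \<in> insert a X1 \<union> {y}" | "u \<in> ?B \<union> {y}" "v \<in> ?B \<union> {y}"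
            | "u \<in> insert a X1" "v \<in> ?B" | "v \<in> insert a X1" "u \<in> ?B" using mem by blast
          then show ?thesis
          proof cases
            case 1 then show ?thesis using ys1(1) by auto
          next
            case 2 then show ?thesis unfolding BX2 using ys2(1) by auto
          next
            case 3
            then have "u = a \<and> v = b" by (rule no[OF uv(1)])
            then show ?thesis by simp
          next
            case 4
            then have "v = a \<and> u = b" by (rule no[OF vu])
            then show ?thesis by (simp add: insert_commute)
          qed
        qed
      qed
      then show ?thesis using ys1 ys2 XX by (intro exI[of _ "ys1 @ y # ys2"]) auto
    qed
  qed
  ultimately show ?case by blast
qed

subsection \<open>Outerplanar drawings\<close>

lemma connected_subset_inside:
  fixes S :: "'a::real_normed_vector set"
  assumes "closed S" "connected T" "T \<inter> S = {}" "T \<inter> inside S \<noteq> {}"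
  shows "T \<subseteq> inside S"
proof -
  have "T \<subseteq> inside S \<union> outside S" using assms(3) by auto
  moreover have "inside S \<inter> outside S \<inter> T = {}" by (simp add: inside_Int_outside)
  ultimately have "T \<inter> outside S = {}"
    using connectedD[OF assms(2) open_inside[OF assms(1)] open_outside[OF assms(1)]] assms(4) by blast
  then show ?thesis using \<open>T \<subseteq> inside S \<union> outside S\<close> by blast
qed

lemma arc_interior:
  assumes "arc c"
  shows "connected (path_image c - {pathstart c, pathfinish c})"
    "path_image c - {pathstart c, pathfinish c} \<noteq> {}"
    "path_image c \<subseteq> closure (path_image c - {pathstart c, pathfinish c})"
proof -
  have sp: "simple_path c" using assms by (rule arc_imp_simple_path)
  show "connected (path_image c - {pathstart c, pathfinish c})" by (rule connected_simple_path_endless[OF sp])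
  have e: "path_image c - {pathstart c, pathfinish c} = c ` {0<..<1}" by (rule simple_path_endless[OF sp])
  show "path_image c - {pathstart c, pathfinish c} \<noteq> {}" unfolding e by simp
  have "c ` {0..1} \<subseteq> closure (c ` {0<..<1})"
    by (rule image_closure_subset[of "{0<..<1::real}" c, unfolded closure_greaterThanLessThan[OF zero_less_one]])
      (use arc_imp_path[OF assms] in \<open>auto simp: path_def closure_subset\<close>)
  then show "path_image c \<subseteq> closure (path_image c - {pathstart c, pathfinish c})"
    unfolding e by (simp add: path_image_def)
qed

section \<open>Three arcs with common ends in the plane\<close>

locale theta_curve =
  fixes c1 c2 c3 :: "real \<Rightarrow> complex" and a b :: complex
  assumes arcs: "arc c1" "arc c2" "arc c3" and ab: "a \<noteq> b"
    and ends: "pathstart c1 = a" "pathfinish c1 = b" "pathstart c2 = a" "pathfinish c2 = b" "pathstart c3 = a" "pathfinish c3 = b"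
    and meet: "path_image c1 \<inter> path_image c2 = {a, b}" "path_image c1 \<inter> path_image c3 = {a, b}" "path_image c2 \<inter> path_image c3 = {a, b}"
begin

lemma rotate: "theta_curve c2 c3 c1 a b"
  using arcs ab ends meet by unfold_locales auto

lemma jordan:
  shows "simple_path (c1 +++ reversepath c2)" "pathfinish (c1 +++ reversepath c2) = pathstart (c1 +++ reversepath c2)"
    "path_image (c1 +++ reversepath c2) = path_image c1 \<union> path_image c2"
  using arcs ends meet by (auto simp: simple_path_join_loop_eq arc_reversepath path_image_join)

lemma closed12: "closed (path_image c1 \<union> path_image c2)"
  using arcs by (intro closed_Un closed_arc_image)

text \<open>Working with the winding numbers of the three arcs instead of the closed curves builds
  in their additivity.\<close>

lemma winding_eq:
  assumes "z \<notin> path_image c1" "z \<notin> path_image c2"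
  shows "winding_number (c1 +++ reversepath c2) z = winding_number c1 z - winding_number c2 z"
  using assms arcs ends by (simp add: winding_number_join winding_number_reversepath arc_imp_path)

lemma winding_inside:
  assumes "z \<in> inside (path_image c1 \<union> path_image c2)"
  shows "winding_number c1 z \<noteq> winding_number c2 z"
proof -
  have z: "z \<notin> path_image c1" "z \<notin> path_image c2" using assms inside_no_overlap by blast+
  have "norm (winding_number (c1 +++ reversepath c2) z) = 1"
    using jordan assms by (intro simple_closed_path_norm_winding_number_inside) auto
  then show ?thesis using winding_eq[OF z] by auto
qed

lemma winding_outside:
  assumes "z \<notin> path_image c1" "z \<notin> path_image c2" "z \<notin> inside (path_image c1 \<union> path_image c2)"
  shows "winding_number c1 z = winding_number c2 z"
proof -
  have "z \<in> outside (path_image c1 \<union> path_image c2)" using assms inside_Un_outside by blast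
  then have "winding_number (c1 +++ reversepath c2) z = 0"
    using jordan by (intro winding_number_zero_in_outside) (auto simp: simple_path_imp_path)
  then show ?thesis using winding_eq assms by auto
qed

lemma interior_inside:
  assumes "path_image c3 \<inter> inside (path_image c1 \<union> path_image c2) \<noteq> {}"
  shows "path_image c3 - {a, b} \<subseteq> inside (path_image c1 \<union> path_image c2)"
proof (rule connected_subset_inside[OF closed12])
  show "connected (path_image c3 - {a, b})" using arc_interior(1)[OF arcs(3)] ends by simp
  show "(path_image c3 - {a, b}) \<inter> (path_image c1 \<union> path_image c2) = {}" using meet by auto
  have "{a, b} \<inter> inside (path_image c1 \<union> path_image c2) = {}" using meet(1) inside_no_overlap by blast
  then show "(path_image c3 - {a, b}) \<inter> inside (path_image c1 \<union> path_image c2) \<noteq> {}" using assms by blast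
qed

text \<open>Insides are connected. If two of them overlap and neither is entered by the remaining
  arc of the other curve, each contains the other; then their boundaries agree, and
  \<open>c1\<close> would consist of its two ends.\<close>

lemma insides_disjoint:
  assumes "path_image c3 \<inter> inside (path_image c1 \<union> path_image c2) = {}"
    and "path_image c1 \<inter> inside (path_image c2 \<union> path_image c3) = {}"
  shows "inside (path_image c1 \<union> path_image c2) \<inter> inside (path_image c2 \<union> path_image c3) = {}"
proof (rule ccontr)
  interpret r: theta_curve c2 c3 c1 a b by (rule rotate)
  assume ne: "inside (path_image c1 \<union> path_image c2) \<inter> inside (path_image c2 \<union> path_image c3) \<noteq> {}"
  note J = Jordan_inside_outside[OF jordan(1,2), unfolded jordan(3)]
  note J' = Jordan_inside_outside[OF r.jordan(1,2), unfolded r.jordan(3)]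
  have no: "inside S \<inter> S = {}" for S :: "complex set" by (rule inside_no_overlap)
  have "inside (path_image c1 \<union> path_image c2) \<subseteq> inside (path_image c2 \<union> path_image c3)"
    by (rule connected_subset_inside[OF r.closed12]) (use J ne assms(1) no[of "path_image c1 \<union> path_image c2"] in blast)+
  moreover have "inside (path_image c2 \<union> path_image c3) \<subseteq> inside (path_image c1 \<union> path_image c2)"
    by (rule connected_subset_inside[OF closed12]) (use J' ne assms(2) no[of "path_image c2 \<union> path_image c3"] in blast)+
  ultimately have "inside (path_image c1 \<union> path_image c2) = inside (path_image c2 \<union> path_image c3)" by (rule equalityI)
  then have "path_image c1 \<union> path_image c2 = path_image c2 \<union> path_image c3" using J J' by metis
  then have "path_image c1 \<subseteq> {a, b}" using meet by blast
  then show False using arc_interior(2)[OF arcs(1)] ends by auto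
qed

text \<open>The winding numbers of the three closed curves add up to zero, so a point inside one of them
  is inside another one.\<close>

lemma some_arc_inside:
  "path_image c3 \<inter> inside (path_image c1 \<union> path_image c2) \<noteq> {} \<or>
   path_image c1 \<inter> inside (path_image c2 \<union> path_image c3) \<noteq> {} \<or>
   path_image c2 \<inter> inside (path_image c3 \<union> path_image c1) \<noteq> {}"
proof (rule ccontr)
  interpret r: theta_curve c2 c3 c1 a b by (rule rotate)
  interpret r': theta_curve c3 c1 c2 a b by (rule r.rotate)
  assume "\<not> ?thesis"
  then have n: "path_image c3 \<inter> inside (path_image c1 \<union> path_image c2) = {}"
    "path_image c1 \<inter> inside (path_image c2 \<union> path_image c3) = {}"
    "path_image c2 \<inter> inside (path_image c3 \<union> path_image c1) = {}" by auto
  obtain z where z: "z \<in> inside (path_image c1 \<union> path_image c2)"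
    using Jordan_inside_outside[OF jordan(1,2), unfolded jordan(3)] by blast
  have off: "z \<notin> path_image c1" "z \<notin> path_image c2" "z \<notin> path_image c3"
    using z n(1) inside_no_overlap[of "path_image c1 \<union> path_image c2"] by blast+
  have "z \<notin> inside (path_image c2 \<union> path_image c3)" using insides_disjoint[OF n(1,2)] z by blast
  moreover have "z \<notin> inside (path_image c3 \<union> path_image c1)" using r'.insides_disjoint[OF n(3,1)] z by blast
  ultimately have "winding_number c1 z = winding_number c2 z"
    using r.winding_outside r'.winding_outside off by metis
  then show False using winding_inside[OF z] by simp
qed

end

section \<open>Walks of the graph as arcs of the drawing\<close>

fun walk_edges :: "'v list \<Rightarrow> 'v set set" where
  "walk_edges (x # y # zs) = insert {x, y} (walk_edges (y # zs))"
| "walk_edges _ = {}"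

lemma walk_edges_subset: "walk E xs \<Longrightarrow> walk_edges xs \<subseteq> E"
  by (induction xs rule: walk_edges.induct) auto

lemma walk_edges_set: "e \<in> walk_edges xs \<Longrightarrow> e \<subseteq> set xs"
  by (induction xs rule: walk_edges.induct) auto

lemma set_walk_edges: "2 \<le> length xs \<Longrightarrow> set xs \<subseteq> \<Union>(walk_edges xs)"
proof (induction xs rule: walk_edges.induct)
  case (1 x y zs)
  then show ?case by (cases zs) auto
qed auto

lemma walk_edges_append: "walk_edges (xs @ y # ys) = walk_edges (xs @ [y]) \<union> walk_edges (y # ys)"
proof (induction xs)
  case (Cons x xs)
  then show ?case by (cases xs) auto
qed simp

lemma walk_edges_rev: "walk_edges (rev xs) = walk_edges xs"
proof (induction xs rule: walk_edges.induct)
  case (1 x y zs)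
  have "walk_edges (rev (x # y # zs)) = walk_edges (rev zs @ y # [x])" by simp
  also have "\<dots> = walk_edges (rev (y # zs)) \<union> walk_edges [y, x]" by (subst walk_edges_append) simp
  finally show ?case using 1 by (simp add: insert_commute)
qed auto

lemma ends_not_walk_edge:
  assumes "distinct (a # l @ [b])" "l \<noteq> []" shows "{a, b} \<notin> walk_edges (a # l @ [b])"
proof -
  obtain x l' where l: "l = x # l'" using assms(2) by (cases l) auto
  have "a \<notin> e" if "e \<in> walk_edges (l @ [b])" for e using walk_edges_set[OF that] assms(1) by auto
  then have "{a, b} \<notin> walk_edges (l @ [b])" by blast
  then show ?thesis using assms(1) l by (auto simp: doubleton_eq_iff)
qed

locale outerplanar_drawing =
  fixes V :: "'v set" and E :: "'v set set" and p \<gamma>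
  assumes gr: "simple_graph V E" and dr: "plane_drawing V E p \<gamma>"
    and out: "p ` V \<subseteq> frontier (outside (drawing_image V E p \<gamma>))"
begin

definition curve :: "'v set set \<Rightarrow> complex set" where
  "curve F = (\<Union>e\<in>F. path_image (\<gamma> e))"

lemma inj_p: "inj_on p V"
  and edge_arc: "e \<in> E \<Longrightarrow> arc (\<gamma> e)" "e \<in> E \<Longrightarrow> {pathstart (\<gamma> e), pathfinish (\<gamma> e)} = p ` e"
  and edge_vertices: "e \<in> E \<Longrightarrow> path_image (\<gamma> e) \<inter> p ` V = p ` e"
  and edges_meet: "e \<in> E \<Longrightarrow> f \<in> E \<Longrightarrow> e \<noteq> f \<Longrightarrow> path_image (\<gamma> e) \<inter> path_image (\<gamma> f) = p ` (e \<inter> f)"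
  using dr unfolding plane_drawing_def by simp_all

lemma edge_sub: "e \<in> E \<Longrightarrow> e \<subseteq> V" and edge_card: "e \<in> E \<Longrightarrow> card e = 2"
  using gr by (auto simp: simple_graph_def)

lemma walk_in_V:
  assumes "walk E xs" "2 \<le> length xs" shows "set xs \<subseteq> V"
  using set_walk_edges[OF assms(2)] walk_edges_subset[OF assms(1)] edge_sub by blast

lemma p_in_curve_iff:
  assumes "walk E xs" "2 \<le> length xs" "v \<in> V" shows "p v \<in> curve (walk_edges xs) \<longleftrightarrow> v \<in> set xs"
proof
  assume "v \<in> set xs"
  then obtain e where e: "e \<in> walk_edges xs" "v \<in> e" using set_walk_edges[OF assms(2)] by blast
  then have "e \<in> E" using walk_edges_subset[OF assms(1)] by blast
  then show "p v \<in> curve (walk_edges xs)" using edge_vertices[of e] e unfolding curve_def by blast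
next
  assume "p v \<in> curve (walk_edges xs)"
  then obtain e where e: "e \<in> walk_edges xs" "p v \<in> path_image (\<gamma> e)" unfolding curve_def by blast
  then have eE: "e \<in> E" using walk_edges_subset[OF assms(1)] by blast
  then have "p v \<in> p ` e" using edge_vertices[of e] e assms(3) by blast
  then have "v \<in> e" using inj_onD[OF inj_p, of v] edge_sub[OF eE] assms(3) by blast
  then show "v \<in> set xs" using walk_edges_set[OF e(1)] by blast
qed

lemma curves_meet:
  assumes "F \<subseteq> E" "F' \<subseteq> E" "F \<inter> F' = {}" "\<Union>F \<inter> \<Union>F' \<subseteq> A"
  shows "curve F \<inter> curve F' \<subseteq> p ` A"
proof
  fix x assume "x \<in> curve F \<inter> curve F'"
  then obtain e f where ef: "e \<in> F" "f \<in> F'" "x \<in> path_image (\<gamma> e)" "x \<in> path_image (\<gamma> f)"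
    unfolding curve_def by blast
  then have "e \<noteq> f" "e \<in> E" "f \<in> E" using assms by blast+
  then have "x \<in> p ` (e \<inter> f)" using edges_meet ef by blast
  then show "x \<in> p ` A" using ef assms(4) by blast
qed

lemma walks_meet:
  assumes "walk E xs" "walk E ys" "walk_edges xs \<inter> walk_edges ys = {}"
  shows "curve (walk_edges xs) \<inter> curve (walk_edges ys) \<subseteq> p ` (set xs \<inter> set ys)"
  by (rule curves_meet) (use assms walk_edges_subset walk_edges_set in blast)+

lemma edge_path:
  assumes "{x, y} \<in> E" "x \<noteq> y"
  shows "\<exists>g. arc g \<and> pathstart g = p x \<and> pathfinish g = p y \<and> path_image g = path_image (\<gamma> {x, y})"
proof -
  have e: "{pathstart (\<gamma> {x, y}), pathfinish (\<gamma> {x, y})} = {p x, p y}" using edge_arc(2)[OF assms(1)] by simp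
  then consider "pathstart (\<gamma> {x, y}) = p x" "pathfinish (\<gamma> {x, y}) = p y"
    | "pathstart (\<gamma> {x, y}) = p y" "pathfinish (\<gamma> {x, y}) = p x" by (auto simp: doubleton_eq_iff)
  then show ?thesis
  proof cases
    case 1
    then show ?thesis using edge_arc(1)[OF assms(1)] by (intro exI[of _ "\<gamma> {x, y}"]) auto
  next
    case 2
    then show ?thesis using edge_arc(1)[OF assms(1)]
      by (intro exI[of _ "reversepath (\<gamma> {x, y})"]) (auto simp: arc_reversepath)
  qed
qed

lemma walk_path:
  assumes "walk E xs" "distinct xs" "2 \<le> length xs"
  shows "\<exists>g. arc g \<and> pathstart g = p (hd xs) \<and> pathfinish g = p (last xs) \<and> path_image g = curve (walk_edges xs)"
  using assms
proof (induction xs rule: walk_edges.induct)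
  case (1 x y zs)
  have e: "{x, y} \<in> E" "x \<noteq> y" using 1 by auto
  obtain h where h: "arc h" "pathstart h = p x" "pathfinish h = p y" "path_image h = path_image (\<gamma> {x, y})"
    using edge_path[OF e] by blast
  show ?case
  proof (cases zs)
    case Nil
    then show ?thesis using h by (intro exI[of _ h]) (auto simp: curve_def)
  next
    case (Cons z ws)
    then obtain g where g: "arc g" "pathstart g = p y" "pathfinish g = p (last (y # zs))" "path_image g = curve (walk_edges (y # zs))"
      using 1 by auto
    have "walk_edges [x, y] \<inter> walk_edges (y # zs) = {}"
      using walk_edges_set[of "{x, y}" "y # zs"] 1(3) by auto
    then have "path_image h \<inter> path_image g \<subseteq> p ` (set [x, y] \<inter> set (y # zs))"
      using walks_meet[of "[x, y]" "y # zs"] 1(2) e h(4) g(4) by (auto simp: curve_def)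
    also have "\<dots> \<subseteq> {p y}" using 1(3) by auto
    finally have "arc (h +++ g)" using h g by (intro arc_join) auto
    moreover have "path_image (h +++ g) = curve (walk_edges (x # y # zs))"
      using h g by (subst path_image_join) (auto simp: curve_def)
    ultimately show ?thesis using h g by (intro exI[of _ "h +++ g"]) auto
  qed
qed auto

text \<open>This is where outerplanarity enters. The inside of a closed part of the drawing is open
  and misses the outer face, hence also its closure, which contains every vertex.\<close>

lemma vertex_not_inside:
  assumes "v \<in> V" "F \<subseteq> E" "closed (curve F)" shows "p v \<notin> inside (curve F)"
proof
  assume i: "p v \<in> inside (curve F)"
  let ?D = "drawing_image V E p \<gamma>"
  have "curve F \<subseteq> ?D" using assms(2) unfolding curve_def drawing_image_def by blast
  then have "outside ?D \<subseteq> outside (curve F)" by (rule outside_mono)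
  then have "inside (curve F) \<inter> outside ?D = {}" using inside_Int_outside[of "curve F"] by blast
  then have "inside (curve F) \<inter> closure (outside ?D) = {}"
    using open_Int_closure_eq_empty[OF open_inside[OF assms(3)]] by blast
  moreover have "p v \<in> closure (outside ?D)" using out assms(1) by (auto simp: frontier_def)
  ultimately show False using i by blast
qed

text \<open>The third path may be a single edge, as needed for chords. A common edge of two of the
  paths would have to join \<open>a\<close> and \<open>z\<close>, but a path with inner vertices
  does not use that edge.\<close>

lemma theta_curve_walks:
  assumes w: "walk E (a # l1 @ [z])" "walk E (a # l2 @ [z])" "walk E (a # l3 @ [z])"
    and dist: "distinct (a # z # l1 @ l2 @ l3)" and ne: "l1 \<noteq> []" "l2 \<noteq> []"
  shows "\<exists>c1 c2 c3. theta_curve c1 c2 c3 (p a) (p z) \<and> path_image c1 = curve (walk_edges (a # l1 @ [z])) \<and>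
    path_image c2 = curve (walk_edges (a # l2 @ [z])) \<and> path_image c3 = curve (walk_edges (a # l3 @ [z]))"
proof -
  obtain c1 where c1: "arc c1" "pathstart c1 = p a" "pathfinish c1 = p z" "path_image c1 = curve (walk_edges (a # l1 @ [z]))"
    using walk_path[OF w(1)] dist by auto
  obtain c2 where c2: "arc c2" "pathstart c2 = p a" "pathfinish c2 = p z" "path_image c2 = curve (walk_edges (a # l2 @ [z]))"
    using walk_path[OF w(2)] dist by auto
  obtain c3 where c3: "arc c3" "pathstart c3 = p a" "pathfinish c3 = p z" "path_image c3 = curve (walk_edges (a # l3 @ [z]))"
    using walk_path[OF w(3)] dist by auto
  have disj: "walk_edges (a # l @ [z]) \<inter> walk_edges (a # l' @ [z]) = {}"
    if l: "walk E (a # l @ [z])" "distinct (a # z # l @ l')" "l \<noteq> []" for l l'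
  proof (rule ccontr)
    assume "walk_edges (a # l @ [z]) \<inter> walk_edges (a # l' @ [z]) \<noteq> {}"
    then obtain e where e: "e \<in> walk_edges (a # l @ [z])" "e \<in> walk_edges (a # l' @ [z])" by blast
    then have "e \<subseteq> {a, z}" using walk_edges_set[OF e(1)] walk_edges_set[OF e(2)] l(2) by auto
    moreover have "card e = 2" using edge_card walk_edges_subset[OF l(1)] e(1) by blast
    ultimately have "e = {a, z}" using l(2) by (intro card_seteq) auto
    then show False using ends_not_walk_edge[of a l z] e(1) l by auto
  qed
  have m: "path_image c \<inter> path_image c' = {p a, p z}"
    if c: "arc c" "pathstart c = p a" "pathfinish c = p z" "path_image c = curve (walk_edges (a # l @ [z]))"
      "arc c'" "pathstart c' = p a" "pathfinish c' = p z" "path_image c' = curve (walk_edges (a # l' @ [z]))"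
      and l: "walk E (a # l @ [z])" "walk E (a # l' @ [z])" "distinct (a # z # l @ l')" "l \<noteq> []" for c c' l l'
  proof
    have "path_image c \<inter> path_image c' \<subseteq> p ` (set (a # l @ [z]) \<inter> set (a # l' @ [z]))"
      unfolding c by (rule walks_meet[OF l(1,2) disj[OF l(1,3,4)]])
    also have "\<dots> \<subseteq> {p a, p z}" using l(3) by auto
    finally show "path_image c \<inter> path_image c' \<subseteq> {p a, p z}" .
    show "{p a, p z} \<subseteq> path_image c \<inter> path_image c'"
      using c(2,3,6,7) pathstart_in_path_image[of c] pathfinish_in_path_image[of c]
        pathstart_in_path_image[of c'] pathfinish_in_path_image[of c'] by simp
  qed
  have aV: "a \<in> V" "z \<in> V" using walk_in_V[OF w(1)] by auto
  have "theta_curve c1 c2 c3 (p a) (p z)"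
  proof
    show "p a \<noteq> p z" using inj_onD[OF inj_p _ aV] dist by auto
    show "path_image c1 \<inter> path_image c2 = {p a, p z}" by (rule m[OF c1 c2 w(1,2)]) (use dist ne in auto)
    show "path_image c1 \<inter> path_image c3 = {p a, p z}" by (rule m[OF c1 c3 w(1,3)]) (use dist ne in auto)
    show "path_image c2 \<inter> path_image c3 = {p a, p z}" by (rule m[OF c2 c3 w(2,3)]) (use dist ne in auto)
  qed (use c1 c2 c3 in auto)
  then show ?thesis using c1 c2 c3 by blast
qed

text \<open>An arc entering the inside runs there entirely, up to its ends, and would take the first
  inner vertex of the path with it.\<close>

lemma path_not_inside:
  assumes th: "theta_curve c1 c2 c3 (p a) (p z)" and im: "path_image c1 = curve F1" "path_image c2 = curve F2" "F1 \<subseteq> E" "F2 \<subseteq> E"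
    and w: "walk E (a # l @ [z])" "distinct (a # l @ [z])" "l \<noteq> []" "path_image c3 = curve (walk_edges (a # l @ [z]))"
  shows "path_image c3 \<inter> inside (path_image c1 \<union> path_image c2) = {}"
proof (rule ccontr)
  interpret theta_curve c1 c2 c3 "p a" "p z" by (rule th)
  assume "path_image c3 \<inter> inside (path_image c1 \<union> path_image c2) \<noteq> {}"
  then have i: "path_image c3 - {p a, p z} \<subseteq> inside (path_image c1 \<union> path_image c2)" by (rule interior_inside)
  have V: "set (a # l @ [z]) \<subseteq> V" using walk_in_V[OF w(1)] by simp
  have v: "hd l \<in> set l" using w(3) by simp
  then have vV: "hd l \<in> V" "a \<in> V" "z \<in> V" and ne: "hd l \<noteq> a" "hd l \<noteq> z" using V w(2) by auto
  have "p (hd l) \<in> path_image c3" unfolding w(4) using p_in_curve_iff[OF w(1) _ vV(1)] v by simp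
  moreover have "p (hd l) \<notin> {p a, p z}" using inj_onD[OF inj_p] vV ne by blast
  ultimately have "p (hd l) \<in> inside (curve (F1 \<union> F2))" using i im by (auto simp: curve_def image_Un)
  moreover have "curve (F1 \<union> F2) = path_image c1 \<union> path_image c2" using im by (auto simp: curve_def)
  ultimately show False using vertex_not_inside[OF vV(1), of "F1 \<union> F2"] im closed12 by auto
qed

lemma theta_free: "theta_free E"
  unfolding theta_free_def
proof (intro allI impI notI)
  fix a z l1 l2 l3
  assume ne: "l1 \<noteq> []" "l2 \<noteq> []" "l3 \<noteq> []" and dist: "distinct (a # z # l1 @ l2 @ l3)"
    and w: "walk E (a # l1 @ [z])" "walk E (a # l2 @ [z])" "walk E (a # l3 @ [z])"
  obtain c1 c2 c3 where th: "theta_curve c1 c2 c3 (p a) (p z)" and im: "path_image c1 = curve (walk_edges (a # l1 @ [z]))"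
    "path_image c2 = curve (walk_edges (a # l2 @ [z]))" "path_image c3 = curve (walk_edges (a # l3 @ [z]))"
    using theta_curve_walks[OF w dist ne(1,2)] by blast
  interpret theta_curve c1 c2 c3 "p a" "p z" by (rule th)
  interpret r: theta_curve c2 c3 c1 "p a" "p z" by (rule rotate)
  have d: "distinct (a # l1 @ [z])" "distinct (a # l2 @ [z])" "distinct (a # l3 @ [z])" using dist by auto
  note sub = walk_edges_subset[OF w(1)] walk_edges_subset[OF w(2)] walk_edges_subset[OF w(3)]
  show False
    using some_arc_inside path_not_inside[OF th im(1,2) sub(1,2) w(3) d(3) ne(3) im(3)]
      path_not_inside[OF rotate im(2,3) sub(2,3) w(1) d(1) ne(1) im(1)]
      path_not_inside[OF r.rotate im(3,1) sub(3,1) w(2) d(2) ne(2) im(2)] by blast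
qed

text \<open>A chord of a cycle is drawn inside of the cycle, since otherwise one of the two parts of the
  cycle, and hence a vertex, would be inside of the cycle formed by the chord and the other part.\<close>

lemma chord_inside:
  assumes w: "walk E (a # l1 @ [b])" "walk E (a # l2 @ [b])" and e: "{a, b} \<in> E"
    and dist: "distinct (a # b # l1 @ l2)" and ne: "l1 \<noteq> []" "l2 \<noteq> []"
  obtains c1 c2 c3 where "theta_curve c1 c2 c3 (p a) (p b)" "path_image c1 = curve (walk_edges (a # l1 @ [b]))"
    "path_image c2 = curve (walk_edges (a # l2 @ [b]))" "path_image c3 = path_image (\<gamma> {a, b})"
    "path_image c3 \<inter> inside (path_image c1 \<union> path_image c2) \<noteq> {}"
proof -
  have w3: "walk E (a # [] @ [b])" using e by simp
  have dist': "distinct (a # b # l1 @ l2 @ [])" using dist by simp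
  obtain c1 c2 c3 where th: "theta_curve c1 c2 c3 (p a) (p b)" and im: "path_image c1 = curve (walk_edges (a # l1 @ [b]))"
    "path_image c2 = curve (walk_edges (a # l2 @ [b]))" "path_image c3 = curve (walk_edges (a # [] @ [b]))"
    using theta_curve_walks[OF w w3 dist' ne] by blast
  interpret theta_curve c1 c2 c3 "p a" "p b" by (rule th)
  interpret r: theta_curve c2 c3 c1 "p a" "p b" by (rule rotate)
  have d: "distinct (a # l1 @ [b])" "distinct (a # l2 @ [b])" using dist by auto
  note sub = walk_edges_subset[OF w(1)] walk_edges_subset[OF w(2)] walk_edges_subset[OF w3]
  have "path_image c3 \<inter> inside (path_image c1 \<union> path_image c2) \<noteq> {}"
    using some_arc_inside path_not_inside[OF rotate im(2,3) sub(2,3) w(1) d(1) ne(1) im(1)]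
      path_not_inside[OF r.rotate im(3,1) sub(3,1) w(2) d(2) ne(2) im(2)] by blast
  then show thesis using that[OF th im(1,2)] im(3) by (simp add: curve_def)
qed

text \<open>Both chords are drawn inside of the same cycle. The chord \<open>ab\<close> divides this
  inside into two parts, and \<open>uv\<close>, disjoint from \<open>ab\<close>, stays in one of
  them, whose closure thus contains \<open>p u\<close> and \<open>p v\<close>. One of these points
  is not on the boundary of that part, and being a vertex it is not inside either.\<close>

lemma crossed_cycle_free: "crossed_cycle_free E"
  unfolding crossed_cycle_free_def
proof (intro allI impI notI)
  fix a b l1 l2 u v
  assume abE: "{a, b} \<in> E" and dist: "distinct (a # b # l1 @ l2)"
    and w: "walk E (a # l1 @ [b])" "walk E (a # l2 @ [b])" and uv: "u \<in> set l1" "v \<in> set l2" "{u, v} \<in> E"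
  have ne: "l1 \<noteq> []" "l2 \<noteq> []" using uv by auto
  obtain c1 c2 c3 where th: "theta_curve c1 c2 c3 (p a) (p b)" and im: "path_image c1 = curve (walk_edges (a # l1 @ [b]))"
    "path_image c2 = curve (walk_edges (a # l2 @ [b]))" "path_image c3 = path_image (\<gamma> {a, b})"
    and c3i: "path_image c3 \<inter> inside (path_image c1 \<union> path_image c2) \<noteq> {}"
    by (rule chord_inside[OF w abE dist ne])
  interpret theta_curve c1 c2 c3 "p a" "p b" by (rule th)
  obtain l1a l1b where l1: "l1 = l1a @ u # l1b" using split_list[OF uv(1)] by blast
  obtain l2a l2b where l2: "l2 = l2a @ v # l2b" using split_list[OF uv(2)] by blast
  have "walk E ((a # l1a @ [u]) @ l1b @ [b])" using w(1) l1 by simp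
  then have 1: "walk E (a # l1a @ [u])" by (rule walk_appendD)
  have "walk E ((a # l1a) @ (u # l1b @ [b]))" using w(1) l1 by simp
  then have 2: "walk E (u # l1b @ [b])" by (rule walk_appendD)
  have "walk E ((a # l2a @ [v]) @ l2b @ [b])" using w(2) l2 by simp
  then have 3: "walk E (a # l2a @ [v])" by (rule walk_appendD)
  have "walk E ((a # l2a) @ (v # l2b @ [b]))" using w(2) l2 by simp
  then have 4: "walk E (v # l2b @ [b])" by (rule walk_appendD)
  \<comment> \<open>The same cycle is cut at \<open>u\<close> and \<open>v\<close> instead of
    \<open>a\<close> and \<open>b\<close>, so that \<open>uv\<close> becomes the chord.\<close>
  have "walk E (rev (a # l1a @ [u]))" using 1 unfolding walk_rev .
  then have "walk E ((u # rev l1a) @ a # (l2a @ [v]))" using 3 by - (rule walk_append_shared, auto)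
  then have w1: "walk E (u # (rev l1a @ a # l2a) @ [v])" by simp
  have "walk E (rev (v # l2b @ [b]))" using 4 unfolding walk_rev .
  then have "walk E ((u # l1b) @ b # (rev l2b @ [v]))" using 2 by - (rule walk_append_shared, auto)
  then have w2: "walk E (u # (l1b @ b # rev l2b) @ [v])" by simp
  have dist': "distinct (u # v # (rev l1a @ a # l2a) @ (l1b @ b # rev l2b))" using dist l1 l2 by auto
  have ne': "rev l1a @ a # l2a \<noteq> []" "l1b @ b # rev l2b \<noteq> []" by simp_all
  obtain d1 d2 d3 where th': "theta_curve d1 d2 d3 (p u) (p v)" and im': "path_image d1 = curve (walk_edges (u # (rev l1a @ a # l2a) @ [v]))"
    "path_image d2 = curve (walk_edges (u # (l1b @ b # rev l2b) @ [v]))" "path_image d3 = path_image (\<gamma> {u, v})"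
    and d3i: "path_image d3 \<inter> inside (path_image d1 \<union> path_image d2) \<noteq> {}"
    by (rule chord_inside[OF w1 w2 uv(3) dist' ne'])
  interpret d: theta_curve d1 d2 d3 "p u" "p v" by (rule th')
  have "walk_edges ((u # rev l1a) @ a # (l2a @ [v])) = walk_edges (rev (a # l1a @ [u])) \<union> walk_edges (a # l2a @ [v])"
    by (subst walk_edges_append) simp
  moreover have "walk_edges ((u # l1b) @ b # (rev l2b @ [v])) = walk_edges (u # l1b @ [b]) \<union> walk_edges (rev (v # l2b @ [b]))"
    by (subst walk_edges_append) simp
  moreover have "walk_edges ((a # l1a) @ u # (l1b @ [b])) = walk_edges (a # l1a @ [u]) \<union> walk_edges (u # l1b @ [b])"
    by (subst walk_edges_append) simp
  moreover have "walk_edges ((a # l2a) @ v # (l2b @ [b])) = walk_edges (a # l2a @ [v]) \<union> walk_edges (v # l2b @ [b])"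
    by (subst walk_edges_append) simp
  ultimately have "walk_edges (u # (rev l1a @ a # l2a) @ [v]) \<union> walk_edges (u # (l1b @ b # rev l2b) @ [v])
     = walk_edges (a # l1 @ [b]) \<union> walk_edges (a # l2 @ [b])"
    unfolding l1 l2 walk_edges_rev by auto
  then have same: "path_image d1 \<union> path_image d2 = path_image c1 \<union> path_image c2"
    unfolding im im' curve_def by (simp flip: UN_Un)
  let ?f = "path_image d3 - {p u, p v}"
  have f_in: "?f \<subseteq> inside (path_image c1 \<union> path_image c2)" using d.interior_inside[OF d3i] unfolding same .
  have V: "a \<in> V" "b \<in> V" "u \<in> V" "v \<in> V" using edge_sub[OF abE] edge_sub[OF uv(3)] by auto
  have nab: "u \<notin> {a, b}" "v \<notin> {a, b}" using dist uv by auto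
  have f3: "path_image d3 \<inter> path_image c3 = {}"
  proof -
    have "{u, v} \<noteq> {a, b}" "{u, v} \<inter> {a, b} = {}" using nab by auto
    then show ?thesis using edges_meet[OF uv(3) abE] im(3) im'(3) by auto
  qed
  have off: "p u \<notin> path_image c2" "p v \<notin> path_image c1" "p u \<notin> path_image c3" "p v \<notin> path_image c3"
  proof -
    show "p u \<notin> path_image c2" unfolding im using p_in_curve_iff[OF w(2) _ V(3)] dist uv by auto
    show "p v \<notin> path_image c1" unfolding im using p_in_curve_iff[OF w(1) _ V(4)] dist uv by auto
    show "p u \<notin> path_image c3" "p v \<notin> path_image c3"
      using f3 d.ends pathstart_in_path_image[of d3] pathfinish_in_path_image[of d3] by auto
  qed
  let ?I1 = "inside (path_image c1 \<union> path_image c3)" and ?I2 = "inside (path_image c2 \<union> path_image c3)"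
  have "?I1 \<inter> ?I2 = {}" and un: "?I1 \<union> ?I2 \<union> (path_image c3 - {p a, p b}) = inside (path_image c1 \<union> path_image c2)"
    using split_inside_simple_closed_curve[OF arc_imp_simple_path[OF arcs(1)] ends(1,2) arc_imp_simple_path[OF arcs(2)] ends(3,4)
        arc_imp_simple_path[OF arcs(3)] ends(5,6) ab meet c3i] by blast+
  have cl: "closed (path_image c1 \<union> path_image c3)" "closed (path_image c2 \<union> path_image c3)"
    using arcs by (auto intro!: closed_Un closed_arc_image)
  have "?f \<subseteq> ?I1 \<union> ?I2" using f_in f3 un by blast
  then have "?f \<subseteq> ?I1 \<or> ?f \<subseteq> ?I2"
    using connectedD[OF arc_interior(1)[OF d.arcs(3)] open_inside[OF cl(1)] open_inside[OF cl(2)]] \<open>?I1 \<inter> ?I2 = {}\<close>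
    unfolding d.ends by blast
  moreover have uvcl: "p u \<in> closure ?f" "p v \<in> closure ?f"
    using arc_interior(3)[OF d.arcs(3)] d.ends pathstart_in_path_image[of d3] pathfinish_in_path_image[of d3] by auto
  moreover have "p v \<notin> closure ?I1"
  proof
    assume "p v \<in> closure ?I1"
    then have "p v \<in> ?I1" using closure_inside_subset[OF cl(1)] off by blast
    moreover have "path_image c1 \<union> path_image c3 = curve (insert {a, b} (walk_edges (a # l1 @ [b])))"
      unfolding im by (auto simp: curve_def)
    ultimately show False
      using vertex_not_inside[OF V(4), of "insert {a, b} (walk_edges (a # l1 @ [b]))"] cl(1) abE walk_edges_subset[OF w(1)] by auto
  qed
  moreover have "p u \<notin> closure ?I2"
  proof
    assume "p u \<in> closure ?I2"
    then have "p u \<in> ?I2" using closure_inside_subset[OF cl(2)] off by blast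
    moreover have "path_image c2 \<union> path_image c3 = curve (insert {a, b} (walk_edges (a # l2 @ [b])))"
      unfolding im by (auto simp: curve_def)
    ultimately show False
      using vertex_not_inside[OF V(3), of "insert {a, b} (walk_edges (a # l2 @ [b]))"] cl(2) abE walk_edges_subset[OF w(2)] by auto
  qed
  ultimately show False using closure_mono[of ?f ?I1] closure_mono[of ?f ?I2] by blast
qed

end

theorem mainTheorem5:
  fixes V :: "'v set" and E :: "'v set set"
  assumes "simple_graph V E" and "V \<noteq> {}" and "outerplanar V E"
  shows "d_Tverberg TYPE(2) (graph_complex V E)"
proof -
  obtain p \<gamma> where "plane_drawing V E p \<gamma>" "p ` V \<subseteq> frontier (outside (drawing_image V E p \<gamma>))"
    using assms(3) by (auto simp: outerplanar_def)
  then interpret outerplanar_drawing V E p \<gamma>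
    using assms(1) by unfold_locales
  obtain a where a: "a \<in> V" using assms(2) by blast
  have "finite (V - {a})" using assms(1) by (simp add: simple_graph_def)
  then obtain ys where ys: "set ys = V - {a}" "distinct ys" "noncrossing E (a # ys)"
    using noncrossing_order_exists[OF theta_free crossed_cycle_free, of "V - {a}"] by blast
  show ?thesis
    by (rule d_Tverberg_if_noncrossing[OF assms(1) _ _ _ ys(3)]) (use a ys(1,2) in auto)
qed

end
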